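(* Let $F$ be an algebraically closed field of odd characteristic. Let $\lambda$ be a partition of $n \in \mathbf{N}$. The Specht module $S^\lambda$ defined over $F$ is decomposable on restriction to the alternating group $A_n$ if and only if $S^\lambda$ is simple and $\lambda = \lambda'$, where $\lambda'$ is the conjugate partition of $\lambda$.
   Context: $\mathbf{N}$ is the set of natural numbers, $S_n$ is the symmetric group of degree $n$ and $A_n$ is its alternating subgroup. A partition of $n$ is a weakly decreasing sequence of positive integers with sum $n$; the conjugate $\lambda'$ is the partition whose Young diagram is the transpose of that of $\lambda$. The Specht module $S^\lambda$ is the submodule of the permutation $FS_n$-module $M^\lambda$ on $\lambda$-tabloids spanned by the polytabloids $e_t = \sum_{\pi \in C_t} \mathrm{sgn}(\pi)\, \{t\}\pi$, where $t$ runs over $\lambda$-tableaux, $\{t\}$ is the tabloid of $t$ and $C_t$ is its column stabiliser (James's convention). "Simple" means simple as an $FS_n$-module. A module is decomposable if it is a direct sum of two non-zero submodules.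
   Formalization: The formal theorem assumes n ≥ 2: for n = 1 (and n = 0) the Specht module is one-dimensional, hence simple, and the partition equals its conjugate, yet the module is not decomposable, so the claim as stated fails there. *)

theory Defs
  imports
    "HOL-Computational_Algebra.Computational_Algebra"
    "HOL-Library.FuncSet"
    "HOL-Library.Function_Algebras"
    "HOL-Algebra.Sym_Groups"
begin

section \<open>Partitions\<close>

definition is_partition :: "nat \<Rightarrow> nat list \<Rightarrow> bool" where
  "is_partition n lam \<longleftrightarrow> sorted_wrt (\<ge>) lam \<and> (\<forall>k\<in>set lam. 0 < k) \<and> sum_list lam = n"

text \<open>The box \<open>(i, j)\<close> lies in row \<open>i\<close> and column \<open>j\<close>, both counted from 0.\<close>

definition young_diagram :: "nat list \<Rightarrow> (nat \<times> nat) set" where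
  "young_diagram lam = {(i, j). i < length lam \<and> j < lam ! i}"

definition conjugate :: "nat list \<Rightarrow> nat list" where
  "conjugate lam = (case lam of [] \<Rightarrow> []
     | k # _ \<Rightarrow> map (\<lambda>j. length (filter (\<lambda>m. j < m) lam)) [0..<k])"


section \<open>Tableaux and tabloids\<close>

text \<open>
  A tableau is a bijection from the boxes to \<open>{1..n}\<close>, extended by \<open>undefined\<close> outside the
  diagram. James lets the symmetric group act on the right and composes permutations from left to
  right; the tableau obtained from \<open>t\<close> by replacing every entry \<open>k\<close> by its image under \<open>p\<close> is
  \<open>p \<circ> t\<close> here, for the right-to-left composition that \<^const>\<open>sym_group\<close> uses. Hence his right
  modules appear as left modules, with the same submodules.
\<close>

type_synonym tableau = "nat \<times> nat \<Rightarrow> nat"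
type_synonym tabloid = "tableau set"

definition tableaux :: "nat list \<Rightarrow> tableau set" where
  "tableaux lam = {t. bij_betw t (young_diagram lam) {1..sum_list lam}
     \<and> t \<in> extensional (young_diagram lam)}"

definition tableau_act :: "nat list \<Rightarrow> (nat \<Rightarrow> nat) \<Rightarrow> tableau \<Rightarrow> tableau" where
  "tableau_act lam p t = compose (young_diagram lam) p t"

text \<open>
  The permutations preserving each line of \<open>t\<close> setwise, where a line consists of the boxes
  on which \<open>pr\<close> takes a given value: the rows for \<open>pr = fst\<close>, the columns for \<open>pr = snd\<close>.
\<close>

definition line_stabiliser ::
    "(nat \<times> nat \<Rightarrow> nat) \<Rightarrow> nat list \<Rightarrow> tableau \<Rightarrow> (nat \<Rightarrow> nat) set" where
  "line_stabiliser pr lam t = {p. p permutes {1..sum_list lam} \<and>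
     (\<forall>r. p ` t ` {b \<in> young_diagram lam. pr b = r} = t ` {b \<in> young_diagram lam. pr b = r})}"

definition row_stabiliser :: "nat list \<Rightarrow> tableau \<Rightarrow> (nat \<Rightarrow> nat) set" where
  "row_stabiliser = line_stabiliser fst"

definition column_stabiliser :: "nat list \<Rightarrow> tableau \<Rightarrow> (nat \<Rightarrow> nat) set" where
  "column_stabiliser = line_stabiliser snd"

definition tabloid_of :: "nat list \<Rightarrow> tableau \<Rightarrow> tabloid" where
  "tabloid_of lam t = (\<lambda>p. tableau_act lam p t) ` row_stabiliser lam t"

definition tabloids :: "nat list \<Rightarrow> tabloid set" where
  "tabloids lam = tabloid_of lam ` tableaux lam"

definition tabloid_act :: "nat list \<Rightarrow> (nat \<Rightarrow> nat) \<Rightarrow> tabloid \<Rightarrow> tabloid" where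
  "tabloid_act lam p X = tableau_act lam p ` X"


section \<open>Submodules of a space of functions\<close>

definition fscale :: "'a::field \<Rightarrow> ('b \<Rightarrow> 'a) \<Rightarrow> 'b \<Rightarrow> 'a" where
  "fscale c f = (\<lambda>x. c * f x)"

interpretation fv: vector_space fscale
  by unfold_locales (auto simp: fscale_def fun_eq_iff algebra_simps)

text \<open>
  A subspace invariant under the operators \<open>act g\<close>, for \<open>g\<close> in the group \<open>G\<close>. Restricting
  a module to a subgroup changes \<open>G\<close> only.
\<close>

definition submodule ::
    "('g, 'z) monoid_scheme \<Rightarrow> ('g \<Rightarrow> ('b \<Rightarrow> 'a::field) \<Rightarrow> 'b \<Rightarrow> 'a) \<Rightarrow> ('b \<Rightarrow> 'a) set \<Rightarrow> bool" where
  "submodule G act W \<longleftrightarrow> fv.subspace W \<and> (\<forall>g\<in>carrier G. \<forall>w\<in>W. act g w \<in> W)"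

definition simple_module ::
    "('g, 'z) monoid_scheme \<Rightarrow> ('g \<Rightarrow> ('b \<Rightarrow> 'a::field) \<Rightarrow> 'b \<Rightarrow> 'a) \<Rightarrow> ('b \<Rightarrow> 'a) set \<Rightarrow> bool" where
  "simple_module G act W \<longleftrightarrow> submodule G act W \<and> W \<noteq> {0} \<and>
     (\<forall>U. submodule G act U \<and> U \<subseteq> W \<longrightarrow> U = {0} \<or> U = W)"

definition decomposable ::
    "('g, 'z) monoid_scheme \<Rightarrow> ('g \<Rightarrow> ('b \<Rightarrow> 'a::field) \<Rightarrow> 'b \<Rightarrow> 'a) \<Rightarrow> ('b \<Rightarrow> 'a) set \<Rightarrow> bool" where
  "decomposable G act W \<longleftrightarrow> (\<exists>U V. submodule G act U \<and> submodule G act V \<and>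
     U \<noteq> {0} \<and> V \<noteq> {0} \<and> U \<inter> V = {0} \<and> W = {u + v | u v. u \<in> U \<and> v \<in> V})"


section \<open>Permutation modules and Specht modules\<close>

text \<open>
  The free vector space on the tabloids is realised by functions vanishing off the tabloids.
\<close>

definition tabloid_vec :: "tabloid \<Rightarrow> tabloid \<Rightarrow> 'a::field" where
  "tabloid_vec X = (\<lambda>Y. of_bool (Y = X))"

definition perm_module :: "nat list \<Rightarrow> (tabloid \<Rightarrow> 'a::field) set" where
  "perm_module lam = fv.span (tabloid_vec ` tabloids lam)"

definition perm_act ::
    "nat list \<Rightarrow> (nat \<Rightarrow> nat) \<Rightarrow> (tabloid \<Rightarrow> 'a::field) \<Rightarrow> tabloid \<Rightarrow> 'a" where
  "perm_act lam p f = (\<Sum>X\<in>tabloids lam. fscale (f X) (tabloid_vec (tabloid_act lam p X)))"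

definition polytabloid :: "nat list \<Rightarrow> tableau \<Rightarrow> tabloid \<Rightarrow> 'a::field" where
  "polytabloid lam t = (\<Sum>p\<in>column_stabiliser lam t.
     fscale (of_int (sign p)) (tabloid_vec (tabloid_act lam p (tabloid_of lam t))))"

definition specht :: "nat list \<Rightarrow> (tabloid \<Rightarrow> 'a::field) set" where
  "specht lam = fv.span (polytabloid lam ` tableaux lam)"


section \<open>Consistency of the definitions\<close>

lemma less_length_filter_iff:
  assumes "sorted_wrt (\<ge>) (lam :: nat list)"
  shows "i < length (filter (\<lambda>m. j < m) lam) \<longleftrightarrow> i < length lam \<and> j < lam ! i"
  using assms
proof (induction lam arbitrary: i)
  case (Cons a lam)
  show ?case
  proof (cases "j < a")
    case True
    then show ?thesis using Cons by (cases i) auto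
  next
    case False
    then have "\<forall>m\<in>set lam. \<not> j < m" using Cons.prems by fastforce
    moreover from this have "filter (\<lambda>m. j < m) lam = []" by (simp add: filter_empty_conv)
    ultimately show ?thesis using False by (cases i) (auto simp: nth_mem)
  qed
qed simp

lemma young_diagram_conjugate:
  assumes "is_partition n lam"
  shows "young_diagram (conjugate lam) = (young_diagram lam)\<inverse>"
proof (cases lam)
  case Nil
  then show ?thesis by (simp add: young_diagram_def conjugate_def)
next
  case (Cons k ks)
  have s: "sorted_wrt (\<ge>) lam" using assms by (simp add: is_partition_def)
  have c: "conjugate lam = map (\<lambda>j. length (filter (\<lambda>m. j < m) lam)) [0..<k]"
    using Cons by (simp add: conjugate_def)
  have "lam ! i \<le> k" if "i < length lam" for i
    using that s Cons by (cases i) (auto dest: nth_mem)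
  then have "j < k" if "i < length lam" "j < lam ! i" for i j
    using that by fastforce
  then show ?thesis
    unfolding young_diagram_def c using less_length_filter_iff[OF s] by auto
qed

lemma card_young_diagram: "card (young_diagram lam) = sum_list lam"
proof -
  have "young_diagram lam = (SIGMA i:{..<length lam}. {..<lam ! i})"
    by (auto simp: young_diagram_def)
  then show ?thesis by (simp add: sum_list_sum_nth atLeast0LessThan)
qed

lemma is_partition_conjugate:
  assumes "is_partition n lam"
  shows "is_partition n (conjugate lam)"
proof (cases lam)
  case Nil
  then show ?thesis using assms by (simp add: conjugate_def)
next
  case (Cons k ks)
  have c: "conjugate lam = map (\<lambda>j. length (filter (\<lambda>m. j < m) lam)) [0..<k]"
    using Cons by (simp add: conjugate_def)
  have "length (filter (\<lambda>m. j < m) lam) \<le> length (filter (\<lambda>m. i < m) lam)" if "i \<le> j" for i j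
    using that by (induction lam) auto
  then have "sorted_wrt (\<ge>) (conjugate lam)"
    unfolding c by (simp add: sorted_wrt_iff_nth_less)
  moreover have "\<forall>k\<in>set (conjugate lam). 0 < k"
    unfolding c using Cons by auto
  moreover have "sum_list (conjugate lam) = n"
    using young_diagram_conjugate[OF assms] card_young_diagram[of lam]
      card_young_diagram[of "conjugate lam"] assms
    by (simp add: card_inverse is_partition_def)
  ultimately show ?thesis by (simp add: is_partition_def)
qed

lemma finite_young_diagram: "finite (young_diagram lam)"
proof -
  have "young_diagram lam = (SIGMA i:{..<length lam}. {..<lam ! i})"
    by (auto simp: young_diagram_def)
  then show ?thesis by simp
qed

lemma finite_tableaux: "finite (tableaux lam)"
proof (rule finite_subset)
  show "tableaux lam \<subseteq> (\<Pi>\<^sub>E b\<in>young_diagram lam. {1..sum_list lam})"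
    by (auto simp: tableaux_def PiE_def bij_betw_def)
  show "finite (\<Pi>\<^sub>E b\<in>young_diagram lam. {1..sum_list lam})"
    by (intro finite_PiE finite_young_diagram) simp
qed

lemma tableau_act_mem:
  assumes "t \<in> tableaux lam" "p permutes {1..sum_list lam}"
  shows "tableau_act lam p t \<in> tableaux lam"
proof -
  have "bij_betw (p \<circ> t) (young_diagram lam) {1..sum_list lam}"
    using assms by (auto simp: tableaux_def intro: bij_betw_trans permutes_imp_bij)
  then have "bij_betw (tableau_act lam p t) (young_diagram lam) {1..sum_list lam}"
    by (rule iffD1[OF bij_betw_cong, rotated]) (simp add: tableau_act_def compose_def)
  then show ?thesis
    by (simp add: tableaux_def tableau_act_def)
qed

lemma tableau_act_comp:
  "tableau_act lam p (tableau_act lam q t) = tableau_act lam (p \<circ> q) t"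
  by (auto simp: tableau_act_def compose_def fun_eq_iff)

lemma tableau_act_image:
  "A \<subseteq> young_diagram lam \<Longrightarrow> tableau_act lam p t ` A = p ` t ` A"
  by (auto simp: tableau_act_def compose_def image_image intro!: image_cong)

lemma line_stabiliser_act:
  assumes p: "p permutes {1..sum_list lam}"
  shows "line_stabiliser pr lam (tableau_act lam p t) =
    (\<lambda>q. p \<circ> q \<circ> inv' p) ` line_stabiliser pr lam t"
proof -
  have ip: "inv' p permutes {1..sum_list lam}" using p by (rule permutes_inv)
  have pi: "p \<circ> inv' p = id" "inv' p \<circ> p = id"
    using permutes_inv_o[OF p] by auto
  have L: "tableau_act lam p t ` {b \<in> young_diagram lam. pr b = r} =
      p ` t ` {b \<in> young_diagram lam. pr b = r}" for r
    by (rule tableau_act_image) auto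
  have 1: "p \<circ> q \<circ> inv' p \<in> line_stabiliser pr lam (tableau_act lam p t)"
    if "q \<in> line_stabiliser pr lam t" for q
  proof -
    have q: "q permutes {1..sum_list lam}"
      and Q: "\<And>r. q ` t ` {b \<in> young_diagram lam. pr b = r} = t ` {b \<in> young_diagram lam. pr b = r}"
      using that by (auto simp: line_stabiliser_def)
    have "(p \<circ> q \<circ> inv' p) ` p ` A = p ` q ` A" for A
      using permutes_inverses(2)[OF p] by (simp add: image_image)
    then have "(p \<circ> q \<circ> inv' p) ` p ` t ` {b \<in> young_diagram lam. pr b = r} =
        p ` t ` {b \<in> young_diagram lam. pr b = r}" for r
      by (simp only: Q)
    moreover have "p \<circ> q \<circ> inv' p permutes {1..sum_list lam}"
      by (intro permutes_compose ip q p)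
    ultimately show ?thesis
      unfolding line_stabiliser_def L by blast
  qed
  have 2: "inv' p \<circ> q \<circ> p \<in> line_stabiliser pr lam t"
    if "q \<in> line_stabiliser pr lam (tableau_act lam p t)" for q
  proof -
    have q: "q permutes {1..sum_list lam}"
      and Q: "\<And>r. q ` p ` t ` {b \<in> young_diagram lam. pr b = r} =
        p ` t ` {b \<in> young_diagram lam. pr b = r}"
      using that unfolding line_stabiliser_def L by auto
    have "(inv' p \<circ> q \<circ> p) ` A = inv' p ` q ` p ` A" for A
      by (simp add: image_comp comp_assoc)
    moreover have "inv' p ` p ` A = A" for A
      using pi(2) by (simp add: image_comp)
    ultimately have "(inv' p \<circ> q \<circ> p) ` t ` {b \<in> young_diagram lam. pr b = r} =
        t ` {b \<in> young_diagram lam. pr b = r}" for r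
      by (simp only: Q)
    moreover have "inv' p \<circ> q \<circ> p permutes {1..sum_list lam}"
      by (intro permutes_compose ip q p)
    ultimately show ?thesis
      unfolding line_stabiliser_def by blast
  qed
  have 3: "q = p \<circ> (inv' p \<circ> q \<circ> p) \<circ> inv' p" for q
    using pi by (metis comp_assoc comp_id id_comp)
  show ?thesis using 1 2 3 by blast
qed

lemma line_stabiliser_permutes:
  "q \<in> line_stabiliser pr lam t \<Longrightarrow> q permutes {1..sum_list lam}"
  by (simp add: line_stabiliser_def)

lemma tabloid_act_tabloid_of:
  assumes p: "p permutes {1..sum_list lam}"
  shows "tabloid_act lam p (tabloid_of lam t) = tabloid_of lam (tableau_act lam p t)"
proof -
  have "inv' p \<circ> p = id" using permutes_inv_o[OF p] by auto
  then have "tableau_act lam (p \<circ> q \<circ> inv' p) (tableau_act lam p t) =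
      tableau_act lam p (tableau_act lam q t)" for q
    by (simp add: tableau_act_comp comp_assoc)
  then show ?thesis
    by (simp add: tabloid_act_def tabloid_of_def row_stabiliser_def line_stabiliser_act[OF p] image_image)
qed

lemma finite_tabloids: "finite (tabloids lam)"
  by (simp add: tabloids_def finite_tableaux)

lemma perm_act_add: "perm_act lam p (f + g) = perm_act lam p f + perm_act lam p g"
  by (simp add: perm_act_def fv.scale_left_distrib sum.distrib)

lemma perm_act_scale: "perm_act lam p (fscale c f) = fscale c (perm_act lam p f)"
  by (simp add: perm_act_def fv.scale_sum_right, simp add: fscale_def mult.assoc)

lemma linear_perm_act: "Vector_Spaces.linear fscale fscale (perm_act lam p)"
  by unfold_locales (auto simp: perm_act_add perm_act_scale)

lemma perm_act_tabloid_vec: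
  assumes "X \<in> tabloids lam"
  shows "perm_act lam p (tabloid_vec X :: tabloid \<Rightarrow> 'a::field) = tabloid_vec (tabloid_act lam p X)"
proof -
  have "perm_act lam p (tabloid_vec X :: tabloid \<Rightarrow> 'a) =
      (\<Sum>Y\<in>tabloids lam. if Y = X then tabloid_vec (tabloid_act lam p X) else 0)"
    unfolding perm_act_def by (intro sum.cong) (auto simp: tabloid_vec_def fscale_def fun_eq_iff)
  then show ?thesis using assms by (simp add: finite_tabloids)
qed

lemma perm_act_polytabloid:
  assumes t: "t \<in> tableaux lam" and p: "p permutes {1..sum_list lam}"
  shows "perm_act lam p (polytabloid lam t :: tabloid \<Rightarrow> 'a::field) =
    polytabloid lam (tableau_act lam p t)"
proof -
  interpret l: Vector_Spaces.linear fscale fscale "perm_act lam p :: (tabloid \<Rightarrow> 'a) \<Rightarrow> _"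
    by (rule linear_perm_act)
  have pi: "p \<circ> inv' p = id" "inv' p \<circ> p = id"
    using permutes_inv_o[OF p] by auto
  have ip: "inv' p permutes {1..sum_list lam}" using p by (rule permutes_inv)
  have inj: "inj_on (\<lambda>q. p \<circ> q \<circ> inv' p) A" for A
    by (rule inj_on_inverseI[where g = "\<lambda>q. inv' p \<circ> q \<circ> p"])
      (metis pi(2) comp_assoc comp_id id_comp)
  have perm: "permutation q" if "q permutes {1..sum_list lam}" for q
    using that permutation_permutes by blast
  let ?C = "column_stabiliser lam t"
  let ?s = "\<lambda>q. fscale (of_int (sign q)) :: (tabloid \<Rightarrow> 'a) \<Rightarrow> _"
  have C: "q permutes {1..sum_list lam}" if "q \<in> ?C" for q
    using that unfolding column_stabiliser_def by (rule line_stabiliser_permutes)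
  have mem: "tabloid_act lam q (tabloid_of lam t) \<in> tabloids lam" if "q \<in> ?C" for q
    using tableau_act_mem[OF t C[OF that]]
    by (auto simp: tabloids_def tabloid_act_tabloid_of[OF C[OF that]])
  have "perm_act lam p (polytabloid lam t :: tabloid \<Rightarrow> 'a) =
      (\<Sum>q\<in>?C. ?s q (tabloid_vec (tabloid_act lam p (tabloid_act lam q (tabloid_of lam t)))))"
    unfolding polytabloid_def l.sum using mem
    by (intro sum.cong refl) (simp add: perm_act_scale perm_act_tabloid_vec)
  also have "\<dots> = (\<Sum>q\<in>?C. ?s (p \<circ> q \<circ> inv' p)
      (tabloid_vec (tabloid_act lam (p \<circ> q \<circ> inv' p) (tabloid_of lam (tableau_act lam p t)))))"
  proof (intro sum.cong refl)
    fix q assume q: "q \<in> ?C"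
    have pq: "p \<circ> q \<circ> inv' p permutes {1..sum_list lam}"
      using C[OF q] p ip by (intro permutes_compose)
    have "sign (p \<circ> q \<circ> inv' p) = sign p * sign q * sign p"
      using C[OF q] p ip by (simp add: sign_compose sign_inverse perm permutation_compose)
    also have "\<dots> = sign q" by (simp add: sign_def)
    finally have s: "sign (p \<circ> q \<circ> inv' p) = sign q" .
    have "tabloid_act lam (p \<circ> q \<circ> inv' p) (tabloid_of lam (tableau_act lam p t)) =
        tabloid_act lam p (tabloid_act lam q (tabloid_of lam t))"
      using C[OF q] p pq pi
      by (simp add: tabloid_act_tabloid_of tableau_act_comp comp_assoc)
    then show "?s q (tabloid_vec (tabloid_act lam p (tabloid_act lam q (tabloid_of lam t)))) =
        ?s (p \<circ> q \<circ> inv' p)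
        (tabloid_vec (tabloid_act lam (p \<circ> q \<circ> inv' p) (tabloid_of lam (tableau_act lam p t))))"
      by (simp only: s)
  qed
  also have "\<dots> = polytabloid lam (tableau_act lam p t)"
    unfolding polytabloid_def column_stabiliser_def line_stabiliser_act[OF p]
    by (subst sum.reindex[OF inj]) (simp add: o_def)
  finally show ?thesis .
qed

lemma span_invariant:
  assumes "Vector_Spaces.linear fscale fscale f" "f ` A \<subseteq> A" "w \<in> fv.span A"
  shows "f w \<in> fv.span A"
proof -
  interpret l: Vector_Spaces.linear fscale fscale f by fact
  have "f w \<in> f ` fv.span A" using assms(3) by blast
  also have "\<dots> = fv.span (f ` A)" by (rule l.span_image[symmetric])
  also have "\<dots> \<subseteq> fv.span A" using assms(2) by (rule fv.span_mono)
  finally show ?thesis .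
qed

lemma submodule_perm_module:
  "submodule (sym_group (sum_list lam)) (perm_act lam) (perm_module lam :: (tabloid \<Rightarrow> 'a::field) set)"
  unfolding submodule_def
proof (intro conjI ballI)
  show "fv.subspace (perm_module lam :: (tabloid \<Rightarrow> 'a) set)"
    by (simp add: perm_module_def fv.subspace_span)
  fix p and w :: "tabloid \<Rightarrow> 'a"
  assume p: "p \<in> carrier (sym_group (sum_list lam))" and w: "w \<in> perm_module lam"
  have p: "p permutes {1..sum_list lam}" using p by (simp add: sym_group_def)
  have "tabloid_act lam p X \<in> tabloids lam" if "X \<in> tabloids lam" for X
    using that p by (auto simp: tabloids_def tabloid_act_tabloid_of tableau_act_mem)
  then have "perm_act lam p ` (tabloid_vec ` tabloids lam :: (tabloid \<Rightarrow> 'a) set) \<subseteq> tabloid_vec ` tabloids lam"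
    by (auto simp: perm_act_tabloid_vec)
  then show "perm_act lam p w \<in> perm_module lam"
    using w unfolding perm_module_def by (rule span_invariant[OF linear_perm_act])
qed

lemma submodule_specht:
  "submodule (sym_group (sum_list lam)) (perm_act lam) (specht lam :: (tabloid \<Rightarrow> 'a::field) set)"
  unfolding submodule_def
proof (intro conjI ballI)
  show "fv.subspace (specht lam :: (tabloid \<Rightarrow> 'a) set)"
    by (simp add: specht_def fv.subspace_span)
  fix p and w :: "tabloid \<Rightarrow> 'a"
  assume p: "p \<in> carrier (sym_group (sum_list lam))" and w: "w \<in> specht lam"
  have p: "p permutes {1..sum_list lam}" using p by (simp add: sym_group_def)
  have "perm_act lam p ` (polytabloid lam ` tableaux lam :: (tabloid \<Rightarrow> 'a) set) \<subseteq> polytabloid lam ` tableaux lam"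
    using p by (auto simp: perm_act_polytabloid tableau_act_mem)
  then show "perm_act lam p w \<in> specht lam"
    using w unfolding specht_def by (rule span_invariant[OF linear_perm_act])
qed

lemma specht_subset_perm_module: "specht lam \<subseteq> (perm_module lam :: (tabloid \<Rightarrow> 'a::field) set)"
proof -
  have "polytabloid lam t \<in> (perm_module lam :: (tabloid \<Rightarrow> 'a) set)" if t: "t \<in> tableaux lam" for t
    unfolding polytabloid_def perm_module_def
  proof (intro fv.span_sum fv.span_scale fv.span_base imageI)
    fix p assume "p \<in> column_stabiliser lam t"
    then have "p permutes {1..sum_list lam}"
      unfolding column_stabiliser_def by (rule line_stabiliser_permutes)
    then show "tabloid_act lam p (tabloid_of lam t) \<in> tabloids lam"
      using t by (simp add: tabloids_def tabloid_act_tabloid_of tableau_act_mem)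
  qed
  then show ?thesis
    unfolding specht_def by (intro fv.span_minimal) (auto simp: perm_module_def fv.subspace_span)
qed

text \<open>
  For \<open>n \<le> 1\<close> the Specht module is one-dimensional, hence simple and indecomposable under any
  group, while the partition is its own conjugate. A criterion for decomposability on restriction
  to the alternating group therefore has to assume \<open>n \<ge> 2\<close>.
\<close>

lemma specht_small:
  assumes "lam = [] \<or> lam = [1]"
  shows "simple_module (sym_group (sum_list lam)) (perm_act lam) (specht lam :: (tabloid \<Rightarrow> 'a::field) set)"
    and "\<not> decomposable G (perm_act lam) (specht lam :: (tabloid \<Rightarrow> 'a) set)"
    and "lam = conjugate lam"
proof -
  define t where "t = restrict (\<lambda>_. 1::nat) (young_diagram lam)"
  consider "lam = []" | "lam = [1]" using assms by blast
  then have T: "tableaux lam = {t}"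
  proof cases
    case 1
    then show ?thesis
      by (simp add: tableaux_def t_def young_diagram_def bij_betw_def restrict_def)
  next
    case 2
    then have D: "young_diagram lam = {(0, 0)}"
      by (auto simp: young_diagram_def)
    have S: "sum_list lam = 1" using 2 by simp
    show ?thesis
    proof (intro equalityI subsetI)
      fix x assume "x \<in> tableaux lam"
      then have "x (0, 0) = t (0, 0)" "x \<in> extensional {(0, 0)}"
        by (simp_all add: tableaux_def D S t_def bij_betw_def)
      then have "x = t"
        by (intro extensionalityI[of _ "{(0, 0)}"]) (auto simp: t_def D)
      then show "x \<in> {t}" by simp
    qed (simp add: tableaux_def D S t_def bij_betw_def)
  qed
  have "{1..sum_list lam} = {} \<or> {1..sum_list lam} = {1}"
    using assms by auto
  then have "p permutes {1..sum_list lam} \<longleftrightarrow> p = id" for p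
    by (auto simp: permutes_sing simp del: One_nat_def)
  then have C: "column_stabiliser lam t = {id}"
    by (auto simp: column_stabiliser_def line_stabiliser_def)
  define v :: "tabloid \<Rightarrow> 'a" where "v = polytabloid lam t"
  have "v (tabloid_act lam id (tabloid_of lam t)) = 1"
    by (simp add: v_def polytabloid_def C tabloid_vec_def fscale_def)
  then have v: "v \<noteq> 0" by auto
  have W: "specht lam = range (\<lambda>c. fscale c v)"
    by (simp add: specht_def T fv.span_singleton v_def)
  have sub: "U = {0} \<or> U = specht lam" if U: "fv.subspace U" "U \<subseteq> specht lam"
    for U :: "(tabloid \<Rightarrow> 'a) set"
  proof (cases "U = {0}")
    case False
    then obtain u where u: "u \<in> U" "u \<noteq> 0" using fv.subspace_0[OF U(1)] by blast
    then obtain c where c: "u = fscale c v" using U(2) W by blast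
    have "fscale d v \<in> U" for d
      using fv.subspace_scale[OF U(1) u(1), of "d / c"] u(2) by (cases "c = 0") (simp_all add: c)
    then show ?thesis using U(2) W by auto
  qed simp
  have "v \<in> specht lam"
    using rangeI[of "\<lambda>c. fscale c v" 1] unfolding W by simp
  then have nz: "specht lam \<noteq> ({0} :: (tabloid \<Rightarrow> 'a) set)"
    using v by blast
  show "simple_module (sym_group (sum_list lam)) (perm_act lam) (specht lam :: (tabloid \<Rightarrow> 'a) set)"
    unfolding simple_module_def
  proof (intro conjI allI impI)
    show "U = {0} \<or> U = specht lam"
      if "submodule (sym_group (sum_list lam)) (perm_act lam) U \<and> U \<subseteq> specht lam"
      for U :: "(tabloid \<Rightarrow> 'a) set"
      using that by (intro sub) (simp_all add: submodule_def)
  qed (rule submodule_specht nz)+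
  show "\<not> decomposable G (perm_act lam) (specht lam :: (tabloid \<Rightarrow> 'a) set)"
  proof
    assume "decomposable G (perm_act lam) (specht lam :: (tabloid \<Rightarrow> 'a) set)"
    then obtain U V :: "(tabloid \<Rightarrow> 'a) set" where UV: "fv.subspace U" "fv.subspace V"
        "U \<noteq> {0}" "V \<noteq> {0}" "U \<inter> V = {0}" "specht lam = {u + v | u v. u \<in> U \<and> v \<in> V}"
      unfolding decomposable_def submodule_def by blast
    have "u \<in> specht lam" if "u \<in> U" for u
      unfolding UV(6) using that fv.subspace_0[OF UV(2)] by (metis (mono_tags, lifting) add_0_right mem_Collect_eq)
    then have "U = specht lam" using sub[OF UV(1)] UV(3) by blast
    moreover have "v \<in> specht lam" if "v \<in> V" for v
      unfolding UV(6) using that fv.subspace_0[OF UV(1)] by (metis (mono_tags, lifting) add_0_left mem_Collect_eq)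
    then have "V = specht lam" using sub[OF UV(2)] UV(4) by blast
    ultimately show False using UV(3,5) by simp
  qed
  show "lam = conjugate lam" using assms by (auto simp: conjugate_def)
qed

end

theory Submission
  imports Defs
begin

text \<open>
  Write \<open>S\<close> for the Specht module and \<open>D\<close> for the diagram. Both directions of the criterion pass
  through \<^emph>\<open>twisted\<close> maps \<open>\<theta>\<close> on \<open>S\<close>, which are linear and satisfy \<open>\<theta> (g x) = sign g * g (\<theta> x)\<close> for
  all permutations \<open>g\<close>. If \<open>S\<close> splits over the alternating group, with projection \<open>\<pi>\<close>, and \<open>\<tau>\<close> is an
  odd permutation, then \<open>\<pi> + \<tau> \<pi> \<tau>\<inverse>\<close> commutes with every permutation. Endomorphisms of \<open>S\<close> are
  scalars (\<open>endomorphism_scalar\<close>, where \<open>2 \<noteq> 0\<close> enters), and this one turns out to be 1, so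
  \<open>\<theta> = 2 \<pi> - 1\<close> is a twisted involution (\<open>decomposable_twisted_involution\<close>). Conversely, the two
  eigenspaces of a twisted involution decompose \<open>S\<close>.

  Tabloids are encoded by words, which send each label to its row. The coefficients of the polytabloids
  become a function \<open>Delta w y\<close> of a row word and a column word that treats the two alike up to the sign:
  \<open>S\<close> is spanned by the functions \<open>Delta _ y\<close>, and the functions \<open>Delta w _\<close> span the Specht
  space \<open>S'\<close> of the transposed diagram. The latter also represent the evaluations at \<open>w\<close> and hence all
  linear functionals on \<open>S\<close>, with the action of the group twisted by the sign. So if \<open>D\<close> is its own transpose, twisted maps on \<open>S\<close> correspond to equivariant maps from
  \<open>S\<close> to its dual, that is, to invariant bilinear forms.

  Three facts make this work. A simple module of a group in which every element is conjugate to its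
  inverse has a nondegenerate invariant form (\<open>exists_invariant_form\<close>, by comparing traces); this gives
  the twisted map when \<open>S\<close> is simple (\<open>decomposable_if_simple\<close>). Applied to a simple submodule \<open>U\<close>,
  it turns a twisted involution into a nonzero equivariant map from \<open>S\<close> to \<open>U\<close>, which is a scalar, so
  \<open>S = U\<close> (\<open>simple_if_twisted_involution\<close>). Finally, a twisted bijection forces \<open>D\<close> to be its own
  transpose (\<open>twisted_bijection_self_conjugate\<close>): it turns vectors symmetric under the row stabiliser
  into antisymmetric ones, and a nonzero antisymmetric vector yields a set of boxes whose row and column
  lengths are both the row lengths of \<open>D\<close>, whence a dominance inequality; functionals give the reverse one.

  The existence of a nonzero symmetric vector in \<open>S\<close> (\<open>exists_symmetric_vector\<close>) is the hard point in
  positive characteristic. It is obtained by reducing an integral vector modulo \<open>p\<close>, using that \<open>S\<close> is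
  the kernel of explicit equations (\<open>kernel_subset_specht_words\<close>).
\<close>


section \<open>Linear maps on finite-dimensional subspaces\<close>

definition lin_on ::
    "('a \<Rightarrow> 'b \<Rightarrow> 'b::ab_group_add) \<Rightarrow> ('a \<Rightarrow> 'c \<Rightarrow> 'c::ab_group_add) \<Rightarrow> 'b set \<Rightarrow> ('b \<Rightarrow> 'c) \<Rightarrow> bool" where
  "lin_on s1 s2 W f \<longleftrightarrow> (\<forall>x\<in>W. \<forall>y\<in>W. f (x + y) = f x + f y) \<and> (\<forall>c. \<forall>x\<in>W. f (s1 c x) = s2 c (f x))"

lemma lin_on_add: "lin_on s1 s2 W f \<Longrightarrow> x \<in> W \<Longrightarrow> y \<in> W \<Longrightarrow> f (x + y) = f x + f y"
  by (simp add: lin_on_def)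

lemma lin_on_scale: "lin_on s1 s2 W f \<Longrightarrow> x \<in> W \<Longrightarrow> f (s1 c x) = s2 c (f x)"
  by (simp add: lin_on_def)

lemma lin_on_subset: "lin_on s1 s2 W f \<Longrightarrow> V \<subseteq> W \<Longrightarrow> lin_on s1 s2 V f"
  unfolding lin_on_def by blast

lemma lin_on_comp:
  "lin_on s1 s2 W f \<Longrightarrow> lin_on s2 s3 V g \<Longrightarrow> f ` W \<subseteq> V \<Longrightarrow> lin_on s1 s3 W (\<lambda>x. g (f x))"
  by (auto simp: lin_on_def image_subset_iff)

definition poly_op :: "('a::zero \<Rightarrow> 'b \<Rightarrow> 'b::ab_group_add) \<Rightarrow> ('b \<Rightarrow> 'b) \<Rightarrow> 'a poly \<Rightarrow> 'b \<Rightarrow> 'b" where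
  "poly_op s T p v = fold_coeffs (\<lambda>a w. s a v + T w) p 0"

definition trace_on :: "('a::field \<Rightarrow> 'b \<Rightarrow> 'b::ab_group_add) \<Rightarrow> 'b set \<Rightarrow> ('b \<Rightarrow> 'b) \<Rightarrow> 'a" where
  "trace_on s B T = (\<Sum>b\<in>B. module.representation s B (T b) b)"

context vector_space
begin

lemma lin_on_zero:
  assumes "lin_on scale s2 W f" "subspace W"
  shows "f 0 = 0"
proof -
  have "f (0 + 0) = f 0 + f 0"
    using assms by (intro lin_on_add[OF assms(1)]) (auto simp: subspace_0)
  then show ?thesis by simp
qed

lemma lin_on_diff:
  assumes "lin_on scale s2 W f" "subspace W" "x \<in> W" "y \<in> W"
  shows "f (x - y) = f x - f y"
proof -
  have "f (x - y + y) = f (x - y) + f y"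
    using assms by (intro lin_on_add[OF assms(1)]) (auto simp: subspace_diff)
  then show ?thesis by (simp add: algebra_simps)
qed

lemma lin_on_sum:
  assumes f: "lin_on scale s2 W f" and W: "subspace W" and x: "\<And>i. i \<in> I \<Longrightarrow> x i \<in> W"
  shows "f (\<Sum>i\<in>I. scale (c i) (x i)) = (\<Sum>i\<in>I. s2 (c i) (f (x i)))"
  using x
proof (induction I rule: infinite_finite_induct)
  case (insert i I)
  have "(\<Sum>i\<in>I. scale (c i) (x i)) \<in> W"
    using insert.prems W by (intro subspace_sum subspace_scale) auto
  moreover have "scale (c i) (x i) \<in> W"
    using insert.prems W by (intro subspace_scale) auto
  ultimately show ?case
    using insert by (simp add: lin_on_add[OF f] lin_on_scale[OF f])
qed (simp_all add: lin_on_zero[OF f W])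

lemma subspace_kernel:
  assumes "lin_on scale s2 W f" "vector_space s2" "subspace W"
  shows "subspace {x \<in> W. f x = 0}"
proof -
  interpret v2: vector_space s2 by fact
  show ?thesis
    by (rule subspaceI)
      (auto simp: lin_on_zero[OF assms(1,3)] lin_on_add[OF assms(1)] lin_on_scale[OF assms(1)]
        subspace_0[OF assms(3)] subspace_add[OF assms(3)] subspace_scale[OF assms(3)])
qed

lemma subspace_image_on:
  assumes f: "lin_on scale s2 W f" and s2: "vector_space s2" and W: "subspace W"
  shows "module.subspace s2 (f ` W)"
proof -
  interpret v2: vector_space s2 by (rule s2)
  show ?thesis
  proof (rule v2.subspaceI)
    show "0 \<in> f ` W" using lin_on_zero[OF f W] subspace_0[OF W] by (metis imageI)
    show "x + y \<in> f ` W" if xy: "x \<in> f ` W" "y \<in> f ` W" for x y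
    proof -
      obtain a b where "a \<in> W" "b \<in> W" "x = f a" "y = f b" using xy by blast
      then have "x + y = f (a + b)" "a + b \<in> W"
        using lin_on_add[OF f] subspace_add[OF W] by auto
      then show ?thesis by blast
    qed
    show "s2 c x \<in> f ` W" if x: "x \<in> f ` W" for c x
    proof -
      obtain a where "a \<in> W" "x = f a" using x by blast
      then have "s2 c x = f (scale c a)" "scale c a \<in> W"
        using lin_on_scale[OF f] subspace_scale[OF W] by auto
      then show ?thesis by blast
    qed
  qed
qed

lemma dim_strict_mono:
  assumes "subspace V" "V \<subset> W" "W \<subseteq> span C" "finite C"
  shows "dim V < dim W"
proof -
  obtain B where B: "B \<subseteq> V" "independent B" "V \<subseteq> span B" "card B = dim V"
    by (rule basis_exists)
  obtain x where x: "x \<in> W" "x \<notin> V" using assms(2) by blast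
  have "span B \<subseteq> V" using B(1) assms(1) by (rule span_minimal)
  then have xB: "x \<notin> span B" using x by blast
  then have i: "independent (insert x B)" using B(2) by (rule independent_insertI)
  obtain E where E: "E \<subseteq> W" "independent E" "W \<subseteq> span E" "card E = dim W"
    by (rule basis_exists)
  have "finite E" using independent_span_bound[OF assms(4) E(2)] E(1) assms(3) by blast
  then have "finite (insert x B) \<and> card (insert x B) \<le> card E"
    by (rule independent_span_bound[OF _ i]) (use B(1) x(1) E(3) assms(2) in blast)
  moreover have "x \<notin> B" using xB span_superset by blast
  ultimately show ?thesis using B(4) E(4) by auto
qed

text \<open>
  Over a field in which polynomials have roots, evaluate at \<open>T\<close> a polynomial of least degree that
  kills some nonzero vector; splitting off a linear factor leaves an eigenvector.
\<close>


lemma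
  assumes T: "lin_on scale scale W T" "T ` W \<subseteq> W" and W: "subspace W" and v: "v \<in> W"
  shows poly_op_in: "poly_op scale T p v \<in> W"
    and poly_op_add: "poly_op scale T (p + q) v = poly_op scale T p v + poly_op scale T q v"
    and poly_op_smult: "poly_op scale T (smult a p) v = scale a (poly_op scale T p v)"
    and poly_op_factor: "poly_op scale T ([:- a, 1:] * p) v = T (poly_op scale T p v) - scale a (poly_op scale T p v)"
proof -
  have z: "poly_op scale T 0 v = 0" by (simp add: poly_op_def)
  have c: "poly_op scale T (pCons a p) v = scale a v + T (poly_op scale T p v)" for a p
  proof (cases "p = 0 \<and> a = 0")
    case True
    then show ?thesis by (simp add: z lin_on_zero[OF T(1) W])
  next
    case False
    then show ?thesis by (auto simp: poly_op_def)
  qed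
  have i: "poly_op scale T p v \<in> W" for p
    by (induction p) (use T(2) v W in \<open>auto simp: z c subspace_0 intro!: subspace_add subspace_scale\<close>)
  have a: "poly_op scale T (p + q) v = poly_op scale T p v + poly_op scale T q v" for p q
  proof (induction p arbitrary: q)
    case (pCons b p)
    show ?case by (cases q) (simp add: c pCons.IH lin_on_add[OF T(1) i i] scale_left_distrib)
  qed (simp add: z)
  have s: "poly_op scale T (smult b p) v = scale b (poly_op scale T p v)" for b p
    by (induction p) (simp_all add: z c lin_on_scale[OF T(1) i] algebra_simps)
  show "poly_op scale T p v \<in> W" by (rule i)
  show "poly_op scale T (p + q) v = poly_op scale T p v + poly_op scale T q v" by (rule a)
  show "poly_op scale T (smult a p) v = scale a (poly_op scale T p v)" by (rule s)
  have "[:- a, 1:] * p = smult (- a) p + pCons 0 p" by simp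
  then show "poly_op scale T ([:- a, 1:] * p) v = T (poly_op scale T p v) - scale a (poly_op scale T p v)"
    by (simp only: a s c) simp
qed

lemma exists_annihilating_poly:
  assumes T: "lin_on scale scale W T" "T ` W \<subseteq> W" and W: "subspace W" and v: "v \<in> W"
    and C: "W \<subseteq> span C" "finite C"
  shows "\<exists>p. p \<noteq> 0 \<and> poly_op scale T p v = 0"
proof (rule ccontr)
  assume "\<not> ?thesis"
  then have nz: "p \<noteq> 0 \<Longrightarrow> poly_op scale T p v \<noteq> 0" for p by blast
  note add = poly_op_add[OF T W v] and smult = poly_op_smult[OF T W v]
  define m where "m i = poly_op scale T (monom 1 i) v" for i :: nat
  have sum: "(\<Sum>i\<in>I. scale (u i) (m i)) = poly_op scale T (\<Sum>i\<in>I. monom (u i) i) v" if "finite I" for u I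
    using that
  proof (induction I rule: finite_induct)
    case empty
    then show ?case by (simp add: poly_op_def)
  next
    case (insert i I)
    have "monom (u i) i = smult (u i) (monom 1 i)" by (simp add: smult_monom)
    then show ?case using insert by (simp add: add smult m_def)
  qed
  have inj: "inj m"
  proof (rule injI)
    fix i j assume "m i = m j"
    then have "poly_op scale T (monom 1 i + smult (-1) (monom 1 j)) v = 0"
      by (simp add: add smult m_def del: smult_minus_left)
    then have "monom (1::'a) i + smult (-1) (monom 1 j) = 0" using nz by blast
    then have "monom (1::'a) i = monom 1 j" by simp
    then show "i = j" by (metis degree_monom_eq one_neq_zero)
  qed
  have "independent (range m)"
    unfolding independent_explicit_finite_subsets
  proof (intro allI impI ballI)
    fix A u x assume A: "A \<subseteq> range m" "finite A" "(\<Sum>v\<in>A. scale (u v) v) = 0" "x \<in> A"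
    obtain I where I: "A = m ` I" "finite I"
      using A(1,2) by (metis finite_subset_image)
    have "(\<Sum>v\<in>A. scale (u v) v) = (\<Sum>i\<in>I. scale (u (m i)) (m i))"
      unfolding I(1) by (rule sum.reindex_cong[OF inj_on_subset[OF inj subset_UNIV]]) auto
    then have "poly_op scale T (\<Sum>i\<in>I. monom (u (m i)) i) v = 0"
      using A(3) by (simp add: sum[OF I(2)])
    then have "(\<Sum>i\<in>I. monom (u (m i)) i) = 0" using nz by blast
    then have "coeff (\<Sum>i\<in>I. monom (u (m i)) i) j = 0" for j by simp
    then have "(if j \<in> I then u (m j) else 0) = 0" for j
      using I(2) by (simp add: coeff_sum)
    then have "u (m j) = 0" if "j \<in> I" for j
      using that by metis
    then show "u x = 0" using A(4) I(1) by blast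
  qed
  moreover have "range m \<subseteq> span C"
    using poly_op_in[OF T W v] C(1) by (auto simp: m_def)
  ultimately have "finite (range m)" using independent_span_bound[OF C(2)] by blast
  then show False using finite_imageD[OF _ inj] by simp
qed

lemma exists_eigenvector:
  assumes roots: "\<And>p :: 'a poly. degree p > 0 \<Longrightarrow> \<exists>z. poly p z = 0"
    and T: "lin_on scale scale W T" "T ` W \<subseteq> W" and W: "subspace W" "W \<noteq> {0}"
    and C: "W \<subseteq> span C" "finite C"
  shows "\<exists>a. \<exists>v\<in>W. v \<noteq> 0 \<and> T v = scale a v"
proof -
  define Q where "Q p \<longleftrightarrow> p \<noteq> 0 \<and> (\<exists>v\<in>W. v \<noteq> 0 \<and> poly_op scale T p v = 0)" for p
  obtain v0 where "v0 \<in> W" "v0 \<noteq> 0" using W subspace_0 by blast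
  then have "\<exists>p. Q p" unfolding Q_def using exists_annihilating_poly[OF T W(1) _ C] by blast
  then obtain p where p: "Q p" and min: "\<And>q. Q q \<Longrightarrow> degree p \<le> degree q"
    by (metis ex_has_least_nat[of Q _ degree])
  obtain v where v: "p \<noteq> 0" "v \<in> W" "v \<noteq> 0" "poly_op scale T p v = 0" using p Q_def by blast
  have "degree p > 0"
  proof (rule ccontr)
    assume "\<not> degree p > 0"
    then obtain a where a: "p = [:a:]" by (metis degree_eq_zeroE gr0I)
    then have "poly_op scale T p v = scale a v"
      by (cases "a = 0") (simp_all add: poly_op_def lin_on_zero[OF T(1) W(1)])
    then show False using v a by simp
  qed
  then obtain a where "poly p a = 0" using roots by blast
  then obtain q where q: "p = [:- a, 1:] * q" by (auto simp: poly_eq_0_iff_dvd)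
  have "q \<noteq> 0" using q v(1) by auto
  then have "degree q < degree p" unfolding q by (subst degree_mult_eq) auto
  then have "\<not> Q q" using min by fastforce
  then have "poly_op scale T q v \<noteq> 0" using \<open>q \<noteq> 0\<close> v(2,3) by (auto simp: Q_def)
  moreover have "T (poly_op scale T q v) = scale a (poly_op scale T q v)"
    using v(4) unfolding q poly_op_factor[OF T W(1) v(2)] by simp
  moreover have "poly_op scale T q v \<in> W" by (rule poly_op_in[OF T W(1) v(2)])
  ultimately show ?thesis by blast
qed

lemma injective_endo_surjective:
  assumes f: "lin_on scale scale W f" "f ` W \<subseteq> W" and W: "subspace W"
    and C: "W \<subseteq> span C" "finite C" and inj: "\<And>x. x \<in> W \<Longrightarrow> f x = 0 \<Longrightarrow> x = 0"
  shows "f ` W = W"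
proof (rule ccontr)
  assume "f ` W \<noteq> W"
  then have ps: "f ` W \<subset> W" using f(2) by blast
  obtain B where B: "B \<subseteq> W" "independent B" "W \<subseteq> span B" "card B = dim W"
    by (rule basis_exists)
  have fB: "finite B" using independent_span_bound[OF C(2) B(2)] B(1) C(1) by blast
  have sub: "subspace (f ` W)" by (rule subspace_image_on[OF f(1) vector_space_axioms W])
  have injf: "inj_on f W"
    by (rule inj_onI)
      (metis W eq_iff_diff_eq_0 f(1) inj lin_on_diff subspace_diff)
  have "independent (f ` B)"
    unfolding independent_explicit_finite_subsets
  proof (intro allI impI ballI)
    fix A u x assume A: "A \<subseteq> f ` B" "finite A" "(\<Sum>v\<in>A. scale (u v) v) = 0" "x \<in> A"
    obtain E where E: "E \<subseteq> B" "A = f ` E" "finite E"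
      using A(1,2) by (metis finite_subset_image)
    have "(\<Sum>v\<in>A. scale (u v) v) = (\<Sum>b\<in>E. scale (u (f b)) (f b))"
      unfolding E(2) using inj_on_subset[OF injf] E(1) B(1)
      by (intro sum.reindex_cong[of f]) auto
    also have "\<dots> = f (\<Sum>b\<in>E. scale (u (f b)) b)"
      using E(1) B(1) by (intro lin_on_sum[OF f(1) W, symmetric]) auto
    finally have "f (\<Sum>b\<in>E. scale (u (f b)) b) = 0" using A(3) by simp
    moreover have "(\<Sum>b\<in>E. scale (u (f b)) b) \<in> W"
      by (rule subspace_sum[OF W], rule subspace_scale[OF W]) (use E(1) B(1) in blast)
    ultimately have "(\<Sum>b\<in>E. scale (u (f b)) b) = 0" using inj by blast
    then have "\<forall>b\<in>E. u (f b) = 0"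
      using independentD[OF B(2) E(3,1), of "\<lambda>b. u (f b)"] by blast
    then show "u x = 0" using A(4) E(2) by blast
  qed
  then have "card (f ` B) = dim (span (f ` B))" by (simp add: dim_eq_card_independent)
  moreover have "card (f ` B) = card B" by (rule card_image[OF inj_on_subset[OF injf B(1)]])
  moreover have "dim (span (f ` B)) \<le> dim (f ` W)"
  proof -
    have "span (f ` B) \<subseteq> f ` W" using B(1) by (intro span_minimal[OF _ sub]) blast
    moreover have "f ` W \<subseteq> span C" using ps C(1) by blast
    ultimately show ?thesis
      by (metis C(2) dim_strict_mono less_imp_le order_refl psubsetI subspace_span)
  qed
  moreover have "dim (f ` W) < dim W" using dim_strict_mono[OF sub ps C] .
  ultimately show False using B(4) by simp
qed

text \<open>
  Taking the values of \<open>B _ v\<close> on a basis as coordinates is an injective endomorphism of \<open>W\<close>, hence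
  surjective.
\<close>

lemma form_represents_functional:
  assumes W: "subspace W" "W \<subseteq> span C" "finite C"
    and B1: "\<And>v. v \<in> W \<Longrightarrow> lin_on scale (*) W (\<lambda>u. B u v)"
    and B2: "\<And>u. u \<in> W \<Longrightarrow> lin_on scale (*) W (\<lambda>v. B u v)"
    and nondeg: "\<And>v. v \<in> W \<Longrightarrow> (\<And>u. u \<in> W \<Longrightarrow> B u v = 0) \<Longrightarrow> v = 0"
    and h: "lin_on scale (*) W h"
  shows "\<exists>v\<in>W. \<forall>u\<in>W. B u v = h u"
proof -
  obtain E where E: "E \<subseteq> W" "independent E" "W \<subseteq> span E" "card E = dim W"
    by (rule basis_exists)
  have fE: "finite E" using independent_span_bound[OF W(3) E(2)] E(1) W(2) by blast
  have sE: "span E = W" using E(1,3) W(1) span_minimal by blast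
  have expand: "\<exists>c. x = (\<Sum>e\<in>E. scale (c e) e)" if "x \<in> W" for x
    using sum_representation_eq[OF E(2) _ fE subset_refl] that E(3) by (metis subset_iff)
  have ext: "g x = g' x"
    if g: "lin_on scale (*) W g" "lin_on scale (*) W g'" "\<forall>e\<in>E. g e = g' e" "x \<in> W" for g g' x
  proof -
    obtain c where c: "x = (\<Sum>e\<in>E. scale (c e) e)" using expand[OF g(4)] by blast
    have "g x = (\<Sum>e\<in>E. c e * g e)" "g' x = (\<Sum>e\<in>E. c e * g' e)"
      using lin_on_sum[OF g(1) W(1), of E "\<lambda>e. e" c] lin_on_sum[OF g(2) W(1), of E "\<lambda>e. e" c] E(1)
      unfolding c by blast+
    then show ?thesis using g(3) by simp
  qed
  define L where "L v = (\<Sum>e\<in>E. scale (B e v) e)" for v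
  have L: "lin_on scale scale W L"
    unfolding lin_on_def L_def using E(1)
    by (auto simp: lin_on_add[OF B2] lin_on_scale[OF B2] subset_iff scale_left_distrib sum.distrib
        scale_sum_right intro!: sum.cong)
  have LW: "L ` W \<subseteq> W"
    unfolding L_def using E(1) W(1) by (auto intro!: subspace_sum subspace_scale)
  have coords: "\<forall>e\<in>E. c e = d e"
    if eq: "(\<Sum>e\<in>E. scale (c e) e) = (\<Sum>e\<in>E. scale (d e) e)" for c d
  proof -
    have "(\<Sum>e\<in>E. scale (c e - d e) e) = 0"
      using eq by (simp add: scale_left_diff_distrib sum_subtractf)
    then show ?thesis
      using independentD[OF E(2) fE subset_refl, of "\<lambda>e. c e - d e"] by simp
  qed
  have "L ` W = W"
  proof (rule injective_endo_surjective[OF L LW W])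
    fix v assume v: "v \<in> W" "L v = 0"
    then have "\<forall>e\<in>E. B e v = 0" using coords[of "\<lambda>e. B e v" "\<lambda>_. 0"] by (simp add: L_def)
    then have "B u v = 0" if "u \<in> W" for u
      using ext[OF B1[OF v(1)], of "\<lambda>_. 0"] that by (simp add: lin_on_def)
    then show "v = 0" using nondeg v(1) by blast
  qed
  moreover have "(\<Sum>e\<in>E. scale (h e) e) \<in> W"
    using E(1) W(1) by (auto intro!: subspace_sum subspace_scale)
  ultimately obtain v where v: "v \<in> W" "L v = (\<Sum>e\<in>E. scale (h e) e)" by (metis imageE)
  then have "\<forall>e\<in>E. B e v = h e" using coords[of "\<lambda>e. B e v" h] by (simp add: L_def)
  then show ?thesis using v(1) ext[OF B1[OF v(1)] h] by blast
qed


section \<open>Traces\<close>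


context
  fixes B assumes B: "independent B" "finite B"
begin

lemma trace_on_cong:
  assumes "\<And>x. x \<in> span B \<Longrightarrow> S x = T x"
  shows "trace_on scale B S = trace_on scale B T"
  unfolding trace_on_def using assms span_base by (intro sum.cong) auto

lemma trace_on_add:
  assumes "S ` span B \<subseteq> span B" "T ` span B \<subseteq> span B"
  shows "trace_on scale B (\<lambda>x. S x + T x) = trace_on scale B S + trace_on scale B T"
proof -
  have "S b \<in> span B" "T b \<in> span B" if "b \<in> B" for b using that assms span_base by blast+
  then show ?thesis
    unfolding trace_on_def by (simp add: representation_add[OF B(1)] sum.distrib)
qed

lemma trace_on_scale:
  assumes "T ` span B \<subseteq> span B"
  shows "trace_on scale B (\<lambda>x. scale c (T x)) = c * trace_on scale B T"
proof -
  have "T b \<in> span B" if "b \<in> B" for b using that assms span_base by blast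
  then show ?thesis
    unfolding trace_on_def by (simp add: representation_scale[OF B(1)] sum_distrib_left)
qed

lemma trace_on_comp_expand:
  assumes S: "lin_on scale scale (span B) S" "S ` span B \<subseteq> span B" and T: "T ` span B \<subseteq> span B"
  shows "trace_on scale B (\<lambda>x. S (T x)) =
    (\<Sum>b\<in>B. \<Sum>c\<in>B. representation B (T b) c * representation B (S c) b)"
  unfolding trace_on_def
proof (intro sum.cong refl)
  fix b assume b: "b \<in> B"
  have Tb: "T b \<in> span B" using b T span_base by blast
  have Sb: "S c \<in> span B" if "c \<in> B" for c using that S(2) span_base by blast
  have "T b = (\<Sum>c\<in>B. scale (representation B (T b) c) c)"
    by (rule sum_representation_eq[OF B(1) Tb B(2) subset_refl, symmetric])
  then have "S (T b) = S (\<Sum>c\<in>B. scale (representation B (T b) c) c)" by (rule arg_cong)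
  also have "\<dots> = (\<Sum>c\<in>B. scale (representation B (T b) c) (S c))"
    by (intro lin_on_sum[OF S(1)] subspace_span span_base)
  finally have "S (T b) = (\<Sum>c\<in>B. scale (representation B (T b) c) (S c))" .
  then show "representation B (S (T b)) b =
      (\<Sum>c\<in>B. representation B (T b) c * representation B (S c) b)"
    using Sb by (simp add: representation_sum[OF B(1)] representation_scale[OF B(1)] span_scale)
qed

lemma trace_on_comp_commute:
  assumes "lin_on scale scale (span B) S" "S ` span B \<subseteq> span B"
    and "lin_on scale scale (span B) T" "T ` span B \<subseteq> span B"
  shows "trace_on scale B (\<lambda>x. S (T x)) = trace_on scale B (\<lambda>x. T (S x))"
  unfolding trace_on_comp_expand[OF assms(1,2,4)] trace_on_comp_expand[OF assms(3,4,2)]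
  by (subst sum.swap) (simp add: mult.commute)

lemma trace_on_rank_one:
  assumes f: "lin_on scale (*) (span B) f" and u: "u \<in> span B"
    and T: "\<And>x. x \<in> span B \<Longrightarrow> T x = scale (f x) u"
  shows "trace_on scale B T = f u"
proof -
  have "trace_on scale B T = (\<Sum>b\<in>B. representation B u b * f b)"
    unfolding trace_on_def using u
    by (intro sum.cong) (simp_all add: T span_base representation_scale[OF B(1)])
  also have "\<dots> = f (\<Sum>b\<in>B. scale (representation B u b) b)"
    by (intro lin_on_sum[OF f, symmetric] subspace_span span_base)
  also have "(\<Sum>b\<in>B. scale (representation B u b) b) = u"
    by (rule sum_representation_eq[OF B(1) u B(2) subset_refl])
  finally show ?thesis .
qed

end

end


section \<open>Simple modules of groups whose elements are conjugate to their inverses\<close>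

text \<open>
  Such a module has a nondegenerate invariant bilinear form. The relation \<open>adj X X'\<close> says that some
  element of the group algebra acts as \<open>X\<close>, while its image under \<open>g \<mapsto> inv g\<close> acts as \<open>X'\<close>. Since
  \<open>g\<close> and \<open>inv g\<close> are conjugate, \<open>X\<close> and \<open>X'\<close> have the same trace. Simplicity provides \<open>(e, e')\<close>
  with \<open>e\<close> of rank one, and the trace shows that \<open>a \<circ> e = 0\<close> implies \<open>e' \<circ> a' = 0\<close>. Every vector
  is \<open>a u0\<close> for \<open>u0\<close> in the image of \<open>e\<close>, so that \<open>B (a u0) v = f (e' (a' v))\<close> is well defined for
  each functional \<open>f\<close>; invariance is built into the formula.
\<close>

locale real_simple_module = vector_space scale
  for scale :: "'a::field \<Rightarrow> 'b::ab_group_add \<Rightarrow> 'b" +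
  fixes G :: "('g, 'z) monoid_scheme" (structure)
    and act :: "'g \<Rightarrow> 'b \<Rightarrow> 'b" and U :: "'b set" and C :: "'b set"
  assumes roots: "\<And>p :: 'a poly. degree p > 0 \<Longrightarrow> \<exists>z. poly p z = 0"
    and group: "group G"
    and conj_inv: "\<And>g. g \<in> carrier G \<Longrightarrow> \<exists>h\<in>carrier G. h \<otimes> g \<otimes> inv h = inv g"
    and U: "subspace U" and C: "U \<subseteq> span C" "finite C"
    and act_lin: "\<And>g. g \<in> carrier G \<Longrightarrow> lin_on scale scale U (act g)"
    and act_in: "\<And>g u. g \<in> carrier G \<Longrightarrow> u \<in> U \<Longrightarrow> act g u \<in> U"
    and act_mult: "\<And>g h u. g \<in> carrier G \<Longrightarrow> h \<in> carrier G \<Longrightarrow> u \<in> U \<Longrightarrow>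
      act (g \<otimes> h) u = act g (act h u)"
    and act_one: "\<And>u. u \<in> U \<Longrightarrow> act \<one> u = u"
    and nonzero: "U \<noteq> {0}"
    and simple: "\<And>W. subspace W \<Longrightarrow> W \<subseteq> U \<Longrightarrow> (\<And>g w. g \<in> carrier G \<Longrightarrow> w \<in> W \<Longrightarrow> act g w \<in> W) \<Longrightarrow>
      W = {0} \<or> W = U"
begin

interpretation group G by (rule group)

inductive adj :: "('b \<Rightarrow> 'b) \<Rightarrow> ('b \<Rightarrow> 'b) \<Rightarrow> bool" where
  adj_act: "g \<in> carrier G \<Longrightarrow> adj (act g) (act (inv g))"
| adj_add: "adj X X' \<Longrightarrow> adj Y Y' \<Longrightarrow> adj (\<lambda>u. X u + Y u) (\<lambda>u. X' u + Y' u)"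
| adj_scale: "adj X X' \<Longrightarrow> adj (\<lambda>u. scale c (X u)) (\<lambda>u. scale c (X' u))"
| adj_cong: "adj X X' \<Longrightarrow> \<forall>u\<in>U. Z u = X u \<Longrightarrow> \<forall>u\<in>U. Z' u = X' u \<Longrightarrow> adj Z Z'"

lemma adj_sym: "adj X X' \<Longrightarrow> adj X' X"
proof (induction rule: adj.induct)
  case (adj_act g)
  then show ?case using adj.adj_act[of "inv g"] by simp
qed (blast intro: adj.adj_add adj.adj_scale adj.adj_cong)+

lemma adj_lin: "adj X X' \<Longrightarrow> lin_on scale scale U X \<and> X ` U \<subseteq> U"
proof (induction rule: adj.induct)
  case (adj_act g)
  then show ?case using act_lin act_in by blast
next
  case (adj_add X X' Y Y')
  then show ?case
    by (auto simp: lin_on_def algebra_simps intro!: subspace_add[OF U])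
next
  case (adj_scale X X' c)
  then show ?case
    by (auto simp: lin_on_def algebra_simps intro!: subspace_scale[OF U])
next
  case (adj_cong X X' Z Z')
  then show ?case
    using subspace_add[OF U] subspace_scale[OF U] by (auto simp: lin_on_def)
qed

lemma adj_in: "adj X X' \<Longrightarrow> u \<in> U \<Longrightarrow> X u \<in> U"
  using adj_lin by blast

lemma adj_lin1: "adj X X' \<Longrightarrow> lin_on scale scale U X"
  using adj_lin by blast

lemma adj_comp_act:
  assumes g: "g \<in> carrier G"
  shows "adj Y Y' \<Longrightarrow> adj (\<lambda>u. act g (Y u)) (\<lambda>u. Y' (act (inv g) u))"
proof (induction rule: adj.induct)
  case (adj_act h)
  have "adj (act (g \<otimes> h)) (act (inv (g \<otimes> h)))" using g adj_act by (intro adj.adj_act) simp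
  then show ?case
    by (rule adj.adj_cong) (use g adj_act in \<open>auto simp: act_mult inv_mult_group\<close>)
next
  case (adj_add X X' Y Y')
  from adj.adj_add[OF adj_add.IH] show ?case
    by (rule adj.adj_cong)
      (use adj_add.hyps in \<open>auto simp: lin_on_add[OF act_lin[OF g] adj_in adj_in]\<close>)
next
  case (adj_scale X X' c)
  from adj.adj_scale[OF adj_scale.IH, of c] show ?case
    by (rule adj.adj_cong)
      (use adj_scale.hyps in \<open>auto simp: lin_on_scale[OF act_lin[OF g] adj_in]\<close>)
next
  case (adj_cong X X' Z Z')
  from adj_cong.IH show ?case
    by (rule adj.adj_cong) (use adj_cong.hyps g act_in in auto)
qed

lemma adj_comp:
  assumes Y: "adj Y Y'"
  shows "adj X X' \<Longrightarrow> adj (\<lambda>u. X (Y u)) (\<lambda>u. Y' (X' u))"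
proof (induction rule: adj.induct)
  case (adj_act h)
  then show ?case using adj_comp_act Y by blast
next
  case (adj_add X1 X1' X2 X2')
  from adj.adj_add[OF adj_add.IH] show ?case
    by (rule adj.adj_cong)
      (simp_all add: lin_on_add[OF adj_lin1[OF adj_sym[OF Y]]
          adj_in[OF adj_sym[OF adj_add.hyps(1)]] adj_in[OF adj_sym[OF adj_add.hyps(2)]]])
next
  case (adj_scale X1 X1' c)
  from adj.adj_scale[OF adj_scale.IH, of c] show ?case
    by (rule adj.adj_cong)
      (simp_all add: lin_on_scale[OF adj_lin1[OF adj_sym[OF Y]] adj_in[OF adj_sym[OF adj_scale.hyps]]])
next
  case (adj_cong X1 X1' Z Z')
  from adj_cong.IH show ?case
    by (rule adj.adj_cong) (use adj_cong.hyps adj_in[OF Y] in auto)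
qed

lemma adj_diff:
  assumes "adj X X'" "adj Y Y'"
  shows "adj (\<lambda>u. X u - scale c (Y u)) (\<lambda>u. X' u - scale c (Y' u))"
  by (rule adj_cong[OF adj_add[OF assms(1) adj_scale[OF assms(2), of "- c"]]]) auto

lemma adj_transitive:
  assumes u: "u \<in> U" "u \<noteq> 0" and v: "v \<in> U"
  shows "\<exists>X X'. adj X X' \<and> X u = v"
proof -
  let ?W = "{X u |X. \<exists>X'. adj X X'}"
  have one: "adj (act \<one>) (act (inv \<one>))" by (rule adj_act) simp
  have "subspace ?W"
  proof (rule subspaceI)
    show "0 \<in> ?W" using adj_scale[OF one, of 0] by fastforce
    show "x + y \<in> ?W" if xy: "x \<in> ?W" "y \<in> ?W" for x y
    proof -
      obtain X X' Y Y' where "adj X X'" "adj Y Y'" and eq: "x = X u" "y = Y u" using xy by blast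
      then have "adj (\<lambda>u. X u + Y u) (\<lambda>u. X' u + Y' u)" by (intro adj_add)
      then show ?thesis unfolding eq by (intro CollectI exI conjI) (rule refl)
    qed
    show "scale c x \<in> ?W" if x: "x \<in> ?W" for c x
    proof -
      obtain X X' where "adj X X'" and eq: "x = X u" using x by blast
      then have "adj (\<lambda>u. scale c (X u)) (\<lambda>u. scale c (X' u))" by (intro adj_scale)
      then show ?thesis unfolding eq by (intro CollectI exI conjI) (rule refl)
    qed
  qed
  moreover have "?W \<subseteq> U" using adj_in u(1) by blast
  moreover have "act g w \<in> ?W" if g: "g \<in> carrier G" and w: "w \<in> ?W" for g w
  proof -
    obtain X X' where "adj X X'" and eq: "w = X u" using w by blast
    then have "adj (\<lambda>u. act g (X u)) (\<lambda>u. X' (act (inv g) u))" by (intro adj_comp_act g)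
    then show ?thesis unfolding eq by (intro CollectI exI conjI) (rule refl)
  qed
  ultimately have "?W = {0} \<or> ?W = U" by (rule simple)
  moreover have "act \<one> u \<in> ?W" using one by blast
  ultimately have "?W = U" using u(2) act_one[OF u(1)] by (metis (no_types, lifting) singletonD)
  then have "v \<in> ?W" using v by (simp only:)
  then show ?thesis by blast
qed

lemma adj_trace:
  assumes B: "independent B" "finite B" "span B = U"
  shows "adj X X' \<Longrightarrow> trace_on scale B X = trace_on scale B X'"
proof (induction rule: adj.induct)
  case (adj_act g)
  obtain h where h: "h \<in> carrier G" "h \<otimes> g \<otimes> inv h = inv g" using conj_inv adj_act by blast
  have lin: "lin_on scale scale (span B) (act k)" "act k ` span B \<subseteq> span B" if "k \<in> carrier G" for k
    using that act_lin act_in B(3) by auto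
  have "trace_on scale B (act (inv g)) = trace_on scale B (\<lambda>u. act (h \<otimes> g) (act (inv h) u))"
  proof (rule trace_on_cong[OF B(1,2)])
    fix u assume "u \<in> span B"
    then have "act (h \<otimes> g \<otimes> inv h) u = act (h \<otimes> g) (act (inv h) u)"
      using h(1) adj_act B(3) by (intro act_mult) auto
    then show "act (inv g) u = act (h \<otimes> g) (act (inv h) u)" by (simp only: h(2))
  qed
  also have "\<dots> = trace_on scale B (\<lambda>u. act (inv h) (act (h \<otimes> g) u))"
    using h(1) adj_act by (intro trace_on_comp_commute B lin) auto
  also have "\<dots> = trace_on scale B (act g)"
  proof (rule trace_on_cong[OF B(1,2)])
    fix u assume "u \<in> span B"
    then have "act (inv h) (act (h \<otimes> g) u) = act (inv h \<otimes> (h \<otimes> g)) u"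
      using h(1) adj_act B(3) by (intro act_mult[symmetric]) auto
    also have "inv h \<otimes> (h \<otimes> g) = g" using h(1) adj_act by (simp flip: m_assoc)
    finally show "act (inv h) (act (h \<otimes> g) u) = act g u" .
  qed
  finally show ?case by simp
next
  case (adj_add X X' Y Y')
  have "X ` span B \<subseteq> span B" "Y ` span B \<subseteq> span B" "X' ` span B \<subseteq> span B" "Y' ` span B \<subseteq> span B"
    using adj_add.hyps adj_sym adj_lin B(3) by blast+
  then show ?case using adj_add.IH by (simp add: trace_on_add[OF B(1,2)])
next
  case (adj_scale X X' c)
  have "X ` span B \<subseteq> span B" "X' ` span B \<subseteq> span B"
    using adj_scale.hyps adj_sym adj_lin B(3) by blast+
  then show ?case using adj_scale.IH by (simp add: trace_on_scale[OF B(1,2)])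
next
  case (adj_cong X X' Z Z')
  have "trace_on scale B Z = trace_on scale B X" "trace_on scale B Z' = trace_on scale B X'"
    using adj_cong.hyps B(3) by (auto intro!: trace_on_cong[OF B(1,2)])
  then show ?case using adj_cong.IH by simp
qed

text \<open>
  An element \<open>e\<close> whose kernel is as large as possible has rank one: for each \<open>a\<close> the map \<open>e \<circ> a\<close>
  has an eigenvalue \<open>c\<close> on the image of \<open>e\<close>, and \<open>e \<circ> a \<circ> e - c e\<close> has a larger kernel, so it
  vanishes.
\<close>

lemma exists_rank_one:
  obtains e e' f u0 where "adj e e'" "u0 \<in> U" "u0 \<noteq> 0" "lin_on scale (*) U f"
    "\<And>u. u \<in> U \<Longrightarrow> e u = scale (f u) u0" "\<exists>u\<in>U. f u \<noteq> 0"
proof -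
  define Q where "Q e \<longleftrightarrow> (\<exists>e'. adj e e') \<and> (\<exists>u\<in>U. e u \<noteq> 0)" for e
  define k where "k e = dim {u \<in> U. e u = 0}" for e :: "'b \<Rightarrow> 'b"
  obtain u where "u \<in> U" "u \<noteq> 0" using nonzero subspace_0[OF U] by blast
  then have "Q (act \<one>)" unfolding Q_def using adj_act[of \<one>] act_one by fastforce
  moreover have "\<forall>e. Q e \<longrightarrow> k e < Suc (card C)"
    unfolding k_def using C by (intro allI impI le_imp_less_Suc dim_le_card) auto
  ultimately have "\<exists>e. Q e \<and> (\<forall>z. Q z \<longrightarrow> k z \<le> k e)" by (rule ex_has_greatest_nat)
  then obtain e where e: "Q e" and max: "\<And>z. Q z \<Longrightarrow> k z \<le> k e" by blast
  obtain e' u1 where e': "adj e e'" and u1: "u1 \<in> U" "e u1 \<noteq> 0" using e Q_def by blast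
  have vs: "vector_space scale" by unfold_locales
  have eae: "\<exists>c. \<forall>v\<in>U. e (a (e v)) = scale c (e v)" if a: "adj a a'" for a a'
  proof -
    have lin: "lin_on scale scale (e ` U) (\<lambda>x. e (a x))"
      by (rule lin_on_subset[OF adj_lin1[OF adj_comp[OF a e']]]) (use adj_in[OF e'] in blast)
    have "subspace (e ` U)" by (rule subspace_image_on[OF adj_lin1[OF e'] vs U])
    moreover have "(\<lambda>x. e (a x)) ` e ` U \<subseteq> e ` U" using adj_in[OF a] adj_in[OF e'] by blast
    moreover have "e ` U \<noteq> {0}" using u1 by blast
    moreover have "e ` U \<subseteq> span C" using adj_in[OF e'] C(1) by blast
    ultimately have "\<exists>c. \<exists>x\<in>e ` U. x \<noteq> 0 \<and> e (a x) = scale c x"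
      using C(2) by (intro exists_eigenvector[OF roots lin])
    then obtain c x where c: "x \<in> e ` U" "x \<noteq> 0" "e (a x) = scale c x" by blast
    then obtain v where v: "v \<in> U" "e v \<noteq> 0" "e (a (e v)) = scale c (e v)" by blast
    let ?z = "\<lambda>u. e (a (e u)) - scale c (e u)"
    have z: "adj ?z (\<lambda>u. e' (a' (e' u)) - scale c (e' u))"
      by (rule adj_diff[OF adj_comp[OF adj_comp[OF e' a] e'] e'])
    have a0: "e (a 0) = 0" using lin_on_zero[OF adj_lin1 U] a e' by metis
    have "{u \<in> U. e u = 0} \<subset> {u \<in> U. ?z u = 0}"
    proof (rule psubsetI)
      show "{u \<in> U. e u = 0} \<subseteq> {u \<in> U. ?z u = 0}" using a0 by auto
      have "v \<in> {u \<in> U. ?z u = 0}" "v \<notin> {u \<in> U. e u = 0}" using v by auto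
      then show "{u \<in> U. e u = 0} \<noteq> {u \<in> U. ?z u = 0}" by blast
    qed
    then have "k e < k ?z"
      unfolding k_def
      using C by (intro dim_strict_mono[of _ _ C] subspace_kernel[OF adj_lin1[OF e'] vs U]) auto
    then have "\<not> Q ?z" using max[of ?z] by auto
    then have "\<forall>u\<in>U. ?z u = 0" using z unfolding Q_def by blast
    then show ?thesis by auto
  qed
  have "\<exists>c. e v = scale c (e u1)" if v: "v \<in> U" for v
  proof -
    obtain a a' where a: "adj a a'" "a (e u1) = v"
      using adj_transitive[OF adj_in[OF e' u1(1)] u1(2) v] by blast
    then show ?thesis using eae[OF a(1)] u1(1) by blast
  qed
  then obtain f where f: "\<And>v. v \<in> U \<Longrightarrow> e v = scale (f v) (e u1)" by metis
  have "lin_on scale (*) U f"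
    unfolding lin_on_def
  proof (intro conjI ballI allI)
    fix x y assume xy: "x \<in> U" "y \<in> U"
    have "scale (f (x + y)) (e u1) = scale (f x + f y) (e u1)"
      using lin_on_add[OF adj_lin1[OF e'] xy] f xy subspace_add[OF U] by (simp add: scale_left_distrib)
    then show "f (x + y) = f x + f y" using u1(2) by simp
  next
    fix c x assume x: "x \<in> U"
    have "scale (f (scale c x)) (e u1) = scale (c * f x) (e u1)"
      using lin_on_scale[OF adj_lin1[OF e'] x, of c] f x subspace_scale[OF U] by simp
    then show "f (scale c x) = c * f x" using u1(2) by simp
  qed
  moreover have "f u1 \<noteq> 0" using f[OF u1(1)] u1(2) by auto
  ultimately show ?thesis using that[OF e' adj_in[OF e' u1(1)] u1(2)] f u1(1) by blast
qed

theorem exists_invariant_form: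
  obtains B where "\<And>v. v \<in> U \<Longrightarrow> lin_on scale (*) U (\<lambda>u. B u v)"
    and "\<And>u. u \<in> U \<Longrightarrow> lin_on scale (*) U (\<lambda>v. B u v)"
    and "\<And>g u v. g \<in> carrier G \<Longrightarrow> u \<in> U \<Longrightarrow> v \<in> U \<Longrightarrow> B (act g u) (act g v) = B u v"
    and "\<And>v. v \<in> U \<Longrightarrow> (\<And>u. u \<in> U \<Longrightarrow> B u v = 0) \<Longrightarrow> v = 0"
proof -
  obtain e e' f u0 where e: "adj e e'" and u0: "u0 \<in> U" "u0 \<noteq> 0" and f: "lin_on scale (*) U f"
    and ef: "\<And>u. u \<in> U \<Longrightarrow> e u = scale (f u) u0" and f0: "\<exists>u\<in>U. f u \<noteq> 0"
    by (rule exists_rank_one) blast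
  obtain u1 where u1: "u1 \<in> U" "f u1 \<noteq> 0" using f0 by blast
  then have u1': "u1 \<noteq> 0" using lin_on_zero[OF f U] by auto
  obtain E where E: "E \<subseteq> U" "independent E" "U \<subseteq> span E" "card E = dim U"
    by (rule basis_exists)
  have fE: "finite E" using independent_span_bound[OF C(2) E(2)] E(1) C(1) by blast
  have sE: "span E = U" using E(1,3) U span_minimal by blast
  note tr = adj_trace[OF E(2) fE sE]
  have zero: "adj (\<lambda>_. 0) (\<lambda>_. 0)"
    using adj_scale[OF adj_act[OF one_closed], of 0] by simp
  have trace0: "trace_on scale E T = 0" if "\<And>u. u \<in> U \<Longrightarrow> T u = 0" for T
  proof -
    have "trace_on scale E T = (\<Sum>b\<in>E. 0)"
      unfolding trace_on_def using that E(1)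
      by (intro sum.cong refl) (auto simp: subset_iff representation_zero)
    then show ?thesis by simp
  qed
  \<comment> \<open>If \<open>T = e' \<circ> a'\<close> were nonzero, \<open>d \<circ> T \<circ> c \<circ> e\<close> would have nonzero trace for suitable \<open>c\<close> and
      \<open>d\<close>, whereas the reversed product contains the factor \<open>a \<circ> e = 0\<close>.\<close>
  have key: "e' (a' v) = 0"
    if a: "adj a a'" and ae: "\<And>u. u \<in> U \<Longrightarrow> a (e u) = 0" and v: "v \<in> U" for a a' v
  proof (rule ccontr)
    assume nz: "e' (a' v) \<noteq> 0"
    let ?T = "\<lambda>u. e' (a' u)"
    have T: "adj ?T (\<lambda>u. a (e u))" using adj_comp[OF adj_sym[OF a] adj_sym[OF e]] .
    obtain c c' where c: "adj c c'" "c u0 = v" using adj_transitive[OF u0 v] by blast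
    obtain d d' where d: "adj d d'" "d (?T v) = u1"
      using adj_transitive[OF adj_in[OF T v] nz u1(1)] by blast
    have ced: "adj (\<lambda>u. c (e (d u))) (\<lambda>u. d' (e' (c' u)))"
      using adj_comp[OF adj_comp[OF d(1) e] c(1)] .
    have "trace_on scale E (\<lambda>u. ?T (c (e (d u)))) = trace_on scale E (\<lambda>u. d' (e' (c' (a (e u)))))"
      by (rule tr[OF adj_comp[OF ced T]])
    also have "\<dots> = 0"
    proof (rule trace0)
      fix u assume "u \<in> U"
      have "c' 0 = 0" "e' 0 = 0" "d' 0 = 0"
        using lin_on_zero[OF adj_lin1 U] adj_sym c(1) d(1) e by blast+
      then show "d' (e' (c' (a (e u)))) = 0" using ae[OF \<open>u \<in> U\<close>] by simp
    qed
    finally have 0: "trace_on scale E (\<lambda>u. ?T (c (e (d u)))) = 0" .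
    have Tce: "adj (\<lambda>u. ?T (c (e u))) (\<lambda>u. e' (c' (a (e u))))"
      using adj_comp[OF adj_comp[OF e c(1)] T] .
    have "trace_on scale E (\<lambda>u. d (?T (c (e u)))) = trace_on scale E (\<lambda>u. ?T (c (e (d u))))"
      using trace_on_comp_commute[OF E(2) fE, of d "\<lambda>u. ?T (c (e u))"] adj_lin[OF d(1)] adj_lin[OF Tce] sE
      by simp
    moreover have "trace_on scale E (\<lambda>u. d (?T (c (e u)))) = f u1"
    proof (rule trace_on_rank_one[OF E(2) fE])
      show "lin_on scale (*) (span E) f" "u1 \<in> span E" using f u1 sE by auto
      fix u assume "u \<in> span E"
      then have u: "u \<in> U" using sE by simp
      have "c (e u) = scale (f u) v"
        using ef[OF u] lin_on_scale[OF adj_lin1[OF c(1)] u0(1)] c(2) by simp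
      then have "?T (c (e u)) = scale (f u) (?T v)" using lin_on_scale[OF adj_lin1[OF T] v] by simp
      then show "d (?T (c (e u))) = scale (f u) u1"
        using lin_on_scale[OF adj_lin1[OF d(1)] adj_in[OF T v]] d(2) by simp
    qed
    ultimately show False using 0 u1(2) by simp
  qed
  have "\<exists>v\<in>U. e' v \<noteq> 0"
  proof (rule ccontr)
    assume "\<not> ?thesis"
    then have e'0: "e' v = 0" if "v \<in> U" for v using that by blast
    obtain b b' where b: "adj b b'" "b u0 = u1" using adj_transitive[OF u0 u1(1)] by blast
    have "trace_on scale E (\<lambda>u. b (e u)) = trace_on scale E (\<lambda>u. e' (b' u))"
      by (rule tr[OF adj_comp[OF e b(1)]])
    also have "\<dots> = 0" by (rule trace0) (use e'0 adj_in[OF adj_sym[OF b(1)]] in blast)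
    also have "trace_on scale E (\<lambda>u. b (e u)) = f u1"
      using f u1 sE by (intro trace_on_rank_one[OF E(2) fE])
        (auto simp: ef lin_on_scale[OF adj_lin1[OF b(1)] u0(1)] b(2))
    finally show False using u1(2) by simp
  qed
  then obtain v1 where v1: "v1 \<in> U" "e' v1 \<noteq> 0" by blast
  \<comment> \<open>The functional \<open>f \<circ> d\<close> does not vanish at \<open>e' v1\<close>, so the form is nonzero.\<close>
  obtain d d' where d: "adj d d'" "d (e' v1) = u1"
    using adj_transitive[OF adj_in[OF adj_sym[OF e] v1(1)] v1(2) u1(1)] by blast
  have "\<exists>a. \<exists>a'. adj a a' \<and> a u0 = u" if "u \<in> U" for u using adj_transitive[OF u0 that] by blast
  then obtain A where A: "\<And>u. u \<in> U \<Longrightarrow> \<exists>a'. adj (A u) a' \<and> A u u0 = u" by metis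
  then obtain A' where A': "\<And>u. u \<in> U \<Longrightarrow> adj (A u) (A' u)" "\<And>u. u \<in> U \<Longrightarrow> A u u0 = u" by metis
  define B where "B u v = f (d (e' (A' u v)))" for u v
  have wd: "e' (a' v) = e' (b' v)" if "adj a a'" "adj b b'" "a u0 = b u0" "v \<in> U" for a a' b b' v
  proof -
    have ab: "adj (\<lambda>u. a u - scale 1 (b u)) (\<lambda>u. a' u - scale 1 (b' u))" by (rule adj_diff[OF that(1,2)])
    have "e' (a' v - scale 1 (b' v)) = 0"
    proof (rule key[OF ab _ that(4)])
      fix u assume "u \<in> U"
      then show "a (e u) - scale 1 (b (e u)) = 0"
        using that(3) by (simp add: ef lin_on_scale[OF adj_lin1[OF that(1)] u0(1)]
            lin_on_scale[OF adj_lin1[OF that(2)] u0(1)])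
    qed
    then show ?thesis
      using lin_on_diff[OF adj_lin1[OF adj_sym[OF e]] U] adj_in[OF adj_sym[OF that(1)] that(4)]
        adj_in[OF adj_sym[OF that(2)] that(4)] by simp
  qed
  have Bval: "B (a u0) v = f (d (e' (a' v)))" if a: "adj a a'" and v: "v \<in> U" for a a' v
    unfolding B_def using wd[OF A'(1) a A'(2) v] adj_in[OF a u0(1)] by simp
  have fde: "lin_on scale (*) U (\<lambda>x. f (d (e' x)))"
    using lin_on_comp[OF adj_lin1[OF adj_comp[OF adj_sym[OF e] d(1)]] f] adj_in[OF adj_comp[OF adj_sym[OF e] d(1)]]
    by blast
  have B1: "lin_on scale (*) U (\<lambda>u. B u v)" if v: "v \<in> U" for v
    unfolding lin_on_def
  proof (intro conjI ballI allI)
    fix x y assume xy: "x \<in> U" "y \<in> U"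
    have "B (A x u0 + A y u0) v = f (d (e' (A' x v + A' y v)))"
      by (rule Bval[OF adj_add[OF A'(1) A'(1)] v]) (rule xy)+
    also have "\<dots> = f (d (e' (A' x v))) + f (d (e' (A' y v)))"
      using xy v by (intro lin_on_add[OF fde] adj_in[OF adj_sym[OF A'(1)]])
    finally show "B (x + y) v = B x v + B y v" using xy by (simp add: A'(2) B_def)
  next
    fix c x assume x: "x \<in> U"
    have "B (scale c (A x u0)) v = f (d (e' (scale c (A' x v))))"
      by (rule Bval[OF adj_scale[OF A'(1)] v]) (rule x)
    also have "\<dots> = c * f (d (e' (A' x v)))"
      using x v by (intro lin_on_scale[OF fde] adj_in[OF adj_sym[OF A'(1)]])
    finally show "B (scale c x) v = c * B x v" using x by (simp add: A'(2) B_def)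
  qed
  have B2: "lin_on scale (*) U (\<lambda>v. B u v)" if u: "u \<in> U" for u
    unfolding B_def
    using lin_on_comp[OF adj_lin1[OF adj_sym[OF A'(1)[OF u]]] fde] adj_in[OF adj_sym[OF A'(1)[OF u]]]
    by blast
  have inv: "B (act g u) (act g v) = B u v" if g: "g \<in> carrier G" and u: "u \<in> U" and v: "v \<in> U" for g u v
  proof -
    have "B (act g (A u u0)) (act g v) = f (d (e' (A' u (act (inv g) (act g v)))))"
      by (rule Bval[OF adj_comp_act[OF g A'(1)[OF u]] act_in[OF g v]])
    moreover have "act (inv g) (act g v) = v"
      using g v act_mult[of "inv g" g v] act_one by simp
    ultimately show ?thesis using u by (simp add: A'(2) B_def)
  qed
  have nondeg: "v = 0" if v: "v \<in> U" and Bv: "\<And>u. u \<in> U \<Longrightarrow> B u v = 0" for v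
  proof -
    let ?W = "{v \<in> U. \<forall>u\<in>U. B u v = 0}"
    have "subspace ?W"
      using subspace_0[OF U] subspace_add[OF U] subspace_scale[OF U] lin_on_zero[OF B2 U]
        lin_on_add[OF B2] lin_on_scale[OF B2]
      by (intro subspaceI) auto
    moreover have "act g w \<in> ?W" if g: "g \<in> carrier G" and w: "w \<in> ?W" for g w
    proof -
      have "B u (act g w) = 0" if u: "u \<in> U" for u
      proof -
        have "B (act g (act (inv g) u)) (act g w) = B (act (inv g) u) w"
          using g w u act_in by (intro inv) auto
        moreover have "act g (act (inv g) u) = u"
          using g u act_mult[of g "inv g" u] act_one by simp
        ultimately show ?thesis using w act_in[of "inv g" u] g u by simp
      qed
      then show ?thesis using g w act_in by blast
    qed
    ultimately have "?W = {0} \<or> ?W = U" by (intro simple) auto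
    moreover have "B u0 v1 \<noteq> 0"
      using Bval[OF adj_act[OF one_closed] v1(1)] act_one u0(1) v1(1) d(2) u1(2) by simp
    ultimately show ?thesis using v Bv u0(1) v1(1) by blast
  qed
  show ?thesis by (rule that[OF B1 B2 inv nondeg])
qed

end


section \<open>Diagrams and words\<close>

text \<open>
  A tabloid is encoded by its word, which maps every label to its row, and a column tabloid by the
  word that maps every label to its column. The labels form a finite set \<open>N\<close>; words vanish off \<open>N\<close>.
\<close>

type_synonym word = "nat \<Rightarrow> nat"

definition zero_off :: "nat set \<Rightarrow> word \<Rightarrow> bool" where
  "zero_off N w \<longleftrightarrow> (\<forall>k. k \<notin> N \<longrightarrow> w k = 0)"

definition is_diagram :: "(nat \<times> nat) set \<Rightarrow> bool" where
  "is_diagram D \<longleftrightarrow> finite D \<and> (\<forall>i j i' j'. (i, j) \<in> D \<longrightarrow> i' \<le> i \<longrightarrow> j' \<le> j \<longrightarrow> (i', j') \<in> D)"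

definition row_len :: "(nat \<times> nat) set \<Rightarrow> nat \<Rightarrow> nat" where
  "row_len D i = card {j. (i, j) \<in> D}"

definition has_content :: "nat set \<Rightarrow> (nat \<Rightarrow> nat) \<Rightarrow> word \<Rightarrow> bool" where
  "has_content N r w \<longleftrightarrow> zero_off N w \<and> (\<forall>i. card {k \<in> N. w k = i} = r i)"

definition filling :: "nat set \<Rightarrow> (nat \<times> nat) set \<Rightarrow> word \<Rightarrow> word \<Rightarrow> bool" where
  "filling N D w y \<longleftrightarrow> zero_off N w \<and> zero_off N y \<and> bij_betw (\<lambda>k. (w k, y k)) N D"

lemma downclosed_eq_lessThan:
  fixes A :: "nat set"
  assumes "finite A" "\<And>j j'. j \<in> A \<Longrightarrow> j' \<le> j \<Longrightarrow> j' \<in> A"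
  shows "A = {..<card A}"
proof -
  define m where "m = (LEAST m. m \<notin> A)"
  have "\<exists>m. m \<notin> A" using assms(1) ex_new_if_finite infinite_UNIV_nat by blast
  then have m: "m \<notin> A" unfolding m_def by (rule LeastI_ex)
  have "j \<in> A" if "j < m" for j using not_less_Least[of j "\<lambda>m. m \<notin> A"] that m_def by blast
  moreover have "j < m" if "j \<in> A" for j using assms(2)[OF that] m by (meson not_le)
  ultimately have "A = {..<m}" by auto
  then show ?thesis by simp
qed

lemma diagram_iff:
  assumes "is_diagram D"
  shows "(i, j) \<in> D \<longleftrightarrow> j < row_len D i"
proof -
  have "{j. (i, j) \<in> D} \<subseteq> snd ` D" by force
  then have "finite {j. (i, j) \<in> D}"
    using assms finite_subset is_diagram_def by blast
  then have "{j. (i, j) \<in> D} = {..<row_len D i}"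
    unfolding row_len_def
    by (rule downclosed_eq_lessThan) (use assms is_diagram_def in blast)
  then show ?thesis by (metis lessThan_iff mem_Collect_eq)
qed

lemma is_diagram_converse: "is_diagram D \<Longrightarrow> is_diagram (D\<inverse>)"
  unfolding is_diagram_def by (metis converse_iff finite_converse)

lemma row_len_antimono:
  assumes D: "is_diagram D" and i: "i \<le> i'"
  shows "row_len D i' \<le> row_len D i"
proof (rule ccontr)
  assume "\<not> ?thesis"
  then have "(i', row_len D i) \<in> D" by (simp add: diagram_iff[OF D])
  then have "(i, row_len D i) \<in> D" using D i is_diagram_def by blast
  then show False by (simp add: diagram_iff[OF D])
qed

lemma zero_off_comp: "g permutes N \<Longrightarrow> zero_off N w \<Longrightarrow> zero_off N (w \<circ> g)"
  by (auto simp: zero_off_def permutes_not_in)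

lemma zero_off_comp_iff: "g permutes N \<Longrightarrow> zero_off N (w \<circ> g) \<longleftrightarrow> zero_off N w"
  by (metis comp_assoc comp_id permutes_inv permutes_inv_o(1) zero_off_comp)

lemma filling_comp_iff:
  assumes g: "g permutes N"
  shows "filling N D (w \<circ> g) (y \<circ> g) \<longleftrightarrow> filling N D w y"
proof -
  have "bij_betw (\<lambda>k. (w k, y k)) N D \<longleftrightarrow> bij_betw ((\<lambda>k. (w k, y k)) \<circ> g) N D"
    by (rule bij_betw_comp_iff[OF permutes_imp_bij[OF g]])
  then show ?thesis
    by (simp only: filling_def zero_off_comp_iff[OF g]) (simp add: o_def)
qed

lemma filling_converse: "filling N (D\<inverse>) y w \<longleftrightarrow> filling N D w y"
proof -
  have *: "bij_betw (\<lambda>k. (y k, w k)) N (D\<inverse>)" if "bij_betw (\<lambda>k. (w k, y k)) N D" for w y :: word and D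
    using that unfolding bij_betw_def inj_on_def by auto
  show ?thesis using *[of w y D] *[of y w "D\<inverse>"] by (auto simp: filling_def)
qed

lemma filling_content:
  assumes "filling N D w y"
  shows "has_content N (row_len D) w"
proof -
  have b: "bij_betw (\<lambda>k. (w k, y k)) N D" and z: "zero_off N w" using assms by (auto simp: filling_def)
  have "card {k \<in> N. w k = i} = row_len D i" for i
    unfolding row_len_def
  proof (rule bij_betw_same_card)
    show "bij_betw y {k \<in> N. w k = i} {j. (i, j) \<in> D}"
      using b unfolding bij_betw_def inj_on_def by auto
  qed
  then show ?thesis using z by (simp add: has_content_def)
qed

lemma card_left_columns:
  fixes M :: "('a \<times> nat) set"
  assumes "finite M" "fst ` M \<subseteq> I" "finite I"
  shows "card {b \<in> M. snd b < m} = (\<Sum>i\<in>I. card {j. (i, j) \<in> M \<and> j < m})"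
proof -
  have "{b \<in> M. snd b < m} = (SIGMA i:I. {j. (i, j) \<in> M \<and> j < m})"
    using assms(2) by force
  moreover have "finite {j. (i, j) \<in> M \<and> j < m}" for i
    by (rule finite_subset[of _ "{..<m}"]) auto
  ultimately show ?thesis using assms(3) by simp
qed

lemma card_left_columns_converse:
  assumes "finite M"
  shows "card {b \<in> M. snd b < m} = (\<Sum>j<m. row_len (M\<inverse>) j)"
proof -
  have "card {b \<in> M. snd b < m} = card {b \<in> M\<inverse>. fst b < m}"
    by (rule bij_betw_same_card[of prod.swap]) (auto simp: bij_betw_def inj_on_def image_def)
  also have "{b \<in> M\<inverse>. fst b < m} = (SIGMA j:{..<m}. {i. (j, i) \<in> M\<inverse>})" by auto
  also have "card \<dots> = (\<Sum>j<m. card {i. (j, i) \<in> M\<inverse>})"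
  proof (rule card_SigmaI)
    show "\<forall>j\<in>{..<m}. finite {i. (j, i) \<in> M\<inverse>}"
    proof
      fix j
      have "{i. (j, i) \<in> M\<inverse>} \<subseteq> fst ` M" by force
      then show "finite {i. (j, i) \<in> M\<inverse>}" using assms finite_subset by blast
    qed
  qed simp
  finally show ?thesis by (simp add: row_len_def)
qed

lemma row_part_le:
  assumes D: "is_diagram D" and M: "finite M" "row_len M i = row_len D i"
  shows "card {j. (i, j) \<in> M \<and> j < m} \<le> card {j. (i, j) \<in> D \<and> j < m}"
proof -
  have fin: "finite {j. (i, j) \<in> M}"
    by (rule finite_subset[OF _ finite_imageI[OF M(1), of snd]]) force
  have "card {j. (i, j) \<in> M \<and> j < m} \<le> row_len M i"
    unfolding row_len_def by (rule card_mono[OF fin]) auto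
  moreover have "card {j. (i, j) \<in> M \<and> j < m} \<le> card {..<m}" by (rule card_mono) auto
  moreover have "{j. (i, j) \<in> D \<and> j < m} = {..<min (row_len D i) m}"
    by (auto simp: diagram_iff[OF D])
  ultimately show ?thesis using M(2) by simp
qed

text \<open>
  A diagram is pushed to the left: row by row, its first \<open>m\<close> columns contain at least as many boxes
  as those of any other set with the same row lengths, and equality for all \<open>m\<close> leaves no freedom.
\<close>

lemma left_columns_le:
  assumes D: "is_diagram D" and M: "finite M" "\<And>i. row_len M i = row_len D i"
  shows "card {b \<in> M. snd b < m} \<le> card {b \<in> D. snd b < m}"
proof -
  have fD: "finite D" using D by (simp add: is_diagram_def)
  have "card {b \<in> M. snd b < m} = (\<Sum>i\<in>fst ` (M \<union> D). card {j. (i, j) \<in> M \<and> j < m})"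
    using M(1) fD by (intro card_left_columns) auto
  also have "\<dots> \<le> (\<Sum>i\<in>fst ` (M \<union> D). card {j. (i, j) \<in> D \<and> j < m})"
    by (intro sum_mono row_part_le D M)
  also have "\<dots> = card {b \<in> D. snd b < m}"
    using M(1) fD by (intro card_left_columns[symmetric]) auto
  finally show ?thesis .
qed

lemma diagram_unique:
  assumes D: "is_diagram D" and M: "finite M" "\<And>i. row_len M i = row_len D i"
    and left: "\<And>m. card {b \<in> M. snd b < m} = card {b \<in> D. snd b < m}"
  shows "M = D"
proof -
  have fD: "finite D" using D by (simp add: is_diagram_def)
  have row: "card {j. (i, j) \<in> M \<and> j < m} = card {j. (i, j) \<in> D \<and> j < m}" for i m
  proof (cases "i \<in> fst ` (M \<union> D)")
    case True
    have "(\<Sum>i\<in>fst ` (M \<union> D). card {j. (i, j) \<in> M \<and> j < m}) =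
        (\<Sum>i\<in>fst ` (M \<union> D). card {j. (i, j) \<in> D \<and> j < m})"
      using left[of m] card_left_columns[of M "fst ` (M \<union> D)" m] card_left_columns[of D "fst ` (M \<union> D)" m]
        M(1) fD by (simp add: image_mono)
    from sum_mono_inv[OF this row_part_le[OF D M(1,2)] True] show ?thesis
      using M(1) fD by simp
  next
    case False
    then have "{j. (i, j) \<in> M \<and> j < m} = {}" "{j. (i, j) \<in> D \<and> j < m} = {}" by force+
    then show ?thesis by (simp only:)
  qed
  have step: "(i, m) \<in> A \<longleftrightarrow> card {j. (i, j) \<in> A \<and> j < Suc m} \<noteq> card {j. (i, j) \<in> A \<and> j < m}"
    for A :: "(nat \<times> nat) set" and i m
  proof -
    have "{j. (i, j) \<in> A \<and> j < Suc m} =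
        (if (i, m) \<in> A then insert m {j. (i, j) \<in> A \<and> j < m} else {j. (i, j) \<in> A \<and> j < m})"
      by (auto simp: less_Suc_eq)
    moreover have "finite {j. (i, j) \<in> A \<and> j < m}" by (rule finite_subset[of _ "{..<m}"]) auto
    ultimately show ?thesis by simp
  qed
  have "(i, m) \<in> M \<longleftrightarrow> (i, m) \<in> D" for i m
  proof -
    have "(i, m) \<in> M \<longleftrightarrow> card {j. (i, j) \<in> D \<and> j < Suc m} \<noteq> card {j. (i, j) \<in> D \<and> j < m}"
      by (rule step[of i m M, unfolded row[of i "Suc m"] row[of i m]])
    also have "\<dots> \<longleftrightarrow> (i, m) \<in> D" by (rule step[symmetric])
    finally show ?thesis .
  qed
  then show ?thesis by auto
qed

lemma row_len_pairs:
  assumes inj: "inj_on (\<lambda>k. (w k, y k)) N"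
  shows "row_len ((\<lambda>k. (w k, y k)) ` N) i = card {k \<in> N. w k = i}"
proof -
  have "bij_betw y {k \<in> N. w k = i} {j. (i, j) \<in> (\<lambda>k. (w k, y k)) ` N}"
    using inj unfolding bij_betw_def inj_on_def by auto
  then show ?thesis unfolding row_len_def by (rule bij_betw_same_card[symmetric])
qed

lemma converse_pairs: "((\<lambda>k. (w k, y k)) ` N)\<inverse> = (\<lambda>k. (y k, w k)) ` N"
  by auto

lemma distinct_pairs_dominance:
  assumes D: "is_diagram D" and N: "finite N" and inj: "inj_on (\<lambda>k. (w k, y k)) N"
    and w: "has_content N (row_len D) w" and y: "has_content N s y"
  shows "(\<Sum>j<m. s j) \<le> (\<Sum>j<m. row_len (D\<inverse>) j)"
proof -
  let ?M = "(\<lambda>k. (w k, y k)) ` N"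
  have inj': "inj_on (\<lambda>k. (y k, w k)) N" using inj by (auto simp: inj_on_def)
  have "row_len ?M i = row_len D i" for i
    using row_len_pairs[OF inj] w by (simp add: has_content_def)
  then have "card {b \<in> ?M. snd b < m} \<le> card {b \<in> D. snd b < m}"
    using N by (intro left_columns_le[OF D]) auto
  moreover have "row_len (?M\<inverse>) j = s j" for j
    unfolding converse_pairs row_len_pairs[OF inj'] using y by (simp add: has_content_def)
  ultimately show ?thesis
    using card_left_columns_converse[of ?M m] card_left_columns_converse[of D m] N D
    by (simp add: is_diagram_def)
qed

lemma filling_if_distinct_pairs:
  assumes D: "is_diagram D" and N: "finite N" and inj: "inj_on (\<lambda>k. (w k, y k)) N"
    and w: "has_content N (row_len D) w" and y: "has_content N (row_len (D\<inverse>)) y"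
  shows "filling N D w y"
proof -
  let ?M = "(\<lambda>k. (w k, y k)) ` N"
  have inj': "inj_on (\<lambda>k. (y k, w k)) N" using inj by (auto simp: inj_on_def)
  have "?M = D"
  proof (rule diagram_unique[OF D])
    show "row_len ?M i = row_len D i" for i
      using row_len_pairs[OF inj] w by (simp add: has_content_def)
    have "row_len (?M\<inverse>) j = row_len (D\<inverse>) j" for j
      unfolding converse_pairs row_len_pairs[OF inj'] using y by (simp add: has_content_def)
    then show "card {b \<in> ?M. snd b < m} = card {b \<in> D. snd b < m}" for m
      using card_left_columns_converse[of ?M m] card_left_columns_converse[of D m] N D
      by (simp add: is_diagram_def)
  qed (use N in simp)
  then show ?thesis using inj w y by (simp add: filling_def has_content_def bij_betw_def)
qed

lemma diagram_eq_converse_if_dominance: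
  assumes D: "is_diagram D"
    and eq: "\<And>m. (\<Sum>j<m. row_len D j) = (\<Sum>j<m. row_len (D\<inverse>) j)"
  shows "D = D\<inverse>"
proof -
  have "row_len D j = row_len (D\<inverse>) j" for j using eq[of j] eq[of "Suc j"] by simp
  then show ?thesis
    using diagram_iff[OF D] diagram_iff[OF is_diagram_converse[OF D]] by auto
qed


section \<open>Signed fillings\<close>

text \<open>
  \<open>Delta N D t0 w y\<close> is the coefficient of the tabloid \<open>w\<close> in the polytabloid of a tableau with
  column word \<open>y\<close>, up to a sign that does not depend on \<open>w\<close>. The reference bijection \<open>t0\<close> from \<open>D\<close> to
  \<open>N\<close> turns a filling into a permutation; its sign treats rows and columns alike, so that the
  functions \<open>Delta N D t0 w\<close> of the second word play the same role for the transposed diagram.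
\<close>

definition Delta :: "nat set \<Rightarrow> (nat \<times> nat) set \<Rightarrow> (nat \<times> nat \<Rightarrow> nat) \<Rightarrow> word \<Rightarrow> word \<Rightarrow> 'a::comm_ring_1" where
  "Delta N D t0 w y =
    (if filling N D w y then of_int (sign (\<lambda>k. if k \<in> N then t0 (w k, y k) else k)) else 0)"

lemma filling_permutes:
  assumes "bij_betw t0 D N" "filling N D w y"
  shows "(\<lambda>k. if k \<in> N then t0 (w k, y k) else k) permutes N"
proof (rule bij_imp_permutes)
  have "bij_betw (t0 \<circ> (\<lambda>k. (w k, y k))) N N"
    using assms bij_betw_trans by (auto simp: filling_def)
  then show "bij_betw (\<lambda>k. if k \<in> N then t0 (w k, y k) else k) N N"
    by (rule iffD1[OF bij_betw_cong, rotated]) simp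
qed simp

lemma permutation_if_permutes: "finite N \<Longrightarrow> g permutes N \<Longrightarrow> permutation g"
  using permutation_permutes by blast

lemma of_int_sign_square: "of_int (sign g) * of_int (sign g) = (1 :: 'a::comm_ring_1)"
  by (simp add: sign_def)

lemma Delta_square: "filling N D w y \<Longrightarrow> Delta N D t0 w y * Delta N D t0 w y = (1 :: 'a::comm_ring_1)"
  by (simp add: Delta_def of_int_sign_square)

lemma Delta_comp:
  assumes N: "finite N" and t0: "bij_betw t0 D N" and g: "g permutes N"
  shows "Delta N D t0 (w \<circ> g) (y \<circ> g) = of_int (sign g) * (Delta N D t0 w y :: 'a::comm_ring_1)"
proof (cases "filling N D w y")
  case True
  let ?p = "\<lambda>k. if k \<in> N then t0 (w k, y k) else k"
  have p: "?p permutes N" using filling_permutes[OF t0 True] .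
  have "(\<lambda>k. if k \<in> N then t0 ((w \<circ> g) k, (y \<circ> g) k) else k) = ?p \<circ> g"
    using permutes_in_image[OF g] permutes_not_in[OF g] by auto
  then have "sign (\<lambda>k. if k \<in> N then t0 ((w \<circ> g) k, (y \<circ> g) k) else k) = sign ?p * sign g"
    using permutation_if_permutes[OF N] p g by (simp add: sign_compose)
  then show ?thesis using True by (simp add: Delta_def filling_comp_iff[OF g] mult.commute)
qed (simp add: Delta_def filling_comp_iff[OF g])

lemma Delta_converse: "Delta N (D\<inverse>) (t0 \<circ> prod.swap) y w = Delta N D t0 w y"
  unfolding Delta_def filling_converse o_def swap_simp by (rule refl)

lemma bij_betw_converse: "bij_betw t0 D N \<Longrightarrow> bij_betw (t0 \<circ> prod.swap) (D\<inverse>) N"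
  by (rule bij_betw_trans[of prod.swap _ D]) (auto simp: bij_betw_def inj_on_def)

lemma Delta_change_reference:
  assumes N: "finite N" and t0: "bij_betw t0 D N" and t1: "bij_betw t1 D N"
  obtains s :: int where "s * s = 1"
    "\<And>w y. Delta N D t0 w y = of_int s * (Delta N D t1 w y :: 'a::comm_ring_1)"
proof -
  define q where "q k = (if k \<in> N then t0 (inv_into D t1 k) else k)" for k
  have q: "q permutes N"
  proof (rule bij_imp_permutes)
    have "bij_betw (t0 \<circ> inv_into D t1) N N"
      using bij_betw_trans[OF bij_betw_inv_into[OF t1] t0] .
    then show "bij_betw q N N" by (rule iffD1[OF bij_betw_cong, rotated]) (simp add: q_def)
  qed (simp add: q_def)
  have "Delta N D t0 w y = of_int (sign q) * (Delta N D t1 w y :: 'a)" for w y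
  proof (cases "filling N D w y")
    case True
    have mem: "(w k, y k) \<in> D" if "k \<in> N" for k
      using True that by (auto simp: filling_def bij_betw_def)
    have "(\<lambda>k. if k \<in> N then t0 (w k, y k) else k) = q \<circ> (\<lambda>k. if k \<in> N then t1 (w k, y k) else k)"
      using mem bij_betw_apply[OF t1] bij_betw_inv_into_left[OF t1] by (auto simp: q_def fun_eq_iff)
    then have "sign (\<lambda>k. if k \<in> N then t0 (w k, y k) else k) =
        sign q * sign (\<lambda>k. if k \<in> N then t1 (w k, y k) else k)"
      using permutation_if_permutes[OF N] q filling_permutes[OF t1 True] by (simp add: sign_compose)
    then show ?thesis using True by (simp add: Delta_def)
  qed (simp add: Delta_def)
  moreover have "sign q * sign q = 1" by (simp add: sign_def)
  ultimately show ?thesis using that by blast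
qed

lemma exists_filling:
  assumes t0: "bij_betw t0 D N"
  obtains w y where "filling N D w y"
proof -
  define w where "w k = (if k \<in> N then fst (inv_into D t0 k) else 0)" for k
  define y where "y k = (if k \<in> N then snd (inv_into D t0 k) else 0)" for k
  have "bij_betw (\<lambda>k. (w k, y k)) N D"
    by (rule iffD1[OF bij_betw_cong bij_betw_inv_into[OF t0]]) (simp add: w_def y_def)
  then have "filling N D w y" by (simp add: filling_def zero_off_def w_def y_def)
  then show ?thesis by (rule that)
qed

lemma antisymmetric_distinct_pairs:
  fixes v :: "word \<Rightarrow> 'a::field"
  assumes two: "(2::'a) \<noteq> 0" and nz: "v w \<noteq> 0"
    and anti: "\<And>g. g permutes N \<Longrightarrow> y \<circ> g = y \<Longrightarrow> v (w \<circ> g) = of_int (sign g) * v w"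
  shows "inj_on (\<lambda>k. (w k, y k)) N"
proof (rule inj_onI, rule ccontr)
  fix a b assume ab: "a \<in> N" "b \<in> N" "(w a, y a) = (w b, y b)" "a \<noteq> b"
  let ?g = "transpose a b"
  have g: "?g permutes N" using ab(1,2) by (rule permutes_swap_id)
  have "y \<circ> ?g = y" "w \<circ> ?g = w" using ab by (auto simp: transpose_def)
  then have "v w = - v w" using anti[OF g] ab(4) by (simp add: sign_swap_id)
  then have "2 * v w = 0" by (metis add.right_inverse mult_2)
  then show False using nz two by simp
qed

lemma filling_transitive:
  assumes f1: "filling N D w1 y1" and f: "filling N D w y"
  obtains g where "g permutes N" "w = w1 \<circ> g" "y = y1 \<circ> g"
proof -
  define g where "g k = (if k \<in> N then inv_into N (\<lambda>k. (w1 k, y1 k)) (w k, y k) else k)" for k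
  have b1: "bij_betw (\<lambda>k. (w1 k, y1 k)) N D" and b: "bij_betw (\<lambda>k. (w k, y k)) N D"
    using f1 f by (auto simp: filling_def)
  have "bij_betw (inv_into N (\<lambda>k. (w1 k, y1 k)) \<circ> (\<lambda>k. (w k, y k))) N N"
    using bij_betw_trans[OF b bij_betw_inv_into[OF b1]] .
  then have "bij_betw g N N" by (rule iffD1[OF bij_betw_cong, rotated]) (simp add: g_def)
  then have g: "g permutes N" by (rule bij_imp_permutes) (simp add: g_def)
  have gk: "w1 (g k) = w k \<and> y1 (g k) = y k" for k
  proof (cases "k \<in> N")
    case True
    have "(w k, y k) \<in> D" using b True by (auto simp: bij_betw_def)
    then have "(\<lambda>k. (w1 k, y1 k)) (g k) = (w k, y k)"
      using bij_betw_inv_into_right[OF b1] True by (simp add: g_def)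
    then show ?thesis by simp
  next
    case False
    then show ?thesis using f1 f by (simp add: g_def filling_def zero_off_def)
  qed
  show ?thesis by (rule that[OF g]) (use gk in auto)
qed

text \<open>
  A function of the row word that is antisymmetric under the column stabiliser vanishes where two
  labels share a row and a column. The remaining words form one orbit of the column stabiliser.
\<close>

lemma antisymmetric_is_Delta:
  fixes v :: "word \<Rightarrow> 'a::field"
  assumes two: "(2::'a) \<noteq> 0"
    and D: "is_diagram D" and N: "finite N" and t0: "bij_betw t0 D N"
    and supp: "\<And>w. v w \<noteq> 0 \<Longrightarrow> has_content N (row_len D) w"
    and w0: "filling N D w0 y"
    and anti: "\<And>g w. g permutes N \<Longrightarrow> y \<circ> g = y \<Longrightarrow> v (w \<circ> g) = of_int (sign g) * v w"
  shows "\<exists>c. \<forall>w. v w = c * Delta N D t0 w y"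
proof -
  have y: "has_content N (row_len (D\<inverse>)) y" using w0 filling_content filling_converse by metis
  have nofill: "v w = 0" if "\<not> filling N D w y" for w
  proof (rule ccontr)
    assume nz: "v w \<noteq> 0"
    have "inj_on (\<lambda>k. (w k, y k)) N"
      by (rule antisymmetric_distinct_pairs[of v, OF two nz]) (rule anti)
    then show False using filling_if_distinct_pairs[OF D N _ supp[OF nz] y] that by blast
  qed
  have "v w = (v w0 * Delta N D t0 w0 y) * Delta N D t0 w y" for w
  proof (cases "filling N D w y")
    case False
    then show ?thesis by (simp add: nofill Delta_def)
  next
    case True
    obtain g where g: "g permutes N" "w = w0 \<circ> g" "y = y \<circ> g" using filling_transitive[OF w0 True] .
    have "v w = of_int (sign g) * v w0" using anti[OF g(1) g(3)[symmetric], of w0] g(2) by simp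
    moreover have "Delta N D t0 w y = of_int (sign g) * (Delta N D t0 w0 y :: 'a)"
      using Delta_comp[OF N t0 g(1), of w0 y] g by simp
    ultimately show ?thesis using Delta_square[OF w0, of t0, where ?'a = 'a]
      by (simp add: algebra_simps)
  qed
  then show ?thesis by blast
qed


section \<open>The Specht space as a kernel\<close>

text \<open>
  In characteristic \<open>p\<close> the row symmetriser can kill the polytabloids, so a nonzero vector of the
  Specht space that is fixed by a row stabiliser is obtained from the integers: symmetrise there,
  divide by the greatest common divisor of the values and reduce modulo \<open>p\<close>. That the result lies in
  the Specht space is seen from James's description as a kernel intersection, whose equations survive
  the division. Its proof works over any field with \<open>2 \<noteq> 0\<close>, by induction on the number of labels.
\<close>

text \<open>
  The equation for \<open>i\<close> and \<open>y\<close> sums \<open>x\<close> over the ways to complete row \<open>i + 1\<close> with labels that \<open>y\<close>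
  has in row \<open>i\<close>; the support of \<open>x\<close> selects the sets \<open>A\<close> of the right size.
\<close>

definition raise :: "nat set \<Rightarrow> nat \<Rightarrow> word \<Rightarrow> word" where
  "raise A i y = (\<lambda>k. if k \<in> A then i else y k)"

definition in_kernel :: "nat set \<Rightarrow> (nat \<Rightarrow> nat) \<Rightarrow> (word \<Rightarrow> 'a::comm_ring_1) \<Rightarrow> bool" where
  "in_kernel N r x \<longleftrightarrow> (\<forall>w. x w \<noteq> 0 \<longrightarrow> has_content N r w) \<and>
     (\<forall>i y. card {k \<in> N. y k = Suc i} < r (Suc i) \<longrightarrow>
       (\<Sum>A\<in>Pow {k \<in> N. y k = i}. x (raise A (Suc i) y)) = 0)"

lemma in_kernel_0: "in_kernel N r (\<lambda>_. 0)"
  by (simp add: in_kernel_def)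

lemma in_kernel_add: "in_kernel N r x \<Longrightarrow> in_kernel N r x' \<Longrightarrow> in_kernel N r (\<lambda>w. x w + x' w)"
  unfolding in_kernel_def by (simp add: sum.distrib) (metis add.right_neutral)

lemma in_kernel_scale: "in_kernel N r x \<Longrightarrow> in_kernel N r (\<lambda>w. c * x w)"
  unfolding in_kernel_def by (simp flip: sum_distrib_left) (metis mult_zero_right)

lemma in_kernel_diff:
  assumes "in_kernel N r x" "in_kernel N r x'"
  shows "in_kernel N r (\<lambda>w. x w - x' w)"
  using in_kernel_add[OF assms(1) in_kernel_scale[OF assms(2), of "-1"]] by simp

lemma in_kernel_sum:
  "(\<And>g. g \<in> R \<Longrightarrow> in_kernel N r (x g)) \<Longrightarrow> in_kernel N r (\<lambda>w. \<Sum>g\<in>R. x g w)"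
  by (induction R rule: infinite_finite_induct) (simp_all add: in_kernel_0 in_kernel_add)

text \<open>
  Fewer labels in a row than in the next one leave no room: inclusion and exclusion over the
  labels \<open>E\<close> of the shorter row expresses \<open>x w\<close> by sums that the kernel equations kill.
\<close>

lemma kernel_trivial_if_increasing:
  assumes N: "finite N" and x: "in_kernel N r x" and r: "r i < r (Suc i)"
  shows "x w = 0"
proof (rule ccontr)
  assume "x w \<noteq> 0"
  then have w: "has_content N r w" using x by (simp add: in_kernel_def)
  define T where "T = {k \<in> N. w k = i \<or> w k = Suc i}"
  define W where "W B = (\<lambda>k. if k \<in> B then Suc i else if k \<in> T then i else w k)" for B
  define F where "F C E = (\<Sum>B\<in>{B \<in> Pow T. C \<subseteq> B \<and> B \<inter> E = {}}. x (W B))" for C E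
  have fT: "finite T" using N by (simp add: T_def)
  have start: "F C {} = 0" if C: "C \<subseteq> T" "card C < r (Suc i)" for C
  proof -
    have "{k \<in> N. W C k = Suc i} = C" using C(1) by (auto simp: W_def T_def)
    then have "(\<Sum>A\<in>Pow {k \<in> N. W C k = i}. x (raise A (Suc i) (W C))) = 0"
      using x C(2) by (simp add: in_kernel_def)
    also have "{k \<in> N. W C k = i} = T - C" using C(1) by (auto simp: W_def T_def)
    also have "(\<Sum>A\<in>Pow (T - C). x (raise A (Suc i) (W C))) = F C {}"
      unfolding F_def
    proof (rule sum.reindex_bij_witness[of _ "\<lambda>B. B - C" "\<lambda>A. A \<union> C"])
      fix A assume "A \<in> Pow (T - C)"
      then have "W (A \<union> C) = raise A (Suc i) (W C)" by (auto simp: W_def raise_def)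
      then show "x (W (A \<union> C)) = x (raise A (Suc i) (W C))" by simp
    qed (use C(1) in auto)
    finally show ?thesis .
  qed
  have F0: "F C E = 0" if "finite E" "E \<subseteq> T" "C \<subseteq> T" "card C + card E < r (Suc i)" "C \<inter> E = {}" for C E
    using that
  proof (induction E arbitrary: C rule: finite_induct)
    case empty
    then show ?case using start by simp
  next
    case (insert e E)
    have fin: "finite {B \<in> Pow T. P B}" for P using fT by simp
    have "{B \<in> Pow T. C \<subseteq> B \<and> B \<inter> E = {}} =
        {B \<in> Pow T. C \<subseteq> B \<and> B \<inter> insert e E = {}} \<union> {B \<in> Pow T. insert e C \<subseteq> B \<and> B \<inter> E = {}}"
      by auto
    then have "F C E = F C (insert e E) + F (insert e C) E"
      unfolding F_def using fin by (simp only:) (subst sum.union_disjoint, auto)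
    moreover have "F C E = 0" using insert by (intro insert.IH) auto
    moreover have "F (insert e C) E = 0"
      using insert finite_subset[OF insert.prems(2) fT] by (intro insert.IH) (auto simp: card_insert_if)
    ultimately show ?case by simp
  qed
  define E where "E = {k \<in> N. w k = i}"
  have "card E = r i" using w by (simp add: E_def has_content_def)
  then have "F {} E = 0" using r N by (intro F0) (auto simp: T_def E_def)
  define B0 where "B0 = {k \<in> N. w k = Suc i}"
  have fB0: "finite B0" using N by (simp add: B0_def)
  have "{B \<in> Pow T. {} \<subseteq> B \<and> B \<inter> E = {}} = Pow B0" by (auto simp: T_def B0_def E_def)
  then have "F {} E = (\<Sum>B\<in>Pow B0. x (W B))" by (simp add: F_def)
  also have "\<dots> = (\<Sum>B\<in>{B0}. x (W B))"
  proof (rule sum.mono_neutral_right)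
    show "\<forall>B\<in>Pow B0 - {B0}. x (W B) = 0"
    proof
      fix B assume B: "B \<in> Pow B0 - {B0}"
      have "{k \<in> N. W B k = Suc i} = B" using B by (auto simp: W_def T_def B0_def)
      moreover have "card B < card B0" using B fB0 by (intro psubset_card_mono) auto
      moreover have "card B0 = r (Suc i)" using w by (simp add: B0_def has_content_def)
      ultimately have "\<not> has_content N r (W B)" by (metis has_content_def less_irrefl)
      then show "x (W B) = 0" using x by (auto simp: in_kernel_def)
    qed
  qed (use fB0 in auto)
  finally have "F {} E = x (W B0)" by simp
  moreover have "W B0 = w" by (auto simp: W_def T_def B0_def)
  ultimately show False using \<open>F {} E = 0\<close> \<open>x w \<noteq> 0\<close> by simp
qed

text \<open>
  The labels of row \<open>i\<close> are too many for their columns, so two of them share a column; exchanging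
  them pairs off the terms of the kernel equation with opposite signs.
\<close>

lemma Delta_in_kernel:
  assumes two: "\<And>a :: 'a::comm_ring_1. a + a = 0 \<Longrightarrow> a = 0"
    and D: "is_diagram D" and N: "finite N" and t0: "bij_betw t0 D N"
  shows "in_kernel N (row_len D) (\<lambda>w. Delta N D t0 w y :: 'a)"
  unfolding in_kernel_def
proof (intro conjI allI impI)
  fix w assume "(Delta N D t0 w y :: 'a) \<noteq> 0"
  then have "filling N D w y" by (auto simp: Delta_def split: if_splits)
  then show "has_content N (row_len D) w" by (rule filling_content)
next
  fix i u assume u: "card {k \<in> N. u k = Suc i} < row_len D (Suc i)"
  let ?Y = "{k \<in> N. u k = i}" and ?Z = "{k \<in> N. u k = Suc i}"
  let ?t = "\<lambda>A. Delta N D t0 (raise A (Suc i) u) y :: 'a"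
  show "(\<Sum>A\<in>Pow ?Y. ?t A) = 0"
  proof (cases "\<exists>A\<in>Pow ?Y. ?t A \<noteq> 0")
    case False
    then show ?thesis by (intro sum.neutral) blast
  next
    case True
    then obtain A0 where A0: "A0 \<subseteq> ?Y" "?t A0 \<noteq> 0" by blast
    let ?w = "raise A0 (Suc i) u"
    have f: "filling N D ?w y" using A0(2) by (auto simp: Delta_def split: if_splits)
    have "card ({k \<in> N. ?w k = i} \<union> {k \<in> N. ?w k = Suc i}) = row_len D i + row_len D (Suc i)"
      using filling_content[OF f] N by (subst card_Un_disjoint) (auto simp: has_content_def)
    also have "{k \<in> N. ?w k = i} \<union> {k \<in> N. ?w k = Suc i} = ?Y \<union> ?Z"
      using A0(1) by (auto simp: raise_def)
    also have "card (?Y \<union> ?Z) = card ?Y + card ?Z"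
      using N by (intro card_Un_disjoint) auto
    finally have big: "card ?Y > row_len D i" using u by linarith
    have "y k < row_len D i" if k: "k \<in> ?Y" for k
    proof -
      have "(?w k, y k) \<in> D" using f k by (auto simp: filling_def bij_betw_def)
      then have "y k < row_len D (?w k)" by (simp add: diagram_iff[OF D])
      moreover have "i \<le> ?w k" using k by (auto simp: raise_def)
      ultimately show ?thesis using row_len_antimono[OF D] by (meson le_trans not_le)
    qed
    then have "y ` ?Y \<subseteq> {..<row_len D i}" by auto
    then have "\<not> inj_on y ?Y"
      using big card_inj_on_le[of y ?Y "{..<row_len D i}"] by auto
    then obtain a b where ab: "a \<in> ?Y" "b \<in> ?Y" "a \<noteq> b" "y a = y b" by (auto simp: inj_on_def)
    let ?g = "transpose a b"
    have g: "?g permutes N" using ab(1,2) by (intro permutes_swap_id) auto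
    have gY: "?g permutes ?Y" using ab(1,2) by (intro permutes_swap_id)
    have inv: "?g (?g k) = k" for k by simp
    have neg: "?t (?g ` A) = - ?t A" for A
    proof -
      have "k \<in> ?g ` A \<longleftrightarrow> ?g k \<in> A" for k by (metis image_iff inv)
      then have "raise (?g ` A) (Suc i) u = raise A (Suc i) u \<circ> ?g"
        using ab by (auto simp: raise_def transpose_def)
      moreover have "y \<circ> ?g = y" using ab by (auto simp: transpose_def)
      ultimately show ?thesis
        using Delta_comp[OF N t0 g, of "raise A (Suc i) u" y, where ?'a = 'a] ab(3)
        by (simp add: sign_swap_id)
    qed
    have gg: "?g ` ?g ` A = A" for A by (simp add: image_image)
    have gP: "?g ` A \<in> Pow ?Y" if "A \<in> Pow ?Y" for A
      using that permutes_image[OF gY] by blast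
    have "(\<Sum>A\<in>Pow ?Y. ?t A) = (\<Sum>A\<in>Pow ?Y. ?t (?g ` A))"
      by (rule sum.reindex_bij_witness[of _ "\<lambda>A. ?g ` A" "\<lambda>A. ?g ` A"]) (simp_all only: gg gP)
    also have "\<dots> = - (\<Sum>A\<in>Pow ?Y. ?t A)" by (simp only: neg sum_negf)
    finally have "(\<Sum>A\<in>Pow ?Y. ?t A) = - (\<Sum>A\<in>Pow ?Y. ?t A)" .
    then show ?thesis by (rule two[OF eq_neg_iff_add_eq_0[THEN iffD1]])
  qed
qed

definition specht_words :: "nat set \<Rightarrow> (nat \<times> nat) set \<Rightarrow> (nat \<times> nat \<Rightarrow> nat) \<Rightarrow> (word \<Rightarrow> 'a::field) set" where
  "specht_words N D t0 = fv.span (range (\<lambda>y w. Delta N D t0 w y))"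

lemma Delta_in_specht_words: "(\<lambda>w. Delta N D t0 w y) \<in> specht_words N D t0"
  unfolding specht_words_def by (rule fv.span_base) blast

lemma subspace_specht_words: "fv.subspace (specht_words N D t0)"
  unfolding specht_words_def by (rule fv.subspace_span)

lemma specht_words_reference_subset:
  assumes N: "finite N" and t0: "bij_betw t0 D N" and t1: "bij_betw t1 D N"
  shows "specht_words N D t0 \<subseteq> (specht_words N D t1 :: (word \<Rightarrow> 'a::field) set)"
proof -
  obtain s :: int where s: "\<And>w y. Delta N D t0 w y = of_int s * (Delta N D t1 w y :: 'a)"
    using Delta_change_reference[OF N t0 t1] by blast
  have "(\<lambda>w. Delta N D t0 w y) = fscale (of_int s) (\<lambda>w. Delta N D t1 w y :: 'a)" for y
    by (simp add: s fscale_def)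
  then have "(\<lambda>w. Delta N D t0 w y :: 'a) \<in> specht_words N D t1" for y
    by (simp add: Delta_in_specht_words fv.subspace_scale[OF subspace_specht_words])
  then show ?thesis
    unfolding specht_words_def[of N D t0] by (intro fv.span_minimal subspace_specht_words) blast
qed

lemma specht_words_reference:
  assumes "finite N" "bij_betw t0 D N" "bij_betw t1 D N"
  shows "specht_words N D t0 = (specht_words N D t1 :: (word \<Rightarrow> 'a::field) set)"
  using specht_words_reference_subset assms by blast


subsection \<open>Removing a label\<close>

definition slice :: "nat set \<Rightarrow> nat \<Rightarrow> nat \<Rightarrow> (word \<Rightarrow> 'a::zero) \<Rightarrow> word \<Rightarrow> 'a" where
  "slice N z i x w = (if zero_off N w then x (w(z := i)) else 0)"

lemma card_fun_upd_label:
  assumes "finite N" "z \<notin> N"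
  shows "card {k \<in> insert z N. (w(z := i)) k = j} = card {k \<in> N. w k = j} + of_bool (i = j)"
proof -
  have "{k \<in> insert z N. (w(z := i)) k = j} =
      (if i = j then insert z {k \<in> N. w k = j} else {k \<in> N. w k = j})"
    using assms(2) by auto
  then show ?thesis using assms by simp
qed

text \<open>
  The equations for \<open>x\<close> at words with \<open>z\<close> in row \<open>i\<close> have additional terms, in which \<open>z\<close> is moved to
  the next row. They vanish if \<open>i\<close> is the lowest row in which \<open>z\<close> occurs.
\<close>

lemma slice_in_kernel:
  assumes N: "finite N" "z \<notin> N" and x: "in_kernel (insert z N) r x"
    and low: "\<And>w. x w \<noteq> 0 \<Longrightarrow> w z \<le> i"
  shows "in_kernel N (r(i := r i - 1)) (slice N z i x)"
  unfolding in_kernel_def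
proof (intro conjI allI impI)
  fix w assume "slice N z i x w \<noteq> 0"
  then have w: "zero_off N w" "x (w(z := i)) \<noteq> 0" by (auto simp: slice_def split: if_splits)
  then have "has_content (insert z N) r (w(z := i))" using x unfolding in_kernel_def by blast
  then have "card {k \<in> insert z N. (w(z := i)) k = j} = r j" for j
    unfolding has_content_def by blast
  then have e: "card {k \<in> N. w k = j} + of_bool (i = j) = r j" for j
    by (simp only: card_fun_upd_label[OF N])
  have "card {k \<in> N. w k = j} = (r(i := r i - 1)) j" for j
    using e[of j] by (cases "i = j") auto
  then show "has_content N (r(i := r i - 1)) w" using w(1) by (simp add: has_content_def)
next
  fix j y assume y: "card {k \<in> N. y k = Suc j} < (r(i := r i - 1)) (Suc j)"
  show "(\<Sum>A\<in>Pow {k \<in> N. y k = j}. slice N z i x (raise A (Suc j) y)) = 0"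
  proof (cases "zero_off N y")
    case False
    then have "\<not> zero_off N (raise A (Suc j) y)" if "A \<in> Pow {k \<in> N. y k = j}" for A
      using that by (auto simp: zero_off_def raise_def)
    then show ?thesis by (intro sum.neutral) (simp add: slice_def)
  next
    case True
    let ?y = "y(z := i)"
    have "card {k \<in> insert z N. ?y k = Suc j} < r (Suc j)"
      using y unfolding card_fun_upd_label[OF N] by (auto split: if_splits)
    then have 0: "(\<Sum>A\<in>Pow {k \<in> insert z N. ?y k = j}. x (raise A (Suc j) ?y)) = 0"
      using x by (simp only: in_kernel_def)
    have "(\<Sum>A\<in>Pow {k \<in> N. y k = j}. slice N z i x (raise A (Suc j) y)) =
        (\<Sum>A\<in>Pow {k \<in> N. y k = j}. x (raise A (Suc j) ?y))"
    proof (intro sum.cong refl)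
      fix A assume A: "A \<in> Pow {k \<in> N. y k = j}"
      then have "zero_off N (raise A (Suc j) y)" using True by (auto simp: zero_off_def raise_def)
      moreover have "(raise A (Suc j) y)(z := i) = raise A (Suc j) ?y"
        using A N(2) by (auto simp: raise_def fun_eq_iff)
      ultimately show "slice N z i x (raise A (Suc j) y) = x (raise A (Suc j) ?y)"
        by (simp add: slice_def)
    qed
    also have "\<dots> = (\<Sum>A\<in>Pow {k \<in> insert z N. ?y k = j}. x (raise A (Suc j) ?y))"
    proof (rule sum.mono_neutral_left)
      show "Pow {k \<in> N. y k = j} \<subseteq> Pow {k \<in> insert z N. ?y k = j}" using N(2) by auto
      show "\<forall>A\<in>Pow {k \<in> insert z N. ?y k = j} - Pow {k \<in> N. y k = j}. x (raise A (Suc j) ?y) = 0"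
      proof
        fix A assume A: "A \<in> Pow {k \<in> insert z N. ?y k = j} - Pow {k \<in> N. y k = j}"
        then have z: "z \<in> A" by (auto split: if_splits)
        then have "i = j" using A by auto
        then show "x (raise A (Suc j) ?y) = 0" using low[of "raise A (Suc j) ?y"] z by (auto simp: raise_def)
      qed
    qed (use N(1) in auto)
    finally show ?thesis using 0 by simp
  qed
qed

text \<open>
  The last box of row \<open>i\<close> can be removed if row \<open>i\<close> is longer than the next one. Putting the label
  \<open>z\<close> into that box extends the fillings of the smaller diagram; no filling with this column
  word has \<open>z\<close> further down.
\<close>

context
  fixes D :: "(nat \<times> nat) set" and i c :: nat and b
  assumes D: "is_diagram D" and corner: "row_len D (Suc i) < row_len D i"
  defines "c \<equiv> row_len D i - 1" and "b \<equiv> (i, c)"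
begin

lemma corner_in: "b \<in> D"
  using corner by (simp add: b_def c_def diagram_iff[OF D])

lemma row_len_remove_corner: "row_len (D - {b}) = (row_len D)(i := row_len D i - 1)"
proof
  fix j
  have "{j'. (j, j') \<in> D} = {..<row_len D j}" by (auto simp: diagram_iff[OF D])
  moreover have "{j'. (j, j') \<in> D - {b}} = {j'. (j, j') \<in> D} - (if j = i then {c} else {})"
    by (auto simp: b_def)
  ultimately show "row_len (D - {b}) j = ((row_len D)(i := row_len D i - 1)) j"
    unfolding row_len_def[of "D - {b}"] using corner by (auto simp: c_def)
qed

lemma is_diagram_remove_corner: "is_diagram (D - {b})"
  unfolding is_diagram_def
proof (intro conjI allI impI)
  show "finite (D - {b})" using D by (simp add: is_diagram_def)
  fix j k j' k' assume jk: "(j, k) \<in> D - {b}" and le: "j' \<le> j" "k' \<le> k"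
  have "(j', k') \<in> D" using D jk le unfolding is_diagram_def by blast
  moreover have "(j', k') \<noteq> b"
  proof
    assume "(j', k') = b"
    then have e: "j' = i" "k' = c" by (auto simp: b_def)
    have k: "c \<le> k" "k < row_len D j" using jk le e by (auto simp: diagram_iff[OF D])
    show False
    proof (cases "j = i")
      case True
      then show ?thesis using k jk by (auto simp: c_def b_def)
    next
      case False
      then have "row_len D j \<le> row_len D (Suc i)" using le e by (intro row_len_antimono[OF D]) auto
      then show ?thesis using k corner by (auto simp: c_def)
    qed
  qed
  ultimately show "(j', k') \<in> D - {b}" by simp
qed

lemma filling_corner_row: "filling N D w y \<Longrightarrow> z \<in> N \<Longrightarrow> y z = c \<Longrightarrow> w z \<le> i"
proof (rule ccontr)
  assume f: "filling N D w y" "z \<in> N" "y z = c" and "\<not> w z \<le> i"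
  then have "row_len D (w z) \<le> row_len D (Suc i)" by (intro row_len_antimono[OF D]) auto
  moreover have "(w z, c) \<in> D" using f by (auto simp: filling_def bij_betw_def)
  ultimately show False using corner by (auto simp: diagram_iff[OF D] c_def)
qed

lemma filling_extend:
  assumes z: "z \<notin> N" and w: "zero_off N w" and y: "zero_off N y"
  shows "filling (insert z N) D (w(z := i)) (y(z := c)) \<longleftrightarrow> filling N (D - {b}) w y"
proof -
  let ?p = "\<lambda>k. ((w(z := i)) k, (y(z := c)) k)"
  have "bij_betw ?p (insert z N) (insert b (D - {b})) \<longleftrightarrow> bij_betw ?p N (D - {b})"
    using notIn_Un_bij_betw3[of z N ?p "D - {b}"] z by (simp add: b_def)
  moreover have "insert b (D - {b}) = D" using corner_in by blast
  moreover have "bij_betw ?p N (D - {b}) \<longleftrightarrow> bij_betw (\<lambda>k. (w k, y k)) N (D - {b})"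
    using z by (intro bij_betw_cong) auto
  ultimately show ?thesis using w y by (auto simp: filling_def zero_off_def)
qed

lemma Delta_extend:
  assumes z: "z \<notin> N" and w: "zero_off N w" and y: "zero_off N y"
    and t: "\<And>d. d \<in> D - {b} \<Longrightarrow> t1 d = t0 d" "t1 b = z"
  shows "Delta (insert z N) D t1 (w(z := i)) (y(z := c)) = Delta N (D - {b}) t0 w y"
proof (cases "filling N (D - {b}) w y")
  case True
  have "(w k, y k) \<in> D - {b}" if "k \<in> N" for k
    using True that by (auto simp: filling_def bij_betw_def)
  then have "(\<lambda>k. if k \<in> insert z N then t1 ((w(z := i)) k, (y(z := c)) k) else k) =
      (\<lambda>k. if k \<in> N then t0 (w k, y k) else k)"
    using t z by (auto simp: fun_eq_iff b_def)
  then show ?thesis unfolding Delta_def filling_extend[OF z w y] by (simp only:)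
next
  case False
  then show ?thesis unfolding Delta_def filling_extend[OF z w y] by simp
qed

end

text \<open>
  The inner induction moves \<open>z\<close> upwards. If row \<open>i\<close> is the lowest one in which \<open>z\<close> occurs, the slice
  there is a combination of fillings of the diagram without the last box of that row; the extended
  fillings give an element \<open>F\<close> with the same slice, and in \<open>x - F\<close> the label \<open>z\<close> occurs above row \<open>i\<close>
  only.
\<close>

theorem kernel_subset_specht_words:
  assumes two: "(2::'a::field) \<noteq> 0" and N: "finite N" and D: "is_diagram D" and t0: "bij_betw t0 D N"
    and x: "in_kernel N (row_len D) x"
  shows "x \<in> (specht_words N D t0 :: (word \<Rightarrow> 'a) set)"
  using N D t0 x
proof (induction N arbitrary: D t0 x rule: finite_induct)
  case empty
  have D: "D = {}" using empty.prems(2) by (auto simp: bij_betw_def)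
  have fill: "filling {} D w y \<longleftrightarrow> w = (\<lambda>_. 0) \<and> y = (\<lambda>_. 0)" for w y
    by (auto simp: filling_def zero_off_def bij_betw_def D)
  have "x = fscale (x (\<lambda>_. 0)) (\<lambda>w. Delta {} D t0 w (\<lambda>_. 0))"
  proof
    fix w
    have "x w = 0" if "w \<noteq> (\<lambda>_. 0)"
      using that empty.prems(3) by (auto simp: in_kernel_def has_content_def zero_off_def fun_eq_iff)
    moreover have "sign (\<lambda>k::nat. k) = 1" using sign_id by (simp add: id_def)
    ultimately show "x w = fscale (x (\<lambda>_. 0)) (\<lambda>w. Delta {} D t0 w (\<lambda>_. 0)) w"
      by (auto simp: fscale_def Delta_def fill)
  qed
  then show ?case
    by (metis Delta_in_specht_words fv.subspace_scale subspace_specht_words)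
next
  case (insert z N)
  note D = insert.prems(1) and t0 = insert.prems(2)
  have fzN: "finite (insert z N)" using insert.hyps by simp
  have two': "a = 0" if "a + a = 0" for a :: 'a using that two by (metis mult_2 mult_eq_0_iff)
  have "x \<in> specht_words (insert z N) D t0"
    if "in_kernel (insert z N) (row_len D) x" "\<And>w. x w \<noteq> 0 \<Longrightarrow> w z < m" for m
      and x :: "word \<Rightarrow> 'a"
    using that
  proof (induction m arbitrary: x)
    case 0
    then have "x = 0" by (auto simp: fun_eq_iff)
    then show ?case using fv.subspace_0[OF subspace_specht_words] by (simp only:)
  next
    case (Suc i)
    have low: "w z \<le> i" if "x w \<noteq> 0" for w using Suc.prems(2)[OF that] by simp
    let ?s = "slice N z i x"
    have sK: "in_kernel N ((row_len D)(i := row_len D i - 1)) ?s"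
      by (rule slice_in_kernel[OF insert.hyps(1,2) Suc.prems(1)]) (rule low)
    have x_slice: "x w = ?s (w(z := 0))" if "zero_off (insert z N) w" "w z = i" for w
    proof -
      have "zero_off N (w(z := 0))" "(w(z := 0))(z := i) = w" using that by (auto simp: zero_off_def)
      then show ?thesis by (simp add: slice_def del: fun_upd_upd)
    qed
    have x_supp: "zero_off (insert z N) w" if "x w \<noteq> 0" for w
      using that Suc.prems(1) by (auto simp: in_kernel_def has_content_def)
    show ?case
    proof (cases "\<forall>w. ?s w = 0")
      case True
      then have "w z < i" if "x w \<noteq> 0" for w
        using low[OF that] x_slice[OF x_supp[OF that]] that by (cases "w z = i") auto
      then show ?thesis using Suc.IH[OF Suc.prems(1)] by blast
    next
      case False
      then obtain w where w: "?s w \<noteq> 0" by blast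
      then have "x (w(z := i)) \<noteq> 0" by (auto simp: slice_def split: if_splits)
      then have "has_content (insert z N) (row_len D) (w(z := i))"
        using Suc.prems(1) unfolding in_kernel_def by blast
      then have "card {k \<in> insert z N. (w(z := i)) k = i} = row_len D i"
        unfolding has_content_def by blast
      then have pos: "row_len D i > 0"
        using card_fun_upd_label[OF insert.hyps(1,2), of w i i] by simp
      have "\<not> ((row_len D)(i := row_len D i - 1)) i < ((row_len D)(i := row_len D i - 1)) (Suc i)"
        using kernel_trivial_if_increasing[OF insert.hyps(1) sK, of i w] w by auto
      then have corner: "row_len D (Suc i) < row_len D i" using pos by simp
      define c where "c = row_len D i - 1"
      define b where "b = (i, c)"
      note fold = c_def[symmetric] b_def[symmetric]
      have bD: "b \<in> D" using corner_in[OF D corner] unfolding fold .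
      have D': "is_diagram (D - {b})" using is_diagram_remove_corner[OF D corner] unfolding fold .
      have rD': "row_len (D - {b}) = (row_len D)(i := row_len D i - 1)"
        using row_len_remove_corner[OF D corner] unfolding fold .
      have fD: "finite D" using D by (simp add: is_diagram_def)
      have "card D = Suc (card N)" using bij_betw_same_card[OF t0] insert.hyps by simp
      then have "card (D - {b}) = card N" using bD fD by simp
      then obtain t' where t': "bij_betw t' (D - {b}) N"
        using finite_same_card_bij fD insert.hyps(1) by blast
      define t1 where "t1 d = (if d = b then z else t' d)" for d
      have t1': "bij_betw t1 (D - {b}) N" using t' by (rule iffD1[OF bij_betw_cong, rotated]) (simp add: t1_def)
      have t1: "bij_betw t1 D (insert z N)"
        using notIn_Un_bij_betw[of b "D - {b}" t1 N] t1' insert.hyps(2) bD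
        by (simp add: t1_def insert_absorb)
      have sS: "?s \<in> specht_words N (D - {b}) t'"
        by (rule insert.IH[OF D' t']) (use sK in \<open>simp only: rD'\<close>)
      have "\<exists>F\<in>specht_words (insert z N) D t1. in_kernel (insert z N) (row_len D) F \<and>
          (\<forall>w. F w \<noteq> 0 \<longrightarrow> w z \<le> i) \<and> (\<forall>w. zero_off N w \<longrightarrow> F (w(z := i)) = f w)"
        if "f \<in> specht_words N (D - {b}) t'" for f :: "word \<Rightarrow> 'a"
        using that unfolding specht_words_def[of N]
      proof (induction f rule: fv.span_induct_alt)
        case base
        then show ?case
          by (intro bexI[of _ 0]) (auto simp: in_kernel_def fv.subspace_0[OF subspace_specht_words])
      next
        case (step a f g)
        then obtain F where F: "F \<in> specht_words (insert z N) D t1" "in_kernel (insert z N) (row_len D) F"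
          "\<And>w. F w \<noteq> 0 \<Longrightarrow> w z \<le> i" "\<And>w. zero_off N w \<Longrightarrow> F (w(z := i)) = g w" by blast
        obtain y where f: "f = (\<lambda>w. Delta N (D - {b}) t' w y)" using step.hyps(1) by blast
        show ?case
        proof (cases "zero_off N y")
          case False
          then have "fscale a f + g = g" by (simp add: f Delta_def filling_def fscale_def fun_eq_iff)
          then show ?thesis unfolding \<open>fscale a f + g = g\<close> using F by blast
        next
          case True
          let ?d = "\<lambda>w. Delta (insert z N) D t1 w (y(z := c)) :: 'a"
          have "?d w \<noteq> 0 \<Longrightarrow> w z \<le> i" for w
            using filling_corner_row[OF D corner, unfolded fold, of "insert z N" w "y(z := c)" z]
            unfolding Delta_def by (metis fun_upd_same insertI1)
          then have "w z \<le> i" if "(fscale a ?d + F) w \<noteq> 0" for w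
            using that F(3) by (cases "?d w = 0") (auto simp: fscale_def)
          moreover have "(fscale a ?d + F) (w(z := i)) = (fscale a f + g) w" if w: "zero_off N w" for w
          proof -
            have "?d (w(z := i)) = f w"
              unfolding f using Delta_extend[OF D corner, unfolded fold, OF insert.hyps(2) w True, of t1 t']
              by (simp add: t1_def)
            then show ?thesis using F(4)[OF w] by (simp only: fscale_def plus_fun_apply)
          qed
          moreover have "in_kernel (insert z N) (row_len D) (fscale a ?d + F)"
            unfolding fscale_def plus_fun_def
            by (intro in_kernel_add in_kernel_scale Delta_in_kernel[OF two' D fzN t1] F(2))
          moreover have "fscale a ?d + F \<in> specht_words (insert z N) D t1"
            by (intro fv.subspace_add fv.subspace_scale subspace_specht_words Delta_in_specht_words F(1))
          ultimately show ?thesis by blast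
        qed
      qed
      from this[OF sS] obtain F where F:
        "F \<in> specht_words (insert z N) D t1" "in_kernel (insert z N) (row_len D) F"
        "\<And>w. F w \<noteq> 0 \<Longrightarrow> w z \<le> i" "\<And>w. zero_off N w \<Longrightarrow> F (w(z := i)) = ?s w" by blast
      let ?x = "\<lambda>w. x w - F w"
      have "w z < i" if nz: "?x w \<noteq> 0" for w
      proof -
        have "x w \<noteq> 0 \<or> F w \<noteq> 0" using nz by auto
        then have wz: "w z \<le> i" "zero_off (insert z N) w"
          using low F(3) x_supp F(2) by (auto simp: in_kernel_def has_content_def)
        moreover have "w z \<noteq> i"
        proof
          assume wi: "w z = i"
          have "F ((w(z := 0))(z := i)) = ?s (w(z := 0))"
            using wz(2) by (intro F(4)) (auto simp: zero_off_def)
          moreover have "(w(z := 0))(z := i) = w" using wi by auto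
          ultimately show False using nz x_slice[OF wz(2) wi] by simp
        qed
        ultimately show ?thesis by simp
      qed
      then have "?x \<in> specht_words (insert z N) D t0"
        using Suc.IH[OF in_kernel_diff[OF Suc.prems(1) F(2)]] by blast
      moreover have "F \<in> specht_words (insert z N) D t0"
        unfolding specht_words_reference[OF fzN t0 t1] by (rule F(1))
      ultimately have "?x + F \<in> specht_words (insert z N) D t0"
        by (intro fv.subspace_add subspace_specht_words)
      moreover have "?x + F = x" by (simp add: fun_eq_iff)
      ultimately show ?thesis by simp
    qed
  qed
  moreover have "w z < (\<Sum>i\<in>fst ` D. Suc i)" if "x w \<noteq> 0" for w
  proof -
    have "card {k \<in> insert z N. w k = w z} = row_len D (w z)"
      using that insert.prems(3) by (simp add: in_kernel_def has_content_def)
    moreover have "card {k \<in> insert z N. w k = w z} \<noteq> 0" using insert.hyps(1) by auto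
    ultimately have "(w z, 0) \<in> D" by (simp add: diagram_iff[OF D])
    then have "w z \<in> fst ` D" by force
    moreover have "finite (fst ` D)" using D by (simp add: is_diagram_def)
    ultimately have "Suc (w z) \<le> (\<Sum>i\<in>fst ` D. Suc i)" by (intro member_le_sum) auto
    then show ?thesis by simp
  qed
  ultimately show ?case using insert.prems(3) by blast
qed


subsection \<open>A vector fixed by the row stabiliser\<close>

theorem exists_symmetric_vector:
  assumes two: "(2::'a::field) \<noteq> 0" and N: "finite N" and D: "is_diagram D" and t0: "bij_betw t0 D N"
    and f0: "filling N D w0 y0"
  obtains v where "v \<in> (specht_words N D t0 :: (word \<Rightarrow> 'a) set)" "v \<noteq> 0"
    "\<And>g w. g permutes N \<Longrightarrow> w0 \<circ> g = w0 \<Longrightarrow> v (w \<circ> g) = v w"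
proof -
  define R where "R = {g. g permutes N \<and> w0 \<circ> g = w0}"
  have fR: "finite R" unfolding R_def by (rule finite_subset[OF _ finite_permutations[OF N]]) auto
  \<comment> \<open>Over the integers the symmetrised vector is nonzero, since all its terms at \<open>w0\<close> agree.\<close>
  define X :: "word \<Rightarrow> int" where "X w = (\<Sum>g\<in>R. Delta N D t0 (w \<circ> g) y0)" for w
  have "in_kernel N (row_len D) (\<lambda>w. Delta N D t0 (w \<circ> g) y0 :: int)" if g: "g \<in> R" for g
  proof -
    have p: "g permutes N" using g R_def by blast
    have "y0 \<circ> inv' g \<circ> g = y0" using permutes_inv_o(2)[OF p] by (simp add: comp_assoc)
    then have "Delta N D t0 (w \<circ> g) y0 = of_int (sign g) * (Delta N D t0 w (y0 \<circ> inv' g) :: int)" for w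
      using Delta_comp[OF N t0 p, of w "y0 \<circ> inv' g", where ?'a = int] by (simp only:)
    moreover have "a = 0" if "a + a = 0" for a :: int using that by simp
    ultimately show ?thesis
      using in_kernel_scale[OF Delta_in_kernel[OF _ D N t0, where ?'a = int]] by simp
  qed
  then have XK: "in_kernel N (row_len D) X" unfolding X_def by (rule in_kernel_sum)
  have Xsym: "X (w \<circ> h) = X w" if h: "h \<in> R" for h w
  proof -
    have p: "h permutes N" "w0 \<circ> h = w0" using h R_def by auto
    have ih: "inv' h permutes N" "w0 \<circ> inv' h = w0"
      using permutes_inv[OF p(1)] permutes_inv_o(1)[OF p(1)] p(2) by (auto simp: comp_assoc) (metis comp_assoc comp_id)
    have e: "inv' h \<circ> (h \<circ> g) = g" "h \<circ> (inv' h \<circ> g) = g" for g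
      using permutes_inv_o[OF p(1)] by (auto simp flip: comp_assoc)
    show ?thesis
      unfolding X_def
    proof (rule sum.reindex_bij_witness[of _ "\<lambda>g. inv' h \<circ> g" "\<lambda>g. h \<circ> g"])
      show "h \<circ> g \<in> R" if "g \<in> R" for g
        using that p by (auto simp: R_def permutes_compose simp flip: comp_assoc)
      show "inv' h \<circ> g \<in> R" if "g \<in> R" for g
        using that ih by (auto simp: R_def permutes_compose simp flip: comp_assoc)
    qed (auto simp: e comp_assoc)
  qed
  have "X w0 = (\<Sum>g\<in>R. Delta N D t0 w0 y0)" unfolding X_def by (intro sum.cong) (auto simp: R_def)
  moreover have "card R \<noteq> 0" using fR permutes_id[of N] by (auto simp: R_def intro!: exI[of _ id])
  moreover have "(Delta N D t0 w0 y0 :: int) \<noteq> 0" using Delta_square[OF f0, of t0, where ?'a = int] by auto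
  ultimately have X0: "X w0 \<noteq> 0" by simp
  define d where "d = Gcd (range X)"
  have d0: "d \<noteq> 0" using X0 unfolding d_def by (metis Gcd_dvd dvd_0_left rangeI)
  have "d dvd X w" for w unfolding d_def by (rule Gcd_dvd) simp
  then obtain Y where Y: "\<And>w. X w = d * Y w" unfolding dvd_def by metis
  have YK: "in_kernel N (row_len D) Y"
    using XK d0 unfolding in_kernel_def by (simp add: Y flip: sum_distrib_left)
  define v :: "word \<Rightarrow> 'a" where "v w = of_int (Y w)" for w
  have "v \<noteq> 0"
  proof
    assume "v = 0"
    then have "of_int (Y w) = (0::'a)" for w by (metis v_def zero_fun_apply)
    then have "int CHAR('a) dvd Y w" for w by (simp add: of_int_eq_0_iff_char_dvd)
    then have "d * int CHAR('a) dvd X w" for w unfolding Y by (intro mult_dvd_mono) simp_all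
    then have "d * int CHAR('a) dvd Gcd (range X)" by (intro Gcd_greatest) auto
    then have "d * int CHAR('a) dvd d" by (simp only: d_def)
    then have "int CHAR('a) dvd 1" using d0 by (metis dvd_times_left_cancel_iff mult.right_neutral)
    then show False using CHAR_not_1 by simp
  qed
  moreover have "in_kernel N (row_len D) v"
    unfolding in_kernel_def
  proof (intro conjI allI impI)
    fix w assume "v w \<noteq> 0"
    then have "Y w \<noteq> 0" by (auto simp: v_def)
    then show "has_content N (row_len D) w" using YK by (auto simp: v_def in_kernel_def)
  next
    fix i y assume "card {k \<in> N. y k = Suc i} < row_len D (Suc i)"
    then have "(\<Sum>A\<in>Pow {k \<in> N. y k = i}. Y (raise A (Suc i) y)) = 0" using YK by (simp add: in_kernel_def)
    then show "(\<Sum>A\<in>Pow {k \<in> N. y k = i}. v (raise A (Suc i) y)) = 0"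
      unfolding v_def by (simp flip: of_int_sum)
  qed
  then have "v \<in> specht_words N D t0" by (rule kernel_subset_specht_words[OF two N D t0])
  moreover have "v (w \<circ> g) = v w" if "g permutes N" "w0 \<circ> g = w0" for g w
    using Xsym[of g w] that d0 by (simp add: R_def v_def Y)
  ultimately show ?thesis using that by blast
qed


section \<open>Permutations are conjugate to their inverses\<close>

text \<open>
  Choose a representative \<open>r\<close> in every cycle of \<open>g\<close> and reflect the cycle by \<open>g^k r \<mapsto> g^(-k) r\<close>.
  With \<open>g^m = id\<close> and \<open>i = m - 1\<close>, the exponent \<open>k * i\<close> stands for \<open>-k\<close>.
\<close>

lemma permutes_conjugate_inverse:
  assumes N: "finite N" and g: "g permutes N"
  obtains h where "h permutes N" "h \<circ> g = inv' g \<circ> h"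
proof -
  obtain i where i: "g ^^ Suc i = id"
    using permutation_is_nilpotent[OF permutation_if_permutes[OF N g]] by (metis gr0_implies_Suc)
  have add: "(g ^^ (a + b)) x = (g ^^ a) ((g ^^ b) x)" for a b x by (simp add: funpow_add)
  have inj_pow: "inj (g ^^ a)" for a using permutes_inj[OF permutes_funpow[OF g]] .
  have cancel: "(g ^^ (a + a * i)) x = x" for a x
  proof -
    have "g ^^ (Suc i * a) = id" unfolding funpow_mult[symmetric] i by simp
    then show ?thesis by (simp add: mult.commute)
  qed
  have scale: "(g ^^ (a * j)) x = (g ^^ (b * j)) x" if ab: "(g ^^ a) x = (g ^^ b) x" for a b j x
  proof (induction j)
    case (Suc j)
    have "(g ^^ (a * Suc j)) x = (g ^^ (a * j)) ((g ^^ b) x)" using ab by (simp add: add.commute[of a] add)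
    also have "\<dots> = (g ^^ b) ((g ^^ (a * j)) x)" by (simp flip: add add: add.commute)
    also have "\<dots> = (g ^^ (b * Suc j)) x" by (simp add: Suc.IH add)
    finally show ?case .
  qed simp
  define rel where "rel x y \<longleftrightarrow> (\<exists>k. (g ^^ k) y = x)" for x y
  have rel_trans: "rel x z" if "rel x y" "rel y z" for x y z using that unfolding rel_def by (metis add)
  have rel_sym: "rel y x" if xy: "rel x y" for x y
  proof -
    obtain k where "x = (g ^^ k) y" using xy unfolding rel_def by auto
    then have "(g ^^ (k * i)) x = y" using cancel[of k y] by (simp add: add add.commute flip: add)
    then show ?thesis unfolding rel_def by blast
  qed
  define r where "r x = (SOME y. rel x y)" for x
  have "rel x x" for x unfolding rel_def by (intro exI[of _ 0]) simp
  then have r: "rel x (r x)" for x unfolding r_def by (rule someI)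
  have r_eq: "r x = r y" if "rel x y" for x y
  proof -
    have "rel x = rel y" using that rel_trans rel_sym by blast
    then show ?thesis by (simp add: r_def)
  qed
  have "\<forall>x. \<exists>k. (g ^^ k) (r x) = x" using r unfolding rel_def by blast
  then obtain k where k: "\<And>x. (g ^^ k x) (r x) = x" by metis
  define h where "h x = (g ^^ (k x * i)) (r x)" for x
  have gh: "h (g x) = (g ^^ i) (h x)" for x
  proof -
    have "rel (g x) x" unfolding rel_def by (intro exI[of _ 1]) simp
    then have rg: "r (g x) = r x" by (rule r_eq)
    have "(g ^^ k (g x)) (r x) = (g ^^ Suc (k x)) (r x)" using k[of "g x"] k[of x] rg by simp
    then have "(g ^^ (k (g x) * i)) (r x) = (g ^^ (Suc (k x) * i)) (r x)" by (rule scale)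
    then show ?thesis by (simp add: h_def rg add)
  qed
  have refl_back: "(g ^^ k x) (h x) = r x" for x
    unfolding h_def using cancel[of "k x" "r x"] by (simp add: add)
  have injh: "inj h"
  proof (rule injI)
    fix x y assume xy: "h x = h y"
    have "rel (h x) (r x)" "rel (h y) (r y)" unfolding rel_def h_def by blast+
    then have "r (r x) = r (r y)" using r_eq xy by metis
    then have rr: "r x = r y" using r_eq[OF r] by metis
    have "(g ^^ k x) (h x) = (g ^^ k y) (h x)" using refl_back[of x] refl_back[of y] xy rr by simp
    then have "(g ^^ (k x * 2)) (h x) = (g ^^ (k y * 2)) (h x)" by (rule scale)
    then have "(g ^^ k x) (r x) = (g ^^ k y) (r y)"
      using refl_back[of x] refl_back[of y] xy by (simp add: mult_2_right add)
    then show "x = y" by (simp add: k)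
  qed
  have hN: "h x \<in> N" if x: "x \<in> N" for x
  proof -
    have "r x \<in> N" using k[of x] permutes_in_image[OF permutes_funpow[OF g, of "k x"], of "r x"] x by simp
    then show ?thesis unfolding h_def using permutes_in_image[OF permutes_funpow[OF g]] by blast
  qed
  have "h permutes N"
  proof (rule bij_imp_permutes)
    show "bij_betw h N N"
      using inj_on_subset[OF injh subset_UNIV] hN N by (simp add: bij_betw_def endo_inj_surj image_subset_iff)
    fix x assume x: "x \<notin> N"
    have gx: "(g ^^ a) x = x" for a using permutes_not_in[OF permutes_funpow[OF g] x] .
    then have "(g ^^ k x) (r x) = (g ^^ k x) x" using k[of x] gx by simp
    then have "r x = x" using inj_pow[of "k x"] by (simp add: inj_eq)
    then show "h x = x" by (simp add: h_def gx)
  qed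
  moreover have "h \<circ> g = inv' g \<circ> h"
  proof
    fix x
    have "g ((g ^^ i) (h x)) = h x" using fun_cong[OF i, of "h x"] by simp
    then have "inv' g (h x) = (g ^^ i) (h x)" using permutes_inv_eq[OF g] by simp
    then show "(h \<circ> g) x = (inv' g \<circ> h) x" by (simp add: gh)
  qed
  ultimately show ?thesis by (rule that)
qed


section \<open>The Specht space as a module\<close>

definition wact :: "(nat \<Rightarrow> nat) \<Rightarrow> (word \<Rightarrow> 'a) \<Rightarrow> word \<Rightarrow> 'a" where
  "wact g x = (\<lambda>w. x (w \<circ> g))"

lemma wact_comp: "wact (g \<circ> h) x = wact g (wact h x)"
  by (simp add: wact_def comp_assoc)

lemma wact_id: "wact id x = x"
  by (simp add: wact_def)

lemma wact_add: "wact g (x + y) = wact g x + wact g y"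
  by (simp add: wact_def plus_fun_def)

lemma wact_diff: "wact g (x - y) = wact g x - wact g y"
  by (simp add: wact_def fun_diff_def)

lemma wact_scale: "wact g (fscale c x) = fscale c (wact g x)"
  by (simp add: wact_def fscale_def)

lemma lin_on_wact: "lin_on fscale fscale W (wact g)"
  by (simp add: lin_on_def wact_add wact_scale)

lemma fscale_fscale: "fscale a (fscale b x) = fscale (a * b) x"
  by simp

lemma wact_inverse:
  assumes "g permutes N"
  shows "wact (inv' g) (wact g x) = x" "wact g (wact (inv' g) x) = x"
  unfolding wact_comp[symmetric] permutes_inv_o[OF assms] by (rule wact_id)+

lemma expand_finite_support:
  fixes x :: "'b \<Rightarrow> 'a::field"
  assumes "finite E" "\<And>w. x w \<noteq> 0 \<Longrightarrow> w \<in> E"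
  shows "x = (\<Sum>w\<in>E. fscale (x w) (\<lambda>u. of_bool (u = w)))"
proof
  fix u
  have "(\<Sum>w\<in>E. fscale (x w) (\<lambda>u. of_bool (u = w))) u = (\<Sum>w\<in>E. if u = w then x u else 0)"
    using assms(1) by (induction E rule: finite_induct) (auto simp: fscale_def)
  then show "x u = (\<Sum>w\<in>E. fscale (x w) (\<lambda>u. of_bool (u = w))) u" using assms by auto
qed

text \<open>
  Extend \<open>h\<close> to a linear functional on all functions; \<open>c w\<close> is its value at the unit vector of \<open>w\<close>.
\<close>

lemma functional_is_evaluation:
  fixes W :: "('b \<Rightarrow> 'a::field) set"
  assumes E: "finite E" "\<And>x w. x \<in> W \<Longrightarrow> x w \<noteq> 0 \<Longrightarrow> w \<in> E"
    and W: "fv.subspace W" and h: "lin_on fscale (*) W h"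
  obtains c where "\<And>x. x \<in> W \<Longrightarrow> h x = (\<Sum>w\<in>E. c w * x w)"
proof -
  interpret F: vector_space "(*) :: 'a \<Rightarrow> 'a \<Rightarrow> 'a"
    by unfold_locales (auto simp: algebra_simps)
  interpret p: vector_space_pair "fscale :: 'a \<Rightarrow> ('b \<Rightarrow> 'a) \<Rightarrow> 'b \<Rightarrow> 'a" "(*) :: 'a \<Rightarrow> 'a \<Rightarrow> 'a"
    by unfold_locales
  obtain B where B: "B \<subseteq> W" "fv.independent B" "W \<subseteq> fv.span B" "card B = fv.dim W"
    by (rule fv.basis_exists)
  define H where "H = p.construct B h"
  have H: "Vector_Spaces.linear fscale (*) H" unfolding H_def by (rule p.linear_construct[OF B(2)])
  have HW: "H x = h x" if "x \<in> W" for x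
  proof -
    have "x \<in> fv.span B" using that B(3) by blast
    then have "x \<in> W \<and> H x = h x"
    proof (induction rule: fv.span_induct_alt)
      case base
      then show ?case
        using fv.subspace_0[OF W] fv.lin_on_zero[OF h W] p.linear_0[OF H] by (simp only: simp_thms)
    next
      case (step c b y)
      have b: "b \<in> W" "fscale c b \<in> W" using step.hyps B(1) fv.subspace_scale[OF W] by auto
      have "H b = h b" unfolding H_def by (rule p.construct_basis[OF B(2) step.hyps])
      then have "H (fscale c b + y) = h (fscale c b + y)"
        using step.IH b by (simp only: p.linear_add[OF H] p.linear_scale[OF H] lin_on_add[OF h] lin_on_scale[OF h])
      then show ?case using step.IH b fv.subspace_add[OF W] by blast
    qed
    then show ?thesis by simp
  qed
  define e where "e w = (\<lambda>u. of_bool (u = w) :: 'a)" for w :: 'b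
  have "h x = (\<Sum>w\<in>E. H (e w) * x w)" if x: "x \<in> W" for x
  proof -
    have "x = (\<Sum>w\<in>E. fscale (x w) (e w))"
      unfolding e_def by (rule expand_finite_support[OF E(1)]) (rule E(2)[OF x])
    then have "H x = H (\<Sum>w\<in>E. fscale (x w) (e w))" by (rule arg_cong)
    then show ?thesis using HW[OF x] by (simp add: p.linear_sum[OF H] p.linear_scale[OF H] mult.commute)
  qed
  then show ?thesis by (rule that)
qed

locale specht_setting =
  fixes n :: nat and D :: "(nat \<times> nat) set" and t0 :: "nat \<times> nat \<Rightarrow> nat"
    and ty :: "'a::alg_closed_field itself"
  assumes two: "(2::'a) \<noteq> 0" and D: "is_diagram D" and t0: "bij_betw t0 D {1..n}"
begin

abbreviation "N \<equiv> {1..n}"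
abbreviation "S \<equiv> specht_words N D t0 :: (word \<Rightarrow> 'a) set"
abbreviation Dl :: "word \<Rightarrow> word \<Rightarrow> 'a" where "Dl y \<equiv> \<lambda>w. Delta N D t0 w y"

text \<open>The same space for the transposed diagram, spanned by the functions of the column word.\<close>

abbreviation "S' \<equiv> specht_words N (D\<inverse>) (t0 \<circ> prod.swap) :: (word \<Rightarrow> 'a) set"

lemma finite_N: "finite N" by simp

lemma S_induct [consumes 1, case_names zero step]:
  assumes "x \<in> S" "P 0" "\<And>c y x. x \<in> S \<Longrightarrow> P x \<Longrightarrow> P (fscale c (Dl y) + x)"
  shows "P x"
proof -
  have "x \<in> S \<and> P x" using assms(1) unfolding specht_words_def
  proof (induction rule: fv.span_induct_alt)
    case base
    then show ?case using assms(2) fv.span_zero by blast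
  next
    case (step c b x)
    then have "P (fscale c b + x)" using assms(3)[unfolded specht_words_def, of x c] by blast
    moreover have "fscale c b + x \<in> fv.span (range (\<lambda>y. Dl y))"
      using step by (intro fv.span_add fv.span_scale) (auto intro: fv.span_base)
    ultimately show ?case by blast
  qed
  then show ?thesis by simp
qed

lemma Dl_in_S: "Dl y \<in> S"
  by (rule Delta_in_specht_words)

lemma row_in_S': "(\<lambda>y. Delta N D t0 w y) \<in> S'"
  using Delta_in_specht_words[of N "D\<inverse>" "t0 \<circ> prod.swap" w] by (simp only: Delta_converse)

lemma subspace_S: "fv.subspace S"
  by (rule subspace_specht_words)

lemma Dl_comp:
  assumes g: "g permutes N"
  shows "Dl (y \<circ> g) = fscale (of_int (sign g)) (wact (inv' g) (Dl y))"
proof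
  fix w :: word
  have "w = w \<circ> inv' g \<circ> g" using permutes_inv_o(2)[OF g] by (simp add: comp_assoc)
  then show "Dl (y \<circ> g) w = fscale (of_int (sign g)) (wact (inv' g) (Dl y)) w"
    using Delta_comp[OF finite_N t0 g, of "w \<circ> inv' g" y, where ?'a = 'a] by (simp add: fscale_def wact_def)
qed

lemma wact_Dl:
  assumes g: "g permutes N"
  shows "wact g (Dl y) = fscale (of_int (sign g)) (Dl (y \<circ> inv' g))"
  using Dl_comp[OF permutes_inv[OF g], of y] permutes_inv_inv[OF g]
    sign_inverse[OF permutation_if_permutes[OF finite_N g]]
  by (simp add: fscale_fscale of_int_sign_square)

lemma wact_in_S:
  assumes g: "g permutes N" and x: "x \<in> S"
  shows "wact g x \<in> S"
  using x
proof (induction rule: S_induct)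
  case zero
  have "wact g (0 :: word \<Rightarrow> 'a) = 0" by (simp add: wact_def fun_eq_iff)
  then show ?case using fv.subspace_0[OF subspace_S] by (simp only:)
next
  case (step c y x)
  then show ?case
    unfolding wact_add wact_scale wact_Dl[OF g]
    by (intro fv.subspace_add[OF subspace_S] fv.subspace_scale[OF subspace_S] Dl_in_S)
qed

lemma submodule_S: "submodule (sym_group n) wact S"
  using wact_in_S subspace_S by (auto simp: submodule_def sym_group_carrier)

lemma S_support: "x \<in> S \<Longrightarrow> x w \<noteq> 0 \<Longrightarrow> has_content N (row_len D) w"
proof (induction rule: S_induct)
  case (step c y x)
  then have "Dl y w \<noteq> 0 \<or> x w \<noteq> 0" by (auto simp: fscale_def)
  then show ?case using step.IH filling_content by (auto simp: Delta_def split: if_splits)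
qed simp

lemma finite_words: "finite {w. has_content N (row_len D) w}"
proof (rule finite_subset)
  have fD: "finite (fst ` D)" using D by (simp add: is_diagram_def)
  show "finite {w. \<forall>k. (k \<in> N \<longrightarrow> w k \<in> fst ` D) \<and> (k \<notin> N \<longrightarrow> w k = 0)}"
    by (rule finite_set_of_finite_funs[OF finite_N fD])
  have "w k \<in> fst ` D" if w: "has_content N (row_len D) w" and k: "k \<in> N" for w k
  proof -
    have "card {l \<in> N. w l = w k} = row_len D (w k)" using w by (simp add: has_content_def)
    moreover have "card {l \<in> N. w l = w k} \<noteq> 0" using k by auto
    ultimately have "(w k, 0) \<in> D" by (simp add: diagram_iff[OF D])
    then show ?thesis by force
  qed
  then show "{w. has_content N (row_len D) w} \<subseteq>
      {w. \<forall>k. (k \<in> N \<longrightarrow> w k \<in> fst ` D) \<and> (k \<notin> N \<longrightarrow> w k = 0)}"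
    by (auto simp: has_content_def zero_off_def)
qed

lemma S_finite_span: "\<exists>C. S \<subseteq> fv.span C \<and> finite C"
proof -
  let ?E = "{w. has_content N (row_len D) w}"
  let ?C = "(\<lambda>w u. of_bool (u = w) :: 'a) ` ?E"
  have "x \<in> fv.span ?C" if x: "x \<in> S" for x
  proof -
    have "x = (\<Sum>w\<in>?E. fscale (x w) (\<lambda>u. of_bool (u = w)))"
      by (rule expand_finite_support[OF finite_words]) (use S_support[OF x] in blast)
    also have "\<dots> \<in> fv.span ?C" by (intro fv.span_sum fv.span_scale fv.span_base imageI)
    finally show ?thesis .
  qed
  then show ?thesis using finite_words by blast
qed

text \<open>
  A functional on \<open>S\<close> is a combination of evaluations at row words, so it is given on the
  polytabloids by a combination of the functions that span \<open>S'\<close>.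
\<close>

lemma functional_in_S':
  assumes h: "lin_on fscale (*) S h"
  shows "(\<lambda>y. h (Dl y)) \<in> S'"
proof -
  obtain c where c: "\<And>x. x \<in> S \<Longrightarrow> h x = (\<Sum>w\<in>{w. has_content N (row_len D) w}. c w * x w)"
    by (rule functional_is_evaluation[OF finite_words _ subspace_S h]) (use S_support in blast)+
  have sub: "fv.subspace S'" by (rule subspace_specht_words)
  have "(\<Sum>w\<in>E. fscale (c w) (\<lambda>y. Delta N D t0 w y)) \<in> S'" for E
    by (intro fv.subspace_sum[OF sub] fv.subspace_scale[OF sub] row_in_S')
  moreover have "(\<lambda>y. \<Sum>w\<in>E. c w * Delta N D t0 w y) = (\<Sum>w\<in>E. fscale (c w) (\<lambda>y. Delta N D t0 w y))" for E
    by (induction E rule: infinite_finite_induct) (auto simp: fscale_def fun_eq_iff)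
  ultimately show ?thesis by (simp only: c[OF Dl_in_S])
qed

lemma S'_functional:
  assumes "s \<in> S'"
  shows "\<exists>h. lin_on fscale (*) UNIV h \<and> (\<forall>y. s y = h (Dl y))"
  using assms unfolding specht_words_def
proof (induction rule: fv.span_induct_alt)
  case base
  show ?case by (rule exI[of _ "\<lambda>_. 0"]) (simp add: lin_on_def)
next
  case (step c b s)
  obtain h where h: "lin_on fscale (*) UNIV h" "\<And>y. s y = h (Dl y)" using step.IH by blast
  obtain w where b: "b = (\<lambda>y. Delta N D t0 w y)" using step.hyps by (auto simp: Delta_converse)
  have "lin_on fscale (*) UNIV (\<lambda>x. c * x w + h x)"
    using h(1) by (auto simp: lin_on_def fscale_def algebra_simps)
  moreover have "(fscale c b + s) y = c * Dl y w + h (Dl y)" for y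
    by (simp add: fscale_def b h(2))
  ultimately show ?case by blast
qed

lemma functional_unique:
  assumes "lin_on fscale (*) S h" "lin_on fscale (*) S h'" "\<And>y. h (Dl y) = h' (Dl y)" "x \<in> S"
  shows "h x = h' x"
  using assms(4)
proof (induction rule: S_induct)
  case zero
  then show ?case using fv.lin_on_zero[OF assms(1) subspace_S] fv.lin_on_zero[OF assms(2) subspace_S] by (simp only:)
next
  case (step c y x)
  then have "fscale c (Dl y) \<in> S" by (intro fv.subspace_scale[OF subspace_S] Dl_in_S)
  then show ?case
    using step by (simp only: lin_on_add[OF assms(1)] lin_on_add[OF assms(2)]
        lin_on_scale[OF assms(1) Dl_in_S] lin_on_scale[OF assms(2) Dl_in_S] assms(3))
qed

lemma Dl_zero: "\<not> (\<exists>w. filling N D w y) \<Longrightarrow> Dl y = 0"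
  by (auto simp: Delta_def fun_eq_iff)

text \<open>
  An endomorphism maps a polytabloid to a vector that is antisymmetric under the same column
  stabiliser, hence to a multiple; as the polytabloids are conjugate, the factor does not depend on
  the polytabloid.
\<close>

theorem endomorphism_scalar:
  assumes f: "lin_on fscale fscale S f" "\<And>x. x \<in> S \<Longrightarrow> f x \<in> S"
    and eq: "\<And>g x. g permutes N \<Longrightarrow> x \<in> S \<Longrightarrow> f (wact g x) = wact g (f x)"
  obtains c where "\<And>x. x \<in> S \<Longrightarrow> f x = fscale c x"
proof -
  obtain w1 y1 where f1: "filling N D w1 y1" using exists_filling[OF t0] .
  have "\<exists>c. \<forall>w. f (Dl y1) w = c * Delta N D t0 w y1"
  proof (rule antisymmetric_is_Delta[where v = "f (Dl y1)", OF two D finite_N t0 _ f1])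
    show "has_content N (row_len D) w" if "f (Dl y1) w \<noteq> 0" for w
      by (rule S_support[of "f (Dl y1)", OF f(2)[OF Dl_in_S] that])
    fix g w assume g: "g permutes N" "y1 \<circ> g = y1"
    have "y1 \<circ> inv' g = y1" using g(2) permutes_inv_o(1)[OF g(1)] by (metis comp_assoc comp_id)
    then have "wact g (Dl y1) = fscale (of_int (sign g)) (Dl y1)" by (simp only: wact_Dl[OF g(1)])
    then have "wact g (f (Dl y1)) = fscale (of_int (sign g)) (f (Dl y1))"
      using eq[OF g(1) Dl_in_S, of y1] lin_on_scale[OF f(1) Dl_in_S] by simp
    then show "f (Dl y1) (w \<circ> g) = of_int (sign g) * f (Dl y1) w"
      unfolding wact_def fscale_def by (rule fun_cong)
  qed
  then obtain c where c: "f (Dl y1) = fscale c (Dl y1)" unfolding fscale_def by blast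
  have cy: "f (Dl y) = fscale c (Dl y)" for y
  proof (cases "\<exists>w. filling N D w y")
    case False
    have "f 0 = 0" by (rule fv.lin_on_zero[OF f(1) subspace_S])
    then show ?thesis unfolding Dl_zero[OF False] by (simp only: fv.scale_zero_right)
  next
    case True
    then obtain w where "filling N D w y" by blast
    then obtain g where g: "g permutes N" and y: "y = y1 \<circ> g" by (rule filling_transitive[OF f1])
    have ig: "inv' g permutes N" by (rule permutes_inv[OF g])
    have "f (Dl y) = fscale (of_int (sign g)) (f (wact (inv' g) (Dl y1)))"
      unfolding y Dl_comp[OF g] by (rule lin_on_scale[OF f(1) wact_in_S[OF ig Dl_in_S]])
    also have "\<dots> = fscale c (Dl y)"
      unfolding y Dl_comp[OF g] eq[OF ig Dl_in_S] c wact_scale by (simp add: mult.commute)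
    finally show ?thesis .
  qed
  have "f x = fscale c x" if "x \<in> S" for x
    using that
  proof (induction rule: S_induct)
    case zero
    then show ?case using fv.lin_on_zero[OF f(1) subspace_S] by (simp only: fv.scale_zero_right)
  next
    case (step d y x)
    have "fscale d (Dl y) \<in> S" by (intro fv.subspace_scale[OF subspace_S] Dl_in_S)
    then have "f (fscale d (Dl y) + x) = fscale d (fscale c (Dl y)) + fscale c x"
      using step by (simp only: lin_on_add[OF f(1)] lin_on_scale[OF f(1) Dl_in_S] cy)
    then show ?case by (simp only: fv.scale_right_distrib fv.scale_scale mult.commute)
  qed
  then show ?thesis by (rule that)
qed

text \<open>
  A bijective linear map that commutes with the group up to the sign turns vectors that are symmetric
  under a stabiliser into antisymmetric ones. A symmetric vector exists for the rows and, among the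
  functionals, for the columns; a nonzero antisymmetric one requires a set of boxes with prescribed
  row and column lengths. This gives the dominance inequality between \<open>D\<close> and its transpose in
  both directions.
\<close>

theorem twisted_bijection_self_conjugate:
  assumes \<theta>: "lin_on fscale fscale S \<theta>" "\<theta> ` S = S" "\<And>x. x \<in> S \<Longrightarrow> \<theta> x = 0 \<Longrightarrow> x = 0"
    and tw: "\<And>g x. g permutes N \<Longrightarrow> x \<in> S \<Longrightarrow> \<theta> (wact g x) = fscale (of_int (sign g)) (wact g (\<theta> x))"
  shows "D = D\<inverse>"
proof (rule diagram_eq_converse_if_dominance[OF D])
  fix m
  obtain w0 y0 where f0: "filling N D w0 y0" using exists_filling[OF t0] .
  have f0': "filling N (D\<inverse>) y0 w0" using f0 filling_converse by blast
  have cw0: "has_content N (row_len D) w0" and cy0: "has_content N (row_len (D\<inverse>)) y0"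
    using filling_content[OF f0] filling_content[OF f0'] .
  have D': "is_diagram (D\<inverse>)" by (rule is_diagram_converse[OF D])
  show "(\<Sum>j<m. row_len D j) = (\<Sum>j<m. row_len (D\<inverse>) j)"
  proof (rule antisym)
    obtain v where v: "v \<in> S" "v \<noteq> 0"
      "\<And>g w. g permutes N \<Longrightarrow> w0 \<circ> g = w0 \<Longrightarrow> v (w \<circ> g) = v w"
      by (rule exists_symmetric_vector[OF two finite_N D t0 f0]) (rule that)
    have "\<theta> v \<noteq> 0" using \<theta>(3) v(1,2) by blast
    then obtain w where w: "\<theta> v w \<noteq> 0" by (auto simp: fun_eq_iff)
    have "\<theta> v \<in> S" using \<theta>(2) v(1) by blast
    then have cw: "has_content N (row_len D) w" using w by (rule S_support[of "\<theta> v" w])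
    have inj: "inj_on (\<lambda>k. (w k, w0 k)) N"
    proof (rule antisymmetric_distinct_pairs[of "\<theta> v", OF two w])
      fix g assume g: "g permutes N" "w0 \<circ> g = w0"
      have "wact g v = v" unfolding wact_def using v(3)[OF g] by blast
      then have "\<theta> v = fscale (of_int (sign g)) (wact g (\<theta> v))" using tw[OF g(1) v(1)] by simp
      then have "\<theta> v w = of_int (sign g) * \<theta> v (w \<circ> g)" unfolding fscale_def wact_def by (rule fun_cong)
      then have "of_int (sign g) * \<theta> v w = (of_int (sign g) * of_int (sign g)) * \<theta> v (w \<circ> g)"
        by (simp only: mult.assoc)
      then show "\<theta> v (w \<circ> g) = of_int (sign g) * \<theta> v w" by (simp only: of_int_sign_square mult_1)
    qed
    show "(\<Sum>j<m. row_len D j) \<le> (\<Sum>j<m. row_len (D\<inverse>) j)"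
      by (rule distinct_pairs_dominance[OF D finite_N inj cw cw0])
  next
    obtain v where v: "v \<in> S'" "v \<noteq> 0"
      "\<And>g w. g permutes N \<Longrightarrow> y0 \<circ> g = y0 \<Longrightarrow> v (w \<circ> g) = v w"
      by (rule exists_symmetric_vector[OF two finite_N D' bij_betw_converse[OF t0] f0']) (rule that)
    obtain h where hU: "lin_on fscale (*) UNIV h" and hv: "\<And>y. v y = h (Dl y)"
      using S'_functional[OF v(1)] by blast
    have h: "lin_on fscale (*) S h" by (rule lin_on_subset[OF hU subset_UNIV])
    have anti: "h (wact (inv' g) x) = of_int (sign g) * h x"
      if g: "g permutes N" "y0 \<circ> g = y0" and x: "x \<in> S" for g x
    proof (rule functional_unique[OF _ _ _ x])
      have ig: "inv' g permutes N" by (rule permutes_inv[OF g(1)])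
      show "lin_on fscale (*) S (\<lambda>x. h (wact (inv' g) x))"
        by (rule lin_on_comp[OF lin_on_wact h]) (use wact_in_S[OF ig] in blast)
      show "lin_on fscale (*) S (\<lambda>x. of_int (sign g) * h x)"
        using h by (auto simp: lin_on_def algebra_simps)
      fix y
      have "of_int (sign g) * h (wact (inv' g) (Dl y)) = h (Dl (y \<circ> g))"
        unfolding Dl_comp[OF g(1)] by (rule lin_on_scale[OF hU, symmetric]) simp
      also have "\<dots> = h (Dl y)" using v(3)[OF g, of y] by (simp add: hv)
      finally have "of_int (sign g) * h (wact (inv' g) (Dl y)) = h (Dl y)" .
      then have "(of_int (sign g) * of_int (sign g)) * h (wact (inv' g) (Dl y)) = of_int (sign g) * h (Dl y)"
        by (simp only: mult.assoc)
      then show "h (wact (inv' g) (Dl y)) = of_int (sign g) * h (Dl y)"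
        by (simp only: of_int_sign_square mult_1)
    qed
    have hth: "lin_on fscale (*) S (\<lambda>x. h (\<theta> x))" by (rule lin_on_comp[OF \<theta>(1) h]) (simp only: \<theta>(2) order_refl)
    define u where "u y = h (\<theta> (Dl y))" for y
    obtain z where z: "v z \<noteq> 0" using v(2) by (auto simp: fun_eq_iff)
    have "\<exists>y. u y \<noteq> 0"
    proof (rule ccontr)
      assume "\<nexists>y. u y \<noteq> 0"
      then have z0: "h (\<theta> (Dl y)) = 0" for y by (simp add: u_def)
      have zero: "h (\<theta> x) = 0" if "x \<in> S" for x
        by (rule functional_unique[OF hth _ _ that, of "\<lambda>_. 0"]) (simp add: lin_on_def, rule z0)
      obtain x where "x \<in> S" "Dl z = \<theta> x" using \<theta>(2) Dl_in_S[of z] by blast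
      then show False using zero z hv by simp
    qed
    then obtain y where y: "u y \<noteq> 0" by blast
    have "\<exists>w. filling N D w y"
    proof (rule ccontr)
      assume "\<not> ?thesis"
      then have "Dl y = 0" by (rule Dl_zero)
      then have "u y = 0"
        unfolding u_def using fv.lin_on_zero[OF hth subspace_S] by (simp only:)
      then show False using y by simp
    qed
    then have cy: "has_content N (row_len (D\<inverse>)) y" using filling_content filling_converse by metis
    have inj: "inj_on (\<lambda>k. (y k, y0 k)) N"
    proof (rule antisymmetric_distinct_pairs[of u, OF two y])
      fix g assume g: "g permutes N" "y0 \<circ> g = y0"
      have ig: "inv' g permutes N" by (rule permutes_inv[OF g(1)])
      have s: "sign (inv' g) = sign g" by (rule sign_inverse[OF permutation_if_permutes[OF finite_N g(1)]])
      have "\<theta> (Dl (y \<circ> g)) = fscale (of_int (sign g)) (\<theta> (wact (inv' g) (Dl y)))"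
        unfolding Dl_comp[OF g(1)] by (rule lin_on_scale[OF \<theta>(1) wact_in_S[OF ig Dl_in_S]])
      also have "\<dots> = wact (inv' g) (\<theta> (Dl y))"
        unfolding tw[OF ig Dl_in_S] s by (simp add: fscale_fscale of_int_sign_square)
      finally have "\<theta> (Dl (y \<circ> g)) = wact (inv' g) (\<theta> (Dl y))" .
      moreover have "\<theta> (Dl y) \<in> S" using \<theta>(2) Dl_in_S by blast
      ultimately show "u (y \<circ> g) = of_int (sign g) * u y" unfolding u_def using anti[OF g] by simp
    qed
    show "(\<Sum>j<m. row_len (D\<inverse>) j) \<le> (\<Sum>j<m. row_len D j)"
      using distinct_pairs_dominance[OF D' finite_N inj cy cy0, of m] by simp
  qed
qed

end


section \<open>Decomposability over the alternating group\<close>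

context specht_setting
begin

lemma S_nonzero: "S \<noteq> {0}"
proof -
  obtain w y where "filling N D w y" using exists_filling[OF t0] .
  then have "Dl y w \<noteq> 0" using Delta_square[of N D w y t0, where ?'a = 'a] by auto
  then have "Dl y \<noteq> 0" by (auto simp: fun_eq_iff)
  then show ?thesis using Dl_in_S[of y] by blast
qed

lemma exists_simple_submodule:
  assumes U: "submodule (sym_group n) wact U" "U \<subseteq> S" "U \<noteq> {0}"
  obtains U0 where "simple_module (sym_group n) wact U0" "U0 \<subseteq> U"
proof -
  obtain C where C: "S \<subseteq> fv.span C" "finite C" using S_finite_span by blast
  let ?P = "\<lambda>W. submodule (sym_group n) wact W \<and> W \<subseteq> U \<and> W \<noteq> {0}"
  have "?P U" using U by blast
  then obtain U0 where U0: "?P U0" and min: "\<And>W. ?P W \<Longrightarrow> fv.dim U0 \<le> fv.dim W"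
    using ex_has_least_nat[of ?P U fv.dim] by blast
  have "W = {0} \<or> W = U0" if W: "submodule (sym_group n) wact W" "W \<subseteq> U0" for W
  proof (rule ccontr)
    assume "\<not> ?thesis"
    then have ne: "W \<noteq> {0}" "W \<subset> U0" using W(2) by auto
    then have "fv.dim U0 \<le> fv.dim W" using W U0 by (intro min) blast
    moreover have "fv.dim W < fv.dim U0"
      using W(1) ne(2) U0 U(2) C by (intro fv.dim_strict_mono[of W U0 C]) (auto simp: submodule_def)
    ultimately show False by simp
  qed
  then have "simple_module (sym_group n) wact U0" using U0 by (simp add: simple_module_def)
  then show ?thesis using U0 that by blast
qed

definition invariant_form :: "(word \<Rightarrow> 'a) set \<Rightarrow> ((word \<Rightarrow> 'a) \<Rightarrow> (word \<Rightarrow> 'a) \<Rightarrow> 'a) \<Rightarrow> bool" where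
  "invariant_form U B \<longleftrightarrow>
     (\<forall>v\<in>U. lin_on fscale (*) U (\<lambda>u. B u v)) \<and> (\<forall>u\<in>U. lin_on fscale (*) U (B u)) \<and>
     (\<forall>g u v. g permutes N \<longrightarrow> u \<in> U \<longrightarrow> v \<in> U \<longrightarrow> B (wact g u) (wact g v) = B u v) \<and>
     (\<forall>v\<in>U. (\<forall>u\<in>U. B u v = 0) \<longrightarrow> v = 0)"

lemma simple_module_form:
  assumes U: "simple_module (sym_group n) wact U" "U \<subseteq> S"
  shows "\<exists>B. invariant_form U B"
proof -
  obtain C :: "(word \<Rightarrow> 'a) set" where C: "S \<subseteq> fv.span C" "finite C" using S_finite_span by blast
  interpret group "sym_group n" by (rule sym_group_is_group)
  interpret real_simple_module "fscale :: 'a \<Rightarrow> _" "sym_group n" wact U C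
  proof
    show "\<exists>z. poly p z = 0" if "degree p > 0" for p :: "'a poly"
      using that by (rule alg_closed_imp_poly_has_root)
    show "\<exists>h\<in>carrier (sym_group n).
        h \<otimes>\<^bsub>sym_group n\<^esub> g \<otimes>\<^bsub>sym_group n\<^esub> inv\<^bsub>sym_group n\<^esub> h = inv\<^bsub>sym_group n\<^esub> g"
      if g: "g \<in> carrier (sym_group n)" for g
    proof -
      obtain h where h: "h permutes N" "h \<circ> g = inv' g \<circ> h"
        using permutes_conjugate_inverse[OF finite_N] g sym_group_carrier by metis
      have "h \<circ> g \<circ> inv' h = inv' g"
        unfolding h(2) by (simp add: comp_assoc permutes_inv_o(1)[OF h(1)])
      then show ?thesis using h(1) g by (intro bexI[of _ h]) (simp_all add: sym_group_carrier sym_group_mult)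
    qed
    show "fv.subspace U" "U \<noteq> {0}" using U(1) by (simp_all add: simple_module_def submodule_def)
    show "wact g u \<in> U" if "g \<in> carrier (sym_group n)" "u \<in> U" for g u
      using U(1) that by (simp add: simple_module_def submodule_def)
    show "W = {0} \<or> W = U" if "fv.subspace W" "W \<subseteq> U"
      "\<And>g w. g \<in> carrier (sym_group n) \<Longrightarrow> w \<in> W \<Longrightarrow> wact g w \<in> W" for W
      using U(1) that by (simp add: simple_module_def submodule_def)
    show "U \<subseteq> fv.span C" "finite C" using U(2) C by auto
  qed (simp_all add: lin_on_wact sym_group_mult sym_group_one wact_comp wact_id)
  show ?thesis
  proof (rule exists_invariant_form)
    fix B
    assume "\<And>v. v \<in> U \<Longrightarrow> lin_on fscale (*) U (\<lambda>u. B u v)" "\<And>u. u \<in> U \<Longrightarrow> lin_on fscale (*) U (B u)"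
      "\<And>g u v. g \<in> carrier (sym_group n) \<Longrightarrow> u \<in> U \<Longrightarrow> v \<in> U \<Longrightarrow> B (wact g u) (wact g v) = B u v"
      "\<And>v. v \<in> U \<Longrightarrow> (\<And>u. u \<in> U \<Longrightarrow> B u v = 0) \<Longrightarrow> v = 0"
    then have "invariant_form U B" unfolding invariant_form_def sym_group_carrier by blast
    then show ?thesis by blast
  qed
qed

lemma S'_eq_S: "D = D\<inverse> \<Longrightarrow> S' = S"
  using specht_words_reference[OF finite_N _ t0, of "t0 \<circ> prod.swap", where ?'a = 'a] bij_betw_converse[OF t0]
  by simp

lemma odd_transposition:
  assumes "n \<ge> 2"
  obtains \<tau> where "\<tau> permutes N" "sign \<tau> = -1" "inv' \<tau> = \<tau>" "\<tau> \<circ> \<tau> = id"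
proof -
  have "transpose 1 2 permutes N" using assms by (intro permutes_swap_id) auto
  moreover have "transpose (1::nat) 2 \<circ> transpose 1 2 = id" by (simp add: fun_eq_iff)
  moreover from this have "inv' (transpose (1::nat) 2) = transpose 1 2" by (intro inv_unique_comp)
  ultimately show ?thesis by (intro that[of "transpose 1 2"]) (auto simp: sign_swap_id)
qed

text \<open>
  If \<open>S\<close> is simple and \<open>D\<close> is its own transpose, the invariant form identifies \<open>S\<close> with the
  functionals on it, that is, with \<open>S' = S\<close>. The resulting map \<open>\<theta>\<close> commutes with the group up to
  sign; its square is a nonzero scalar, and its two eigenspaces are exchanged by odd permutations.
\<close>

theorem decomposable_if_simple:
  assumes n: "n \<ge> 2" and S: "simple_module (sym_group n) wact S" and DD: "D = D\<inverse>"
  shows "decomposable (alt_group n) wact S"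
proof -
  obtain B where B: "invariant_form S B" using simple_module_form[OF S subset_refl] by blast
  have B1: "\<And>v. v \<in> S \<Longrightarrow> lin_on fscale (*) S (\<lambda>u. B u v)"
    and B2: "\<And>u. u \<in> S \<Longrightarrow> lin_on fscale (*) S (\<lambda>v. B u v)"
    and inv: "\<And>g u v. g permutes N \<Longrightarrow> u \<in> S \<Longrightarrow> v \<in> S \<Longrightarrow> B (wact g u) (wact g v) = B u v"
    and nondeg: "\<And>v. v \<in> S \<Longrightarrow> (\<And>u. u \<in> S \<Longrightarrow> B u v = 0) \<Longrightarrow> v = 0"
    using B unfolding invariant_form_def by blast+
  define \<theta> where "\<theta> v = (\<lambda>y. B (Dl y) v)" for v
  have \<theta>S: "\<theta> v \<in> S" if "v \<in> S" for v
    using functional_in_S'[OF B1[OF that]] S'_eq_S[OF DD] by (simp add: \<theta>_def)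
  have lin: "lin_on fscale fscale S \<theta>"
    unfolding lin_on_def
  proof (intro conjI ballI allI ext)
    show "\<theta> (x + z) y = (\<theta> x + \<theta> z) y" if "x \<in> S" "z \<in> S" for x z y
      by (simp only: \<theta>_def plus_fun_apply lin_on_add[OF B2[OF Dl_in_S]] that)
    show "\<theta> (fscale c x) y = fscale c (\<theta> x) y" if "x \<in> S" for c x y
      using lin_on_scale[OF B2[OF Dl_in_S] that, of y c] by (simp only: \<theta>_def) (simp only: fscale_def)
  qed
  have tw: "\<theta> (wact g v) = fscale (of_int (sign g)) (wact g (\<theta> v))" if g: "g permutes N" and v: "v \<in> S" for g v
  proof
    fix y
    have ig: "inv' g permutes N" by (rule permutes_inv[OF g])
    have "B (Dl (y \<circ> g)) v = of_int (sign g) * B (wact (inv' g) (Dl y)) v"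
      unfolding Dl_comp[OF g] by (rule lin_on_scale[OF B1[OF v] wact_in_S[OF ig Dl_in_S]])
    also have "B (wact (inv' g) (Dl y)) v = B (Dl y) (wact g v)"
      using inv[OF g wact_in_S[OF ig Dl_in_S] v, of y] by (simp only: wact_inverse[OF g])
    finally have e: "B (Dl (y \<circ> g)) v = of_int (sign g) * B (Dl y) (wact g v)" .
    have "\<theta> (wact g v) y = (of_int (sign g) * of_int (sign g)) * B (Dl y) (wact g v)"
      by (simp only: \<theta>_def of_int_sign_square mult_1)
    also have "\<dots> = of_int (sign g) * B (Dl (y \<circ> g)) v" by (simp only: e mult.assoc)
    finally show "\<theta> (wact g v) y = fscale (of_int (sign g)) (wact g (\<theta> v)) y"
      by (simp only: \<theta>_def wact_def fscale_def)
  qed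
  have inj: "v = 0" if v: "v \<in> S" "\<theta> v = 0" for v
  proof (rule nondeg[OF v(1)])
    fix u assume u: "u \<in> S"
    have z: "B (Dl y) v = 0" for y using fun_cong[OF v(2), of y] by (simp add: \<theta>_def)
    show "B u v = 0"
      by (rule functional_unique[OF B1[OF v(1)] _ _ u, of "\<lambda>_. 0"]) (simp add: lin_on_def, rule z)
  qed
  obtain d where d: "\<And>x. x \<in> S \<Longrightarrow> \<theta> (\<theta> x) = fscale d x"
  proof (rule endomorphism_scalar[of "\<lambda>x. \<theta> (\<theta> x)"])
    show "lin_on fscale fscale S (\<lambda>x. \<theta> (\<theta> x))" by (rule lin_on_comp[OF lin lin]) (use \<theta>S in blast)
    show "\<theta> (\<theta> x) \<in> S" if "x \<in> S" for x using \<theta>S that by blast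
    show "\<theta> (\<theta> (wact g x)) = wact g (\<theta> (\<theta> x))" if g: "g permutes N" and x: "x \<in> S" for g x
      unfolding tw[OF g x] lin_on_scale[OF lin wact_in_S[OF g \<theta>S[OF x]]] tw[OF g \<theta>S[OF x]]
      by (simp add: of_int_sign_square)
  qed (rule that)
  obtain x0 where x0: "x0 \<in> S" "x0 \<noteq> 0" using S_nonzero fv.subspace_0[OF subspace_S] by blast
  have "d \<noteq> 0"
  proof
    assume "d = 0"
    then have "\<theta> (\<theta> x0) = 0" using d[OF x0(1)] by (simp only: fv.scale_zero_left)
    then show False using inj \<theta>S x0 by blast
  qed
  obtain e where e: "e ^ 2 = d" using nth_root_exists[of 2 d] by auto
  then have e0: "e \<noteq> 0" using \<open>d \<noteq> 0\<close> by auto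
  define E where "E a = {x \<in> S. \<theta> x = fscale a x}" for a
  have subE: "fv.subspace (E a)" for a
  proof (rule fv.subspaceI)
    show "0 \<in> E a"
      using fv.subspace_0[OF subspace_S] fv.lin_on_zero[OF lin subspace_S]
      by (simp only: E_def mem_Collect_eq fv.scale_zero_right simp_thms)
    show "x + y \<in> E a" if "x \<in> E a" "y \<in> E a" for x y
      using that fv.subspace_add[OF subspace_S]
      by (simp only: E_def mem_Collect_eq lin_on_add[OF lin] fv.scale_right_distrib simp_thms)
    show "fscale c x \<in> E a" if "x \<in> E a" for c x
      using that fv.subspace_scale[OF subspace_S]
      by (simp only: E_def mem_Collect_eq lin_on_scale[OF lin] fv.scale_scale mult.commute simp_thms)
  qed
  have actE: "wact g x \<in> E (of_int (sign g) * a)" if g: "g permutes N" and x: "x \<in> E a" for g x a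
  proof -
    have "x \<in> S" "\<theta> x = fscale a x" using x by (auto simp: E_def)
    then show ?thesis
      unfolding E_def using tw[OF g] wact_in_S[OF g] by (simp only: mem_Collect_eq wact_scale fv.scale_scale simp_thms)
  qed
  have altE: "submodule (alt_group n) wact (E a)" for a
    unfolding submodule_def using subE actE[of _ _ a]
    by (fastforce simp: alt_group_carrier sign_def)
  \<comment> \<open>For \<open>a\<^sup>2 = d\<close> this is the projection onto \<open>E a\<close> along \<open>E (- a)\<close>.\<close>
  define P where "P a x = fscale (1/2) (x + fscale (1 / a) (\<theta> x))" for a x
  have PE: "P a x \<in> E a" if a: "a ^ 2 = d" and x: "x \<in> S" for a x
  proof -
    have a0: "a \<noteq> 0" using a \<open>d \<noteq> 0\<close> by auto
    have s1: "fscale (1 / a) (\<theta> x) \<in> S" by (rule fv.subspace_scale[OF subspace_S \<theta>S[OF x]])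
    have s: "fscale (1 / a) (\<theta> x) \<in> S" "x + fscale (1 / a) (\<theta> x) \<in> S"
      using s1 fv.subspace_add[OF subspace_S x s1] by blast+
    then have "P a x \<in> S" unfolding P_def by (intro fv.subspace_scale[OF subspace_S])
    have "\<theta> (P a x) = fscale (1/2) (\<theta> x + fscale (1 / a) (fscale d x))"
      unfolding P_def using s x \<theta>S[OF x]
      by (simp only: lin_on_scale[OF lin] lin_on_add[OF lin] d)
    also have "\<dots> = fscale a (P a x)"
      using a0 by (simp add: P_def fscale_def fun_eq_iff a[symmetric] power2_eq_square field_simps)
    finally show ?thesis using \<open>P a x \<in> S\<close> by (simp add: E_def)
  qed
  have sum: "x = P e x + P (- e) x" for x
    using two by (simp add: P_def fscale_def fun_eq_iff field_simps)
  obtain \<tau> where \<tau>: "\<tau> permutes N" "sign \<tau> = -1" "inv' \<tau> = \<tau>" "\<tau> \<circ> \<tau> = id"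
    using odd_transposition[OF n] .
  have E0: "x = 0" if z: "E (- a) = {0}" and x: "x \<in> E a" for a x
  proof -
    have "wact \<tau> x \<in> E (- a)" using actE[OF \<tau>(1) x] \<tau>(2) by simp
    then have "wact \<tau> x = 0" using z by blast
    then have "wact \<tau> (wact \<tau> x) = 0" by (simp add: wact_def fun_eq_iff)
    then show ?thesis by (simp only: wact_comp[symmetric] \<tau>(4) wact_id)
  qed
  have ne: "E a \<noteq> {0}" if a: "a ^ 2 = d" for a
  proof
    assume z: "E a = {0}"
    have "x0 = P a x0 + P (- a) x0"
      using two by (simp add: P_def fscale_def fun_eq_iff field_simps)
    moreover have "P a x0 = 0" using PE[OF a x0(1)] z by blast
    moreover have "P (- a) x0 = 0"
      using E0[of "- a" "P (- a) x0"] PE[of "- a" x0] a x0(1) z by simp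
    ultimately show False using x0(2) by (simp only: add_0)
  qed
  have int: "E e \<inter> E (- e) = {0}"
  proof -
    have "x = 0" if "x \<in> E e" "x \<in> E (- e)" for x
    proof -
      have "fscale e x = fscale (- e) x" using that by (simp only: E_def mem_Collect_eq)
      then have "fscale (2 * e) x = 0"
        by (simp add: fscale_def fun_eq_iff)
      then show ?thesis using two e0 by (simp only: fv.scale_eq_0_iff mult_eq_0_iff simp_thms)
    qed
    then show ?thesis using fv.subspace_0[OF subE] by blast
  qed
  have "S = {u + v | u v. u \<in> E e \<and> v \<in> E (- e)}"
  proof
    show "S \<subseteq> {u + v | u v. u \<in> E e \<and> v \<in> E (- e)}"
    proof
      fix x assume "x \<in> S"
      then have "P e x \<in> E e" "P (- e) x \<in> E (- e)" using PE e by auto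
      then show "x \<in> {u + v | u v. u \<in> E e \<and> v \<in> E (- e)}" using sum[of x] by blast
    qed
    show "{u + v | u v. u \<in> E e \<and> v \<in> E (- e)} \<subseteq> S"
      using fv.subspace_add[OF subspace_S] by (auto simp: E_def)
  qed
  moreover have "E e \<noteq> {0}" "E (- e) \<noteq> {0}" using e by (auto intro!: ne)
  ultimately show ?thesis unfolding decomposable_def using altE int by blast
qed

text \<open>
  Let \<open>U\<close> be a simple submodule, identified with its dual by an invariant form. As \<open>D\<close> is its own
  transpose, every \<open>\<theta> s\<close> is a functional \<open>h s\<close> on \<open>S\<close>; restricting it to \<open>U\<close> gives a map from \<open>S\<close>
  to \<open>U\<close>, in which the two sign twists cancel. It is a scalar, and a nonzero one since \<open>h s\<close> runs
  through all functionals, so \<open>S \<subseteq> U\<close>.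
\<close>

theorem simple_if_twisted_involution:
  assumes lin: "lin_on fscale fscale S \<theta>" and \<theta>S: "\<And>x. x \<in> S \<Longrightarrow> \<theta> x \<in> S"
    and invol: "\<And>x. x \<in> S \<Longrightarrow> \<theta> (\<theta> x) = x"
    and tw: "\<And>g x. g permutes N \<Longrightarrow> x \<in> S \<Longrightarrow> \<theta> (wact g x) = fscale (of_int (sign g)) (wact g (\<theta> x))"
    and DD: "D = D\<inverse>"
  shows "simple_module (sym_group n) wact S"
proof -
  have S_sub: "S \<subseteq> U" if simple: "simple_module (sym_group n) wact U" and US: "U \<subseteq> S" for U
  proof -
    obtain B where B: "invariant_form U B" using simple_module_form[OF simple US] by blast
    have B1: "\<And>v. v \<in> U \<Longrightarrow> lin_on fscale (*) U (\<lambda>u. B u v)"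
      and B2: "\<And>u. u \<in> U \<Longrightarrow> lin_on fscale (*) U (\<lambda>v. B u v)"
      and inv: "\<And>g u v. g permutes N \<Longrightarrow> u \<in> U \<Longrightarrow> v \<in> U \<Longrightarrow> B (wact g u) (wact g v) = B u v"
      and nondeg: "\<And>v. v \<in> U \<Longrightarrow> (\<And>u. u \<in> U \<Longrightarrow> B u v = 0) \<Longrightarrow> v = 0"
      using B unfolding invariant_form_def by blast+
    have U: "fv.subspace U" and U0: "U \<noteq> {0}" and actU: "\<And>g u. g permutes N \<Longrightarrow> u \<in> U \<Longrightarrow> wact g u \<in> U"
      using simple by (auto simp: simple_module_def submodule_def sym_group_carrier)
    obtain C :: "(word \<Rightarrow> 'a) set" where C: "S \<subseteq> fv.span C" "finite C" using S_finite_span by blast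
    have UC: "U \<subseteq> fv.span C" using US C(1) by blast
    have "\<exists>h. lin_on fscale (*) UNIV h \<and> (\<forall>y. \<theta> s y = h (Dl y))" if "s \<in> S" for s
      using S'_functional[of "\<theta> s"] \<theta>S[OF that] S'_eq_S[OF DD] by simp
    then obtain h where hU: "\<And>s. s \<in> S \<Longrightarrow> lin_on fscale (*) UNIV (h s)"
      and h\<theta>: "\<And>s y. s \<in> S \<Longrightarrow> \<theta> s y = h s (Dl y)" by metis
    have h: "lin_on fscale (*) S (h s)" if "s \<in> S" for s
      using lin_on_subset[OF hU[OF that] subset_UNIV] .
    have "\<exists>v\<in>U. \<forall>u\<in>U. B u v = h s u" if s: "s \<in> S" for s
      by (rule fv.form_represents_functional[OF U UC C(2) B1 B2 nondeg lin_on_subset[OF hU[OF s] subset_UNIV]])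
    then obtain \<eta> where \<eta>U: "\<And>s. s \<in> S \<Longrightarrow> \<eta> s \<in> U"
      and B\<eta>: "\<And>s u. s \<in> S \<Longrightarrow> u \<in> U \<Longrightarrow> B u (\<eta> s) = h s u" by metis
    have unique: "v = v'" if "v \<in> U" "v' \<in> U" "\<And>u. u \<in> U \<Longrightarrow> B u v = B u v'" for v v'
    proof -
      have "v - v' = 0"
        by (rule nondeg) (use that fv.subspace_diff[OF U] fv.lin_on_diff[OF B2 U] in auto)
      then show ?thesis by (simp only: eq_iff_diff_eq_0[symmetric])
    qed
    have \<eta>_lin: "lin_on fscale fscale S \<eta>"
      unfolding lin_on_def
    proof (intro conjI ballI allI)
      fix x y assume xy: "x \<in> S" "y \<in> S"
      then have xyS: "x + y \<in> S" by (intro fv.subspace_add[OF subspace_S])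
      have hadd: "h (x + y) u = h x u + h y u" if u: "u \<in> S" for u
      proof (rule functional_unique[OF h[OF xyS] _ _ u])
        show "lin_on fscale (*) S (\<lambda>u. h x u + h y u)"
          using h[OF xy(1)] h[OF xy(2)] by (auto simp: lin_on_def algebra_simps)
        show "h (x + y) (Dl z) = h x (Dl z) + h y (Dl z)" for z
          by (simp only: h\<theta>[symmetric] xy xyS lin_on_add[OF lin] plus_fun_apply)
      qed
      show "\<eta> (x + y) = \<eta> x + \<eta> y"
      proof (rule unique)
        show "\<eta> (x + y) \<in> U" "\<eta> x + \<eta> y \<in> U" using \<eta>U xy xyS fv.subspace_add[OF U] by blast+
        fix u assume u: "u \<in> U"
        then show "B u (\<eta> (x + y)) = B u (\<eta> x + \<eta> y)"
          using hadd US xy xyS \<eta>U by (simp only: lin_on_add[OF B2[OF u]] B\<eta> subsetD)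
      qed
    next
      fix c x assume x: "x \<in> S"
      then have cx: "fscale c x \<in> S" by (intro fv.subspace_scale[OF subspace_S])
      have hscale: "h (fscale c x) u = c * h x u" if u: "u \<in> S" for u
      proof (rule functional_unique[OF h[OF cx] _ _ u])
        show "lin_on fscale (*) S (\<lambda>u. c * h x u)"
          using h[OF x] by (auto simp: lin_on_def algebra_simps)
        show "h (fscale c x) (Dl z) = c * h x (Dl z)" for z
          by (simp only: h\<theta>[symmetric] x cx lin_on_scale[OF lin]) (simp only: fscale_def)
      qed
      show "\<eta> (fscale c x) = fscale c (\<eta> x)"
      proof (rule unique)
        show "\<eta> (fscale c x) \<in> U" "fscale c (\<eta> x) \<in> U" using \<eta>U x cx fv.subspace_scale[OF U] by blast+
        fix u assume u: "u \<in> U"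
        then show "B u (\<eta> (fscale c x)) = B u (fscale c (\<eta> x))"
          using hscale US x cx \<eta>U by (simp only: lin_on_scale[OF B2[OF u]] B\<eta> subsetD)
      qed
    qed
    have \<eta>_act: "\<eta> (wact g x) = wact g (\<eta> x)" if g: "g permutes N" and x: "x \<in> S" for g x
    proof (rule unique)
      have ig: "inv' g permutes N" by (rule permutes_inv[OF g])
      have gx: "wact g x \<in> S" by (rule wact_in_S[OF g x])
      show "\<eta> (wact g x) \<in> U" "wact g (\<eta> x) \<in> U" using \<eta>U gx x actU[OF g] by blast+
      fix u assume u: "u \<in> U"
      have uS: "u \<in> S" using u US by blast
      have "h (wact g x) u = h x (wact (inv' g) u)"
      proof (rule functional_unique[OF h[OF gx] _ _ uS])
        show "lin_on fscale (*) S (\<lambda>u. h x (wact (inv' g) u))"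
          by (rule lin_on_comp[OF lin_on_wact h[OF x]]) (use wact_in_S[OF ig] in blast)
        fix y
        have "h (wact g x) (Dl y) = of_int (sign g) * \<theta> x (y \<circ> g)"
          by (simp only: h\<theta>[OF gx, symmetric] tw[OF g x]) (simp only: fscale_def wact_def)
        also have "\<dots> = of_int (sign g) * (of_int (sign g) * h x (wact (inv' g) (Dl y)))"
          unfolding h\<theta>[OF x] Dl_comp[OF g] lin_on_scale[OF hU[OF x] UNIV_I] ..
        also have "\<dots> = h x (wact (inv' g) (Dl y))"
          by (simp only: mult.assoc[symmetric] of_int_sign_square mult_1)
        finally show "h (wact g x) (Dl y) = h x (wact (inv' g) (Dl y))" .
      qed
      also have "\<dots> = B (wact (inv' g) u) (\<eta> x)" by (rule B\<eta>[OF x actU[OF ig u], symmetric])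
      also have "\<dots> = B u (wact g (\<eta> x))"
        using inv[OF g actU[OF ig u] \<eta>U[OF x]] by (simp only: wact_inverse[OF g])
      finally show "B u (\<eta> (wact g x)) = B u (wact g (\<eta> x))" by (simp only: B\<eta>[OF gx u])
    qed
    have \<eta>S: "\<eta> x \<in> S" if "x \<in> S" for x using \<eta>U[OF that] US by blast
    obtain c where c: "\<And>x. x \<in> S \<Longrightarrow> \<eta> x = fscale c x"
      by (rule endomorphism_scalar[OF \<eta>_lin]) (rule \<eta>S, assumption, rule \<eta>_act, assumption+, rule that)
    have "c \<noteq> 0"
    proof
      assume "c = 0"
      then have \<eta>0: "\<eta> x = 0" if "x \<in> S" for x using c[OF that] by (simp only: fv.scale_zero_left)
      obtain u where u: "u \<in> U" "u \<noteq> 0" using U0 fv.subspace_0[OF U] by blast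
      then obtain w where w: "u w \<noteq> 0" by (auto simp: fun_eq_iff)
      \<comment> \<open>The functional attached to \<open>\<theta> r\<close> is evaluation at \<open>w\<close>.\<close>
      define r where "r = (\<lambda>y. Delta N D t0 w y :: 'a)"
      have rS: "r \<in> S" unfolding r_def using row_in_S' S'_eq_S[OF DD] by blast
      have s: "\<theta> r \<in> S" by (rule \<theta>S[OF rS])
      have uS: "u \<in> S" using u(1) US by blast
      have "h (\<theta> r) u = u w"
      proof (rule functional_unique[OF h[OF s] _ _ uS])
        show "lin_on fscale (*) S (\<lambda>x. x w)" by (auto simp: lin_on_def fscale_def)
        show "h (\<theta> r) (Dl y) = Dl y w" for y
          by (simp only: h\<theta>[OF s, symmetric] invol[OF rS]) (simp only: r_def)
      qed
      moreover have "h (\<theta> r) u = 0"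
        using B\<eta>[OF s u(1)] fv.lin_on_zero[OF B2[OF u(1)] U] by (simp only: \<eta>0[OF s])
      ultimately show False using w by simp
    qed
    show "S \<subseteq> U"
    proof
      fix x assume x: "x \<in> S"
      have "fscale (1 / c) (\<eta> x) = x" using c[OF x] \<open>c \<noteq> 0\<close> by simp
      then show "x \<in> U" using fv.subspace_scale[OF U \<eta>U[OF x], of "1 / c"] by simp
    qed
  qed
  show ?thesis
    unfolding simple_module_def
  proof (intro conjI allI impI)
    fix U assume U: "submodule (sym_group n) wact U \<and> U \<subseteq> S"
    show "U = {0} \<or> U = S"
    proof (cases "U = {0}")
      case False
      then obtain U0 where "simple_module (sym_group n) wact U0" "U0 \<subseteq> U"
        using exists_simple_submodule U by blast
      then show ?thesis using S_sub[of U0] U by blast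
    qed simp
  qed (rule submodule_S S_nonzero)+
qed

text \<open>
  Let \<open>\<pi>\<close> be the projection onto the first summand and \<open>\<tau>\<close> an odd permutation. Then
  \<open>\<pi> + \<tau> \<pi> \<tau>\<inverse>\<close> commutes with the whole group, hence is a scalar. Evaluated on the two summands, the
  scalar must be 1, so \<open>2 \<pi> - 1\<close> is a twisted involution.
\<close>

theorem decomposable_twisted_involution:
  assumes n: "n \<ge> 2" and dec: "decomposable (alt_group n) wact S"
  obtains \<theta> where "lin_on fscale fscale S \<theta>" "\<And>x. x \<in> S \<Longrightarrow> \<theta> x \<in> S"
    "\<And>x. x \<in> S \<Longrightarrow> \<theta> (\<theta> x) = x"
    "\<And>g x. g permutes N \<Longrightarrow> x \<in> S \<Longrightarrow> \<theta> (wact g x) = fscale (of_int (sign g)) (wact g (\<theta> x))"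
proof -
  obtain U V where UV: "submodule (alt_group n) wact U" "submodule (alt_group n) wact V"
    "U \<noteq> {0}" "V \<noteq> {0}" "U \<inter> V = {0}" "S = {u + v | u v. u \<in> U \<and> v \<in> V}"
    using dec unfolding decomposable_def by blast
  have U: "fv.subspace U" and V: "fv.subspace V" using UV(1,2) by (auto simp: submodule_def)
  have act: "wact g u \<in> U" "wact g v \<in> V" if "g permutes N" "evenperm g" "u \<in> U" "v \<in> V" for g u v
    using UV(1,2) that by (auto simp: submodule_def alt_group_carrier)
  have unique: "u = u' \<and> v = v'" if "u \<in> U" "u' \<in> U" "v \<in> V" "v' \<in> V" "u + v = u' + v'" for u u' v v'
  proof -
    have "u - u' = (u + v) - (u' + v)" by (simp only: add_diff_cancel_right)
    also have "\<dots> = v' - v" by (simp only: that(5) add_diff_cancel_left)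
    finally have "u - u' = v' - v" .
    moreover have "u - u' \<in> U" "v' - v \<in> V" using that fv.subspace_diff U V by blast+
    ultimately have "u - u' \<in> U \<inter> V" "v' - v \<in> U \<inter> V" by (simp_all only: Int_iff simp_thms)
    then have "u - u' = 0" "v' - v = 0" unfolding UV(5) by (simp_all only: singleton_iff)
    then show ?thesis by (simp only: eq_iff_diff_eq_0[symmetric] simp_thms)
  qed
  have "\<forall>x\<in>S. \<exists>u. \<exists>v. u \<in> U \<and> v \<in> V \<and> x = u + v" using UV(6) by blast
  then obtain \<pi> where "\<forall>x\<in>S. \<exists>v. \<pi> x \<in> U \<and> v \<in> V \<and> x = \<pi> x + v" by metis
  then obtain \<rho> where dec: "\<And>x. x \<in> S \<Longrightarrow> \<pi> x \<in> U" "\<And>x. x \<in> S \<Longrightarrow> \<rho> x \<in> V"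
    "\<And>x. x \<in> S \<Longrightarrow> x = \<pi> x + \<rho> x" by metis
  have US: "u \<in> S" if "u \<in> U" for u
  proof -
    have "u + 0 \<in> S" unfolding UV(6) using that fv.subspace_0[OF V] by blast
    then show ?thesis by (simp only: add_0_right)
  qed
  have VS: "v \<in> S" if "v \<in> V" for v
  proof -
    have "0 + v \<in> S" unfolding UV(6) using that fv.subspace_0[OF U] by blast
    then show ?thesis by (simp only: add_0_left)
  qed
  have \<pi>_eq: "\<pi> (u + v) = u" if "u \<in> U" "v \<in> V" for u v
  proof -
    have "u + v \<in> S" using that UV(6) by blast
    then show ?thesis using unique[OF dec(1) that(1) dec(2) that(2) dec(3)[symmetric]] by blast
  qed
  have \<pi>U: "\<pi> u = u" if "u \<in> U" for u
    using \<pi>_eq[OF that fv.subspace_0[OF V]] by (simp only: add_0_right)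
  have \<pi>V: "\<pi> v = 0" if "v \<in> V" for v
    using \<pi>_eq[OF fv.subspace_0[OF U] that] by (simp only: add_0_left)
  have \<pi>S: "\<pi> x \<in> S" if "x \<in> S" for x using US dec(1) that by blast
  have \<pi>\<pi>: "\<pi> (\<pi> x) = \<pi> x" if "x \<in> S" for x using \<pi>U dec(1) that by blast
  have lin: "lin_on fscale fscale S \<pi>"
    unfolding lin_on_def
  proof (intro conjI ballI allI)
    fix x y assume xy: "x \<in> S" "y \<in> S"
    have "x + y = (\<pi> x + \<rho> x) + (\<pi> y + \<rho> y)" using dec(3) xy by metis
    also have "\<dots> = (\<pi> x + \<pi> y) + (\<rho> x + \<rho> y)" by (simp only: ac_simps)
    finally show "\<pi> (x + y) = \<pi> x + \<pi> y"
      using \<pi>_eq[of "\<pi> x + \<pi> y" "\<rho> x + \<rho> y"] dec xy fv.subspace_add U V by metis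
  next
    fix c x assume x: "x \<in> S"
    have "fscale c x = fscale c (\<pi> x) + fscale c (\<rho> x)"
      using dec(3)[OF x] fv.scale_right_distrib by metis
    then show "\<pi> (fscale c x) = fscale c (\<pi> x)"
      using \<pi>_eq[of "fscale c (\<pi> x)" "fscale c (\<rho> x)"] dec x fv.subspace_scale U V by metis
  qed
  have even: "\<pi> (wact g x) = wact g (\<pi> x)" if g: "g permutes N" "evenperm g" and x: "x \<in> S" for g x
  proof -
    have "wact g x = wact g (\<pi> x) + wact g (\<rho> x)" using dec(3)[OF x] wact_add by metis
    then show ?thesis using \<pi>_eq act[OF g] dec(1,2)[OF x] by metis
  qed
  obtain \<tau> where \<tau>: "\<tau> permutes N" "sign \<tau> = -1" "inv' \<tau> = \<tau>" "\<tau> \<circ> \<tau> = id"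
    using odd_transposition[OF n] .
  have \<tau>\<tau>: "wact \<tau> (wact \<tau> x) = x" for x :: "word \<Rightarrow> 'a" by (simp only: wact_comp[symmetric] \<tau>(4) wact_id)
  have \<tau>S: "wact \<tau> x \<in> S" if "x \<in> S" for x using wact_in_S[OF \<tau>(1) that] .
  have perm: "permutation g" if "g permutes N" for g using permutation_if_permutes[OF finite_N that] .
  have even_iff: "evenperm g \<longleftrightarrow> sign g = 1" for g :: "nat \<Rightarrow> nat" by (simp add: sign_def)
  have even_comp: "evenperm (g \<circ> h)" if "g permutes N" "h permutes N" "sign g = sign h" for g h
    using that perm by (simp add: even_iff sign_compose)
  define \<sigma> where "\<sigma> x = \<pi> x + wact \<tau> (\<pi> (wact \<tau> x))" for x
  have \<sigma>\<tau>: "\<sigma> (wact \<tau> x) = wact \<tau> (\<sigma> x)" for x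
    unfolding \<sigma>_def wact_add \<tau>\<tau> by (simp only: add.commute)
  have \<sigma>even: "\<sigma> (wact g x) = wact g (\<sigma> x)" if g: "g permutes N" "evenperm g" and x: "x \<in> S" for g x
  proof -
    have c: "\<tau> \<circ> g \<circ> \<tau> permutes N" "evenperm (\<tau> \<circ> g \<circ> \<tau>)"
      using g \<tau>(1,2) perm by (auto simp: even_iff sign_compose permutation_compose intro!: permutes_compose)
    have "\<tau> \<circ> g = \<tau> \<circ> g \<circ> \<tau> \<circ> \<tau>" by (simp add: comp_assoc \<tau>(4))
    then have "wact \<tau> (wact g x) = wact (\<tau> \<circ> g \<circ> \<tau>) (wact \<tau> x)" by (simp only: wact_comp[symmetric])
    then have "wact \<tau> (\<pi> (wact \<tau> (wact g x))) = wact \<tau> (wact (\<tau> \<circ> g \<circ> \<tau>) (\<pi> (wact \<tau> x)))"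
      using even[OF c \<tau>S[OF x]] by (simp only:)
    also have "\<dots> = wact g (wact \<tau> (\<pi> (wact \<tau> x)))"
      by (simp only: wact_comp \<tau>\<tau>)
    finally show ?thesis by (simp only: \<sigma>_def even[OF g x] wact_add)
  qed
  obtain c where c: "\<And>x. x \<in> S \<Longrightarrow> \<sigma> x = fscale c x"
  proof (rule endomorphism_scalar[of \<sigma>])
    show "lin_on fscale fscale S \<sigma>"
      unfolding lin_on_def
    proof (intro conjI ballI allI)
      show "\<sigma> (x + y) = \<sigma> x + \<sigma> y" if "x \<in> S" "y \<in> S" for x y
        unfolding \<sigma>_def wact_add lin_on_add[OF lin that] lin_on_add[OF lin \<tau>S[OF that(1)] \<tau>S[OF that(2)]]
        by (simp only: ac_simps)
      show "\<sigma> (fscale c x) = fscale c (\<sigma> x)" if "x \<in> S" for c x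
        unfolding \<sigma>_def wact_scale lin_on_scale[OF lin that] lin_on_scale[OF lin \<tau>S[OF that]]
        by (simp only: fv.scale_right_distrib)
    qed
    show "\<sigma> x \<in> S" if "x \<in> S" for x
      unfolding \<sigma>_def using that \<tau>S \<pi>S by (intro fv.subspace_add[OF subspace_S]) blast+
    show "\<sigma> (wact g x) = wact g (\<sigma> x)" if g: "g permutes N" and x: "x \<in> S" for g x
    proof (cases "evenperm g")
      case True
      then show ?thesis using \<sigma>even g x by blast
    next
      case False
      then have s: "sign g = sign \<tau>" unfolding \<tau>(2) by (simp add: sign_def)
      have "g = g \<circ> \<tau> \<circ> \<tau>" by (simp add: comp_assoc \<tau>(4))
      then have gx: "wact g z = wact (g \<circ> \<tau>) (wact \<tau> z)" for z :: "word \<Rightarrow> 'a" by (metis wact_comp)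
      show ?thesis
        unfolding gx using \<sigma>even[OF permutes_compose[OF \<tau>(1) g] even_comp[OF g \<tau>(1) s] \<tau>S[OF x]] \<sigma>\<tau>
        by (simp only:)
    qed
  qed (rule that)
  have \<pi>\<tau>: "wact \<tau> (\<pi> (wact \<tau> x)) = fscale c x - \<pi> x" if "x \<in> S" for x
    using c[OF that] unfolding \<sigma>_def by (simp only: eq_diff_eq add.commute)
  have idem: "a * a = a" if z: "z \<noteq> 0" "z \<in> S" "\<pi> z = fscale a z" for a z
  proof -
    have "fscale (a * a) z = \<pi> (\<pi> z)"
      using z by (simp only: lin_on_scale[OF lin] fv.scale_scale)
    then have "fscale (a * a) z = fscale a z" using \<pi>\<pi>[OF z(2)] z(3) by simp
    then show ?thesis using z(1) by (simp only: fv.scale_cancel_right simp_thms)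
  qed
  have \<tau>0: "wact \<tau> x \<noteq> 0" if "x \<noteq> 0" for x :: "word \<Rightarrow> 'a"
    using that \<tau>\<tau>[of x] by (metis fv.scale_zero_left wact_scale)
  have flip: "\<pi> (wact \<tau> x) = fscale (c - a) (wact \<tau> x)" if x: "x \<in> S" "\<pi> x = fscale a x" for a x
  proof -
    have "wact \<tau> (\<pi> (wact \<tau> x)) = fscale (c - a) x"
      using \<pi>\<tau>[OF x(1)] x(2) by (simp only: fv.scale_left_diff_distrib)
    then show ?thesis using \<tau>\<tau>[of "\<pi> (wact \<tau> x)"] by (simp only: wact_scale)
  qed
  obtain u where u: "u \<in> U" "u \<noteq> 0" using UV(3) fv.subspace_0[OF U] by blast
  obtain v where v: "v \<in> V" "v \<noteq> 0" using UV(4) fv.subspace_0[OF V] by blast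
  have "\<pi> u = fscale 1 u" "\<pi> v = fscale 0 v" using \<pi>U[OF u(1)] \<pi>V[OF v(1)] by simp_all
  then have "(c - 1) * (c - 1) = c - 1" "(c - 0) * (c - 0) = c - 0"
    using flip[OF US[OF u(1)]] flip[OF VS[OF v(1)]] \<tau>0[OF u(2)] \<tau>0[OF v(2)] \<tau>S US[OF u(1)] VS[OF v(1)] idem
    by blast+
  then have cc: "c * c - 2 * c + 1 = c - 1" "c * c = c" by (auto simp: algebra_simps)
  then have "2 * c = 2 * 1" by (simp add: algebra_simps)
  then have c1: "c = 1" using two by (simp only: mult_cancel_left simp_thms)
  define \<theta> where "\<theta> x = fscale 2 (\<pi> x) - x" for x
  have 1: "lin_on fscale fscale S \<theta>"
    unfolding lin_on_def
  proof (intro conjI ballI allI)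
    show "\<theta> (x + y) = \<theta> x + \<theta> y" if "x \<in> S" "y \<in> S" for x y
      unfolding \<theta>_def lin_on_add[OF lin that] by (simp add: fscale_def fun_eq_iff algebra_simps)
    show "\<theta> (fscale c x) = fscale c (\<theta> x)" if "x \<in> S" for c x
      unfolding \<theta>_def lin_on_scale[OF lin that] by (simp add: fscale_def fun_eq_iff algebra_simps)
  qed
  have 2: "\<theta> x \<in> S" if "x \<in> S" for x
    unfolding \<theta>_def using that \<pi>S by (intro fv.subspace_diff[OF subspace_S] fv.subspace_scale[OF subspace_S])
  have 3: "\<theta> (\<theta> x) = x" if x: "x \<in> S" for x
  proof -
    have "\<pi> (\<theta> x) = \<pi> x"
    proof -
      have "\<pi> (\<theta> x) = fscale 2 (\<pi> x) - \<pi> x"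
        unfolding \<theta>_def
        using fv.lin_on_diff[OF lin subspace_S fv.subspace_scale[OF subspace_S \<pi>S[OF x], of 2] x]
          lin_on_scale[OF lin \<pi>S[OF x], of 2] \<pi>\<pi>[OF x] by simp
      then show ?thesis by (simp add: fscale_def fun_eq_iff)
    qed
    then have "\<theta> (\<theta> x) = fscale 2 (\<pi> x) - \<theta> x" by (simp only: \<theta>_def[of "\<theta> x"])
    then show ?thesis by (simp only: \<theta>_def[of x]) (simp add: fun_eq_iff)
  qed
  have \<theta>even: "\<theta> (wact g x) = wact g (\<theta> x)" if "g permutes N" "evenperm g" "x \<in> S" for g x
    unfolding \<theta>_def even[OF that] by (simp only: wact_diff wact_scale)
  have \<theta>\<tau>: "\<theta> (wact \<tau> x) = fscale (-1) (wact \<tau> (\<theta> x))" if x: "x \<in> S" for x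
  proof -
    have "\<pi> (wact \<tau> x) = wact \<tau> x - wact \<tau> (\<pi> x)"
      using \<pi>\<tau>[OF x] \<tau>\<tau>[of "\<pi> (wact \<tau> x)"] c1 by (simp only: wact_diff fv.scale_one)
    then show ?thesis unfolding \<theta>_def
      by (simp only: wact_diff wact_scale) (simp add: fscale_def fun_eq_iff algebra_simps)
  qed
  have 4: "\<theta> (wact g x) = fscale (of_int (sign g)) (wact g (\<theta> x))" if g: "g permutes N" and x: "x \<in> S" for g x
  proof (cases "evenperm g")
    case True
    then show ?thesis using \<theta>even[OF g True x] by (simp add: sign_def)
  next
    case False
    then have s: "sign g = sign \<tau>" unfolding \<tau>(2) by (simp add: sign_def)
    have "g = g \<circ> \<tau> \<circ> \<tau>" by (simp add: comp_assoc \<tau>(4))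
    then have gx: "wact g z = wact (g \<circ> \<tau>) (wact \<tau> z)" for z :: "word \<Rightarrow> 'a" by (metis wact_comp)
    have "\<theta> (wact g x) = wact (g \<circ> \<tau>) (fscale (-1) (wact \<tau> (\<theta> x)))"
      unfolding gx[of x] \<theta>\<tau>[OF x, symmetric]
      by (rule \<theta>even[OF permutes_compose[OF \<tau>(1) g] even_comp[OF g \<tau>(1) s] \<tau>S[OF x]])
    then show ?thesis by (simp only: wact_scale gx[symmetric] s \<tau>(2)) simp
  qed
  show ?thesis using 1 2 3 4 by (rule that)
qed

theorem decomposable_iff:
  assumes n: "n \<ge> 2"
  shows "decomposable (alt_group n) wact S \<longleftrightarrow> simple_module (sym_group n) wact S \<and> D = D\<inverse>"
proof
  assume "decomposable (alt_group n) wact S"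
  then obtain \<theta> where \<theta>: "lin_on fscale fscale S \<theta>" "\<And>x. x \<in> S \<Longrightarrow> \<theta> x \<in> S"
    "\<And>x. x \<in> S \<Longrightarrow> \<theta> (\<theta> x) = x"
    "\<And>g x. g permutes N \<Longrightarrow> x \<in> S \<Longrightarrow> \<theta> (wact g x) = fscale (of_int (sign g)) (wact g (\<theta> x))"
    by (rule decomposable_twisted_involution[OF n]) (rule that)
  have DD: "D = D\<inverse>"
  proof (rule twisted_bijection_self_conjugate[OF \<theta>(1) _ _ \<theta>(4)])
    show "\<theta> ` S = S" using \<theta>(2,3) by (metis (no_types, lifting) image_eqI image_subsetI subsetI subset_antisym)
    show "x = 0" if "x \<in> S" "\<theta> x = 0" for x
      using \<theta>(3)[OF that(1)] that(2) fv.lin_on_zero[OF \<theta>(1) subspace_S] by simp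
  qed
  then show "simple_module (sym_group n) wact S \<and> D = D\<inverse>"
    using simple_if_twisted_involution[OF \<theta> DD] by blast
qed (use decomposable_if_simple[OF n] in blast)

end


section \<open>From tabloids to words\<close>

subsection \<open>Transport of submodules along an injective intertwiner\<close>

context
  fixes G :: "('g, 'z) monoid_scheme"
    and act :: "'g \<Rightarrow> ('b \<Rightarrow> 'a::field) \<Rightarrow> 'b \<Rightarrow> 'a"
    and act' :: "'g \<Rightarrow> ('c \<Rightarrow> 'a) \<Rightarrow> 'c \<Rightarrow> 'a"
    and J :: "('b \<Rightarrow> 'a) \<Rightarrow> 'c \<Rightarrow> 'a" and M :: "('b \<Rightarrow> 'a) set"
  assumes M: "submodule G act M"
    and J: "Vector_Spaces.linear fscale fscale J"
    and inj: "inj_on J M"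
    and intertwine: "\<And>g x. g \<in> carrier G \<Longrightarrow> x \<in> M \<Longrightarrow> J (act g x) = act' g (J x)"
begin

interpretation l: Vector_Spaces.linear fscale fscale J by (rule J)

lemma subspace_M: "fv.subspace M"
  using M by (simp add: submodule_def)

lemma J_eq_0: "x \<in> M \<Longrightarrow> J x = 0 \<longleftrightarrow> x = 0"
  using inj_onD[OF inj, of x 0] fv.subspace_0[OF subspace_M] l.zero by (simp only:) metis

lemma image_eq_0: "U \<subseteq> M \<Longrightarrow> J ` U = {0} \<longleftrightarrow> U = {0}"
proof
  assume U: "U \<subseteq> M" and z: "J ` U = {0}"
  have "x = 0" if "x \<in> U" for x using that U z J_eq_0 by blast
  moreover have "U \<noteq> {}" using z by blast
  ultimately show "U = {0}" by blast
next
  assume "U = {0}"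
  then show "J ` U = {0}" using l.zero by (simp only: image_insert image_empty)
qed

lemma submodule_image:
  assumes U: "U \<subseteq> M"
  shows "submodule G act' (J ` U) \<longleftrightarrow> submodule G act U"
proof
  assume s: "submodule G act U"
  then show "submodule G act' (J ` U)"
    unfolding submodule_def using l.subspace_image[of U] U intertwine by (auto simp flip: intertwine)
next
  assume s: "submodule G act' (J ` U)"
  then have s0: "fv.subspace (J ` U)" by (simp add: submodule_def)
  have mem: "x \<in> U" if "J x \<in> J ` U" "x \<in> M" for x
    using that U inj_onD[OF inj] by blast
  have "fv.subspace U"
  proof (rule fv.subspaceI)
    show "0 \<in> U" using mem[of 0] fv.subspace_0[OF s0] fv.subspace_0[OF subspace_M] by (simp only: l.zero)
    show "x + y \<in> U" if xy: "x \<in> U" "y \<in> U" for x y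
    proof (rule mem)
      show "J (x + y) \<in> J ` U" unfolding l.add using xy by (intro fv.subspace_add[OF s0] imageI)
      show "x + y \<in> M" using xy U by (intro fv.subspace_add[OF subspace_M]) auto
    qed
    show "fscale c x \<in> U" if x: "x \<in> U" for c x
    proof (rule mem)
      show "J (fscale c x) \<in> J ` U" unfolding l.scale using x by (intro fv.subspace_scale[OF s0] imageI)
      show "fscale c x \<in> M" using x U by (intro fv.subspace_scale[OF subspace_M]) auto
    qed
  qed
  moreover have "act g x \<in> U" if "g \<in> carrier G" "x \<in> U" for g x
    using that U s M by (intro mem) (auto simp: submodule_def intertwine)
  ultimately show "submodule G act U" by (simp add: submodule_def)
qed

lemma simple_module_image:
  assumes W: "W \<subseteq> M"
  shows "simple_module G act' (J ` W) \<longleftrightarrow> simple_module G act W"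
proof -
  have "(\<forall>U. P U \<and> U \<subseteq> J ` W \<longrightarrow> Q U) \<longleftrightarrow> (\<forall>U. P (J ` U) \<and> U \<subseteq> W \<longrightarrow> Q (J ` U))" for P Q
    unfolding subset_image_iff by blast
  then have "(\<forall>U. submodule G act' U \<and> U \<subseteq> J ` W \<longrightarrow> U = {0} \<or> U = J ` W) \<longleftrightarrow>
      (\<forall>U. submodule G act' (J ` U) \<and> U \<subseteq> W \<longrightarrow> J ` U = {0} \<or> J ` U = J ` W)" .
  also have "\<dots> \<longleftrightarrow> (\<forall>U. submodule G act U \<and> U \<subseteq> W \<longrightarrow> U = {0} \<or> U = W)"
  proof -
    have "(submodule G act' (J ` U) \<and> U \<subseteq> W \<longrightarrow> J ` U = {0} \<or> J ` U = J ` W) =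
        (submodule G act U \<and> U \<subseteq> W \<longrightarrow> U = {0} \<or> U = W)" for U
    proof (cases "U \<subseteq> W")
      case True
      then have UM: "U \<subseteq> M" using W by blast
      show ?thesis
        unfolding submodule_image[OF UM] image_eq_0[OF UM] inj_on_image_eq_iff[OF inj UM W] by (rule refl)
    qed simp
    then show ?thesis by (rule arg_cong[where f = All, OF ext])
  qed
  finally show ?thesis unfolding simple_module_def submodule_image[OF W] image_eq_0[OF W] by blast
qed

lemma decomposable_image:
  assumes W: "W \<subseteq> M"
  shows "decomposable G act' (J ` W) \<longleftrightarrow> decomposable G act W"
proof -
  have image_sum: "J ` {u + v | u v. u \<in> U \<and> v \<in> V} = {u + v | u v. u \<in> J ` U \<and> v \<in> J ` V}" for U V
  proof (intro equalityI subsetI)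
    fix x assume "x \<in> J ` {u + v | u v. u \<in> U \<and> v \<in> V}"
    then obtain u v where "u \<in> U" "v \<in> V" "x = J u + J v" by (auto simp: l.add)
    then show "x \<in> {u + v | u v. u \<in> J ` U \<and> v \<in> J ` V}" by blast
  next
    fix x assume "x \<in> {u + v | u v. u \<in> J ` U \<and> v \<in> J ` V}"
    then obtain u v where "u \<in> U" "v \<in> V" "x = J (u + v)" by (auto simp: l.add)
    then show "x \<in> J ` {u + v | u v. u \<in> U \<and> v \<in> V}" by blast
  qed
  have sum_M: "{u + v | u v. u \<in> U \<and> v \<in> V} \<subseteq> M" if "U \<subseteq> M" "V \<subseteq> M" for U V
    using that fv.subspace_add[OF subspace_M] by blast
  show ?thesis
  proof
    assume "decomposable G act W"
    then obtain U V where UV: "submodule G act U" "submodule G act V" "U \<noteq> {0}" "V \<noteq> {0}"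
      "U \<inter> V = {0}" "W = {u + v | u v. u \<in> U \<and> v \<in> V}"
      unfolding decomposable_def by blast
    have 0: "0 \<in> U" "0 \<in> V" using UV(1,2) fv.subspace_0 by (auto simp: submodule_def)
    have "u + 0 \<in> W" "0 + v \<in> W" if "u \<in> U" "v \<in> V" for u v using that 0 UV(6) by blast+
    then have UM: "U \<subseteq> M" "V \<subseteq> M" using W 0 by (auto simp only: add_0_right add_0_left subset_iff)
    show "decomposable G act' (J ` W)"
      unfolding decomposable_def
    proof (intro exI conjI)
      show "submodule G act' (J ` U)" "submodule G act' (J ` V)" 
        using UV(1,2) submodule_image[OF UM(1)] submodule_image[OF UM(2)] by simp_all
      show "J ` U \<noteq> {0}" "J ` V \<noteq> {0}"
        using UV(3,4) image_eq_0[OF UM(1)] image_eq_0[OF UM(2)] by simp_all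
      have "J ` U \<inter> J ` V = J ` (U \<inter> V)" using inj_on_image_Int[OF inj UM] by simp
      then show "J ` U \<inter> J ` V = {0}" unfolding UV(5) by (simp only: image_insert image_empty l.zero)
      show "J ` W = {u + v | u v. u \<in> J ` U \<and> v \<in> J ` V}" unfolding UV(6) by (rule image_sum)
    qed
  next
    assume "decomposable G act' (J ` W)"
    then obtain U' V' where UV: "submodule G act' U'" "submodule G act' V'" "U' \<noteq> {0}" "V' \<noteq> {0}"
      "U' \<inter> V' = {0}" "J ` W = {u + v | u v. u \<in> U' \<and> v \<in> V'}"
      unfolding decomposable_def by blast
    have 0: "0 \<in> U'" "0 \<in> V'" using UV(1,2) fv.subspace_0 by (auto simp: submodule_def)
    have "u + 0 \<in> J ` W" "0 + v \<in> J ` W" if "u \<in> U'" "v \<in> V'" for u v using that 0 UV(6) by blast+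
    then have sub: "U' \<subseteq> J ` W" "V' \<subseteq> J ` W" using 0 by (auto simp only: add_0_right add_0_left subset_iff)
    obtain U V where U: "U \<subseteq> W" "U' = J ` U" and V: "V \<subseteq> W" "V' = J ` V"
      using sub by (meson subset_imageE)
    have UM: "U \<subseteq> M" "V \<subseteq> M" using U V W by auto
    show "decomposable G act W"
      unfolding decomposable_def
    proof (intro exI conjI)
      show "submodule G act U" "submodule G act V"
        using UV(1,2) U(2) V(2) submodule_image[OF UM(1)] submodule_image[OF UM(2)] by simp_all
      show "U \<noteq> {0}" "V \<noteq> {0}"
        using UV(3,4) U(2) V(2) image_eq_0[OF UM(1)] image_eq_0[OF UM(2)] by simp_all
      have "J ` (U \<inter> V) = {0}" using inj_on_image_Int[OF inj UM] UV(5) U V by simp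
      then show "U \<inter> V = {0}" using image_eq_0[of "U \<inter> V"] UM by blast
      have "J ` W = J ` {u + v | u v. u \<in> U \<and> v \<in> V}" using UV(6) U V image_sum by simp
      then show "W = {u + v | u v. u \<in> U \<and> v \<in> V}"
        using inj_on_image_eq_iff[OF inj W sum_M[OF UM]] by blast
    qed
  qed
qed

end


subsection \<open>Tabloids and their words\<close>

lemma sum_fun_apply: "(\<Sum>i\<in>I. f i) x = (\<Sum>i\<in>I. f i x)"
  by (induction I rule: infinite_finite_induct) auto

lemma is_diagram_young_diagram:
  assumes "is_partition n lam"
  shows "is_diagram (young_diagram lam)"
proof -
  have "lam ! i \<le> lam ! i'" if "i' \<le> i" "i < length lam" for i i'
    using assms that by (cases "i' = i") (auto simp: is_partition_def sorted_wrt_iff_nth_less)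
  then show ?thesis
    using finite_young_diagram unfolding is_diagram_def
    by (fastforce simp: young_diagram_def)
qed

lemma young_diagram_inject:
  assumes "is_partition n lam" "is_partition n mu" "young_diagram lam = young_diagram mu"
  shows "lam = mu"
proof (rule nth_equalityI)
  have len: "i < length lam \<longleftrightarrow> (i, 0) \<in> young_diagram lam" if "is_partition n lam" for lam i
    using that by (auto simp: young_diagram_def is_partition_def)
  have "i < length lam \<longleftrightarrow> i < length mu" for i using len assms by metis
  then show l: "length lam = length mu" by (metis linorder_neqE_nat less_irrefl)
  fix i assume i: "i < length lam"
  have "j < lam ! i \<longleftrightarrow> j < mu ! i" for j
  proof -
    have "(i, j) \<in> young_diagram lam \<longleftrightarrow> (i, j) \<in> young_diagram mu" using assms(3) by simp
    then show ?thesis using i l by (simp add: young_diagram_def)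
  qed
  then show "lam ! i = mu ! i" by (metis linorder_neqE_nat less_irrefl)
qed

lemma young_diagram_self_conjugate:
  assumes "is_partition n lam"
  shows "young_diagram lam = (young_diagram lam)\<inverse> \<longleftrightarrow> lam = conjugate lam"
  using young_diagram_conjugate[OF assms] young_diagram_inject[OF assms is_partition_conjugate[OF assms]]
  by metis

context
  fixes lam :: "nat list"
  notes One_nat_def [simp del]
begin

abbreviation (input) "LN \<equiv> {1..sum_list lam}"
abbreviation (input) "LD \<equiv> young_diagram lam"

text \<open>\<open>line_word pr t\<close> is the row word of \<open>t\<close> for \<open>pr = fst\<close>, the column word for \<open>pr = snd\<close>.\<close>

definition line_word :: "(nat \<times> nat \<Rightarrow> nat) \<Rightarrow> tableau \<Rightarrow> word" where
  "line_word pr t k = (if k \<in> LN then pr (inv_into LD t k) else 0)"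

definition word_tabloid :: "word \<Rightarrow> tabloid" where
  "word_tabloid w = {t \<in> tableaux lam. \<forall>b\<in>LD. w (t b) = fst b}"

lemma tableau_bij: "t \<in> tableaux lam \<Longrightarrow> bij_betw t LD LN"
  by (simp add: tableaux_def)

lemma line_word_tableau: "t \<in> tableaux lam \<Longrightarrow> b \<in> LD \<Longrightarrow> line_word pr t (t b) = pr b"
  using bij_betw_apply[OF tableau_bij] bij_betw_inv_into_left[OF tableau_bij] by (simp add: line_word_def)

lemma zero_off_line_word: "zero_off LN (line_word pr t)"
  by (simp add: zero_off_def line_word_def)

lemma label_box: "t \<in> tableaux lam \<Longrightarrow> k \<in> LN \<Longrightarrow> \<exists>b\<in>LD. k = t b"
  by (metis bij_betw_imp_surj_on imageE tableau_bij)

lemma eq_line_word: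
  assumes t: "t \<in> tableaux lam" and w: "zero_off LN w" "\<And>b. b \<in> LD \<Longrightarrow> w (t b) = pr b"
  shows "w = line_word pr t"
proof
  fix k show "w k = line_word pr t k"
  proof (cases "k \<in> LN")
    case True
    then obtain b where "b \<in> LD" "k = t b" using label_box[OF t] by blast
    then show ?thesis using line_word_tableau[OF t] w(2) by simp
  next
    case False
    then show ?thesis using w(1) unfolding zero_off_def line_word_def by auto
  qed
qed

lemma filling_line_words:
  assumes t: "t \<in> tableaux lam"
  shows "filling LN LD (line_word fst t) (line_word snd t)"
proof -
  have "bij_betw (\<lambda>k. (line_word fst t k, line_word snd t k)) LN LD"
    by (rule iffD1[OF bij_betw_cong bij_betw_inv_into[OF tableau_bij[OF t]]]) (simp add: line_word_def)
  then show ?thesis by (simp add: filling_def zero_off_line_word)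
qed

lemma filling_tableau:
  assumes f: "filling LN LD w y"
  obtains t where "t \<in> tableaux lam" "w = line_word fst t" "y = line_word snd t"
proof -
  have b: "bij_betw (\<lambda>k. (w k, y k)) LN LD" using f by (simp add: filling_def)
  define t where "t = restrict (inv_into LN (\<lambda>k. (w k, y k))) LD"
  have "bij_betw t LD LN"
    by (rule iffD1[OF bij_betw_cong bij_betw_inv_into[OF b]]) (simp add: t_def)
  then have t: "t \<in> tableaux lam" by (simp add: tableaux_def t_def)
  have "(w (t d), y (t d)) = d" if "d \<in> LD" for d
    using bij_betw_inv_into_right[OF b that] that by (simp add: t_def)
  then have "w (t d) = fst d" "y (t d) = snd d" if "d \<in> LD" for d
    using that by (metis fst_conv, metis snd_conv)
  then show ?thesis using f by (intro that[OF t] eq_line_word[OF t]) (auto simp: filling_def)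
qed

lemma line_stabiliser_iff:
  assumes t: "t \<in> tableaux lam"
  shows "p \<in> line_stabiliser pr lam t \<longleftrightarrow> p permutes LN \<and> line_word pr t \<circ> p = line_word pr t"
proof -
  have line: "t ` {b \<in> LD. pr b = r} = {k \<in> LN. line_word pr t k = r}" for r
  proof (intro equalityI subsetI)
    show "k \<in> {k \<in> LN. line_word pr t k = r}" if "k \<in> t ` {b \<in> LD. pr b = r}" for k
      using that line_word_tableau[OF t, of _ pr] bij_betw_apply[OF tableau_bij[OF t]] by auto
    fix k assume k: "k \<in> {k \<in> LN. line_word pr t k = r}"
    then have "k \<in> LN" by simp
    from label_box[OF t this] obtain b where b: "b \<in> LD" "k = t b" ..
    have "pr b = r" using k line_word_tableau[OF t b(1), of pr] b(2) by simp
    then show "k \<in> t ` {b \<in> LD. pr b = r}" using b by blast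
  qed
  show ?thesis
  proof
    assume p: "p \<in> line_stabiliser pr lam t"
    then have perm: "p permutes LN" by (rule line_stabiliser_permutes)
    have "line_word pr t (p k) = line_word pr t k" for k
    proof (cases "k \<in> LN")
      case True
      have "p ` {l \<in> LN. line_word pr t l = line_word pr t k} = {l \<in> LN. line_word pr t l = line_word pr t k}"
        using p unfolding line_stabiliser_def line[symmetric] by blast
      then show ?thesis using True by blast
    next
      case False
      then show ?thesis using permutes_not_in[OF perm] by simp
    qed
    then show "p permutes LN \<and> line_word pr t \<circ> p = line_word pr t" using perm by auto
  next
    assume p: "p permutes LN \<and> line_word pr t \<circ> p = line_word pr t"
    have perm: "p permutes LN" and lw: "line_word pr t (p k) = line_word pr t k" for k
      using p by (auto simp: fun_eq_iff)
    have "p ` {k \<in> LN. line_word pr t k = r} = {k \<in> LN. line_word pr t k = r}" for r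
    proof (rule endo_inj_surj)
      show "p ` {k \<in> LN. line_word pr t k = r} \<subseteq> {k \<in> LN. line_word pr t k = r}"
        using lw permutes_in_image[OF perm] by auto
      show "inj_on p {k \<in> LN. line_word pr t k = r}"
        by (rule inj_on_subset[OF permutes_inj[OF perm]]) simp
    qed simp
    then show "p \<in> line_stabiliser pr lam t" unfolding line_stabiliser_def line using perm by blast
  qed
qed

lemma tableau_act_apply: "b \<in> LD \<Longrightarrow> tableau_act lam p t b = p (t b)"
  by (simp add: tableau_act_def compose_def)

lemma line_word_act:
  assumes t: "t \<in> tableaux lam" and p: "p permutes LN"
  shows "line_word pr (tableau_act lam p t) = line_word pr t \<circ> inv' p"
proof (rule eq_line_word[symmetric, OF tableau_act_mem[OF t p]])
  show "zero_off LN (line_word pr t \<circ> inv' p)"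
    by (rule zero_off_comp[OF permutes_inv[OF p] zero_off_line_word])
  show "(line_word pr t \<circ> inv' p) (tableau_act lam p t b) = pr b" if "b \<in> LD" for b
    using line_word_tableau[OF t that] permutes_inverses(2)[OF p] that by (simp add: tableau_act_apply)
qed

lemma tableau_act_id: "t \<in> tableaux lam \<Longrightarrow> tableau_act lam id t = t"
  by (auto simp: tableaux_def tableau_act_def compose_def extensional_def fun_eq_iff)

lemma tabloid_of_eq:
  assumes t: "t \<in> tableaux lam"
  shows "tabloid_of lam t = word_tabloid (line_word fst t)"
proof
  show "tabloid_of lam t \<subseteq> word_tabloid (line_word fst t)"
  proof
    fix s assume "s \<in> tabloid_of lam t"
    then obtain p where p: "p permutes LN" "line_word fst t \<circ> p = line_word fst t" and s: "s = tableau_act lam p t"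
      using line_stabiliser_iff[OF t] by (auto simp: tabloid_of_def row_stabiliser_def)
    have "line_word fst t (p (t b)) = fst b" if "b \<in> LD" for b
      using fun_cong[OF p(2), of "t b"] line_word_tableau[OF t that] by simp
    then show "s \<in> word_tabloid (line_word fst t)"
      unfolding s word_tabloid_def using tableau_act_mem[OF t p(1)] by (simp add: tableau_act_apply)
  qed
  show "word_tabloid (line_word fst t) \<subseteq> tabloid_of lam t"
  proof
    fix s assume "s \<in> word_tabloid (line_word fst t)"
    then have s: "s \<in> tableaux lam" and sw: "\<And>b. b \<in> LD \<Longrightarrow> line_word fst t (s b) = fst b"
      by (auto simp: word_tabloid_def)
    define p where "p k = (if k \<in> LN then s (inv_into LD t k) else k)" for k
    have "bij_betw (s \<circ> inv_into LD t) LN LN"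
      using bij_betw_trans[OF bij_betw_inv_into[OF tableau_bij[OF t]] tableau_bij[OF s]] .
    then have "bij_betw p LN LN" by (rule iffD1[OF bij_betw_cong, rotated]) (simp add: p_def)
    then have p: "p permutes LN" by (rule bij_imp_permutes) (auto simp: p_def)
    have ps: "p (t b) = s b" if "b \<in> LD" for b
      using that bij_betw_apply[OF tableau_bij[OF t]] bij_betw_inv_into_left[OF tableau_bij[OF t]]
      by (simp add: p_def)
    have "line_word fst t \<circ> p = line_word fst t"
      by (rule eq_line_word[OF t zero_off_comp[OF p zero_off_line_word]]) (simp add: ps sw)
    then have "p \<in> row_stabiliser lam t" unfolding row_stabiliser_def line_stabiliser_iff[OF t] using p by blast
    moreover have "s = tableau_act lam p t"
      using s ps by (auto simp: tableaux_def tableau_act_def compose_def extensional_def fun_eq_iff)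
    ultimately show "s \<in> tabloid_of lam t" by (auto simp: tabloid_of_def)
  qed
qed

lemma mem_word_tabloid:
  assumes "t \<in> word_tabloid w" "zero_off LN w"
  shows "t \<in> tableaux lam" "w = line_word fst t"
  using assms eq_line_word[of t w fst] by (auto simp: word_tabloid_def)

lemma tableau_in_word_tabloid: "t \<in> tableaux lam \<Longrightarrow> t \<in> word_tabloid (line_word fst t)"
  by (simp add: word_tabloid_def line_word_tableau)

lemma word_tabloid_inject:
  assumes t: "t \<in> tableaux lam" and w: "zero_off LN w" and eq: "word_tabloid w = word_tabloid (line_word fst t)"
  shows "w = line_word fst t"
  using mem_word_tabloid(2)[OF _ w] tableau_in_word_tabloid[OF t] eq by blast

text \<open>
  Words that do not vanish off the labels describe the same tabloids as their restrictions, so the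
  value there is set to 0.
\<close>

definition to_words :: "(tabloid \<Rightarrow> 'a::field) \<Rightarrow> word \<Rightarrow> 'a" where
  "to_words f w = (if zero_off LN w then f (word_tabloid w) else 0)"

lemma linear_to_words: "Vector_Spaces.linear fscale fscale (to_words :: (tabloid \<Rightarrow> 'a::field) \<Rightarrow> _)"
  by unfold_locales (auto simp: to_words_def fscale_def fun_eq_iff)

lemma perm_module_support:
  assumes "f \<in> perm_module lam" "X \<notin> tabloids lam"
  shows "f X = (0 :: 'a::field)"
  using assms(1) unfolding perm_module_def
proof (induction rule: fv.span_induct_alt)
  case (step c b g)
  then show ?case using assms(2) by (auto simp: fscale_def tabloid_vec_def)
qed simp

lemma inj_to_words: "inj_on to_words (perm_module lam :: (tabloid \<Rightarrow> 'a::field) set)"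
proof (rule inj_onI)
  fix f g :: "tabloid \<Rightarrow> 'a"
  assume fg: "f \<in> perm_module lam" "g \<in> perm_module lam" "to_words f = to_words g"
  show "f = g"
  proof
    fix X
    show "f X = g X"
    proof (cases "X \<in> tabloids lam")
      case True
      then obtain t where t: "t \<in> tableaux lam" "X = word_tabloid (line_word fst t)"
        by (auto simp: tabloids_def tabloid_of_eq)
      then show ?thesis
        using fun_cong[OF fg(3), of "line_word fst t"] by (simp add: to_words_def zero_off_line_word)
    next
      case False
      then show ?thesis using perm_module_support fg by metis
    qed
  qed
qed

lemma tabloid_act_word_tabloid:
  assumes p: "p permutes LN"
  shows "tabloid_act lam p (word_tabloid (w \<circ> p)) = word_tabloid w"
proof
  show "tabloid_act lam p (word_tabloid (w \<circ> p)) \<subseteq> word_tabloid w"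
    using tableau_act_mem[OF _ p] by (auto simp: tabloid_act_def word_tabloid_def tableau_act_apply)
  show "word_tabloid w \<subseteq> tabloid_act lam p (word_tabloid (w \<circ> p))"
  proof
    fix t assume t: "t \<in> word_tabloid w"
    have ip: "inv' p permutes LN" by (rule permutes_inv[OF p])
    have "tableau_act lam (inv' p) t \<in> word_tabloid (w \<circ> p)"
      using t tableau_act_mem[OF _ ip] permutes_inverses(1)[OF p] by (auto simp: word_tabloid_def tableau_act_apply)
    moreover have "tableau_act lam p (tableau_act lam (inv' p) t) = t"
      using t tableau_act_id by (simp add: tableau_act_comp permutes_inv_o(1)[OF p] word_tabloid_def)
    ultimately show "t \<in> tabloid_act lam p (word_tabloid (w \<circ> p))"
      unfolding tabloid_act_def by (metis imageI)
  qed
qed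

lemma to_words_act:
  assumes f: "f \<in> (perm_module lam :: (tabloid \<Rightarrow> 'a::field) set)" and p: "p permutes LN"
  shows "to_words (perm_act lam p f) = wact p (to_words f)"
proof
  fix w
  show "to_words (perm_act lam p f) w = wact p (to_words f) w"
  proof (cases "zero_off LN w")
    case False
    then show ?thesis by (simp add: to_words_def wact_def zero_off_comp_iff[OF p])
  next
    case True
    have zp: "zero_off LN (w \<circ> p)" using True zero_off_comp[OF p] by blast
    have move: "word_tabloid w = tabloid_act lam p X \<longleftrightarrow> X = word_tabloid (w \<circ> p)" if X: "X \<in> tabloids lam" for X
    proof
      assume e: "word_tabloid w = tabloid_act lam p X"
      obtain t where t: "t \<in> tableaux lam" "X = word_tabloid (line_word fst t)"
        using X by (auto simp: tabloids_def tabloid_of_eq)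
      have pt: "tableau_act lam p t \<in> tableaux lam" by (rule tableau_act_mem[OF t(1) p])
      have "word_tabloid w = word_tabloid (line_word fst (tableau_act lam p t))"
        using e X t tabloid_act_tabloid_of[OF p, of t] tabloid_of_eq[OF t(1)] tabloid_of_eq[OF pt] by simp
      then have "w = line_word fst t \<circ> inv' p"
        using word_tabloid_inject[OF pt True] line_word_act[OF t(1) p] by simp
      then have "w \<circ> p = line_word fst t" by (simp add: comp_assoc permutes_inv_o(2)[OF p])
      then show "X = word_tabloid (w \<circ> p)" using t(2) by simp
    qed (simp add: tabloid_act_word_tabloid[OF p])
    have "perm_act lam p f (word_tabloid w) =
        (\<Sum>X\<in>tabloids lam. f X * of_bool (word_tabloid w = tabloid_act lam p X))"
      unfolding perm_act_def sum_fun_apply by (simp add: fscale_def tabloid_vec_def)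
    also have "\<dots> = (\<Sum>X\<in>tabloids lam. if X = word_tabloid (w \<circ> p) then f X else 0)"
      by (intro sum.cong) (auto simp: move)
    also have "\<dots> = f (word_tabloid (w \<circ> p))"
      using perm_module_support[OF f] finite_tabloids by auto
    finally show ?thesis using True zp by (simp add: to_words_def wact_def)
  qed
qed

text \<open>
  The polytabloid of \<open>t\<close> takes the value \<open>sign g\<close> at the word \<open>line_word fst t \<circ> g\<close> for \<open>g\<close> in the
  column stabiliser, which is also how \<^const>\<open>Delta\<close> varies.
\<close>

lemma to_words_polytabloid:
  assumes t: "t \<in> tableaux lam" and t0: "bij_betw t0 LD LN"
  shows "to_words (polytabloid lam t) =
    fscale (Delta LN LD t0 (line_word fst t) (line_word snd t))
      (\<lambda>w. Delta LN LD t0 w (line_word snd t) :: 'a::field)"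
proof
  fix w
  let ?w = "line_word fst t" and ?y = "line_word snd t"
  have N: "finite LN" by simp
  have ft: "filling LN LD ?w ?y" by (rule filling_line_words[OF t])
  have C: "p \<in> column_stabiliser lam t \<longleftrightarrow> p permutes LN \<and> ?y \<circ> p = ?y" for p
    unfolding column_stabiliser_def by (rule line_stabiliser_iff[OF t])
  have fC: "finite (column_stabiliser lam t)"
    by (rule finite_subset[OF _ finite_permutations[OF N]]) (auto simp: C)
  show "to_words (polytabloid lam t) w = fscale (Delta LN LD t0 ?w ?y) (\<lambda>w. Delta LN LD t0 w ?y :: 'a) w"
  proof (cases "zero_off LN w")
    case False
    then show ?thesis by (simp add: to_words_def fscale_def Delta_def filling_def)
  next
    case True
    have eq: "word_tabloid w = tabloid_act lam p (tabloid_of lam t) \<longleftrightarrow> w = ?w \<circ> inv' p"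
      if "p \<in> column_stabiliser lam t" for p
    proof -
      have p: "p permutes LN" using that C by blast
      have pt: "tableau_act lam p t \<in> tableaux lam" by (rule tableau_act_mem[OF t p])
      show ?thesis
        unfolding tabloid_act_tabloid_of[OF p] tabloid_of_eq[OF pt] line_word_act[OF t p, symmetric]
        using word_tabloid_inject[OF pt True] by blast
    qed
    have "to_words (polytabloid lam t :: tabloid \<Rightarrow> 'a) w = (\<Sum>p\<in>column_stabiliser lam t.
        of_int (sign p) * of_bool (word_tabloid w = tabloid_act lam p (tabloid_of lam t)))"
      using True unfolding to_words_def polytabloid_def sum_fun_apply
      by (simp add: fscale_def tabloid_vec_def)
    also have "\<dots> = (\<Sum>p\<in>column_stabiliser lam t. if w = ?w \<circ> inv' p then of_int (sign p) else 0)"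
      by (intro sum.cong) (auto simp: eq)
    also have "\<dots> = Delta LN LD t0 ?w ?y * Delta LN LD t0 w ?y"
    proof (cases "filling LN LD w ?y")
      case False
      have "w \<noteq> ?w \<circ> inv' p" if "p \<in> column_stabiliser lam t" for p
      proof
        assume w: "w = ?w \<circ> inv' p"
        have p: "p permutes LN" "?y \<circ> p = ?y" using that C by blast+
        have "?y = ?y \<circ> inv' p" using p(2) permutes_inv_o(1)[OF p(1)] by (metis comp_assoc comp_id)
        then show False using False ft filling_comp_iff[OF permutes_inv[OF p(1)], of LD ?w ?y] w by simp
      qed
      then have "(\<Sum>p\<in>column_stabiliser lam t. if w = ?w \<circ> inv' p then of_int (sign p) else 0) = (0 :: 'a)"
        by (intro sum.neutral) auto
      then show ?thesis using False by (simp add: Delta_def)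
    next
      case True
      obtain g where g: "g permutes LN" "w = ?w \<circ> g" "?y = ?y \<circ> g" by (rule filling_transitive[OF ft True])
      have ig: "inv' g permutes LN" by (rule permutes_inv[OF g(1)])
      have yig: "?y \<circ> inv' g = ?y" using g(3) permutes_inv_o(1)[OF g(1)] by (metis comp_assoc comp_id)
      have unique: "w = ?w \<circ> inv' p \<longleftrightarrow> p = inv' g" if "p \<in> column_stabiliser lam t" for p
      proof
        have p: "p permutes LN" "?y \<circ> p = ?y" using that C by blast+
        assume w: "w = ?w \<circ> inv' p"
        have yip: "?y \<circ> inv' p = ?y" using p permutes_inv_o(1)[OF p(1)] by (metis comp_assoc comp_id)
        have "inv' p k = g k" for k
        proof (cases "k \<in> LN")
          case True
          have "(?w (inv' p k), ?y (inv' p k)) = (?w (g k), ?y (g k))"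
            using fun_cong[OF w, of k] fun_cong[OF g(2), of k] fun_cong[OF g(3), of k] fun_cong[OF yip, of k] by simp
          moreover have "inv' p k \<in> LN" "g k \<in> LN"
            using True permutes_in_image[OF g(1)] permutes_in_image[OF permutes_inv[OF p(1)]] by blast+
          ultimately show ?thesis using ft unfolding filling_def bij_betw_def inj_on_def by blast
        next
          case False
          then show ?thesis using permutes_not_in[OF g(1)] permutes_not_in[OF permutes_inv[OF p(1)]] by simp
        qed
        then have "inv' p = g" by auto
        then show "p = inv' g" using permutes_inv_inv[OF p(1)] by simp
      next
        assume "p = inv' g"
        then show "w = ?w \<circ> inv' p" using g(2) permutes_inv_inv[OF g(1)] by simp
      qed
      have "(\<Sum>p\<in>column_stabiliser lam t. if w = ?w \<circ> inv' p then of_int (sign p) else 0) =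
          (\<Sum>p\<in>column_stabiliser lam t. if p = inv' g then of_int (sign p) else (0 :: 'a))"
        by (intro sum.cong) (auto simp: unique)
      also have "\<dots> = of_int (sign g)"
        using fC C ig yig sign_inverse[OF permutation_if_permutes[OF N g(1)]] by simp
      also have "\<dots> = Delta LN LD t0 ?w ?y * (of_int (sign g) * Delta LN LD t0 ?w ?y)"
        using Delta_square[OF ft, of t0, where ?'a = 'a] by (simp add: mult.left_commute)
      also have "of_int (sign g) * Delta LN LD t0 ?w ?y = (Delta LN LD t0 w ?y :: 'a)"
        using Delta_comp[OF N t0 g(1), of ?w ?y, where ?'a = 'a] g(2,3) by simp
      finally show ?thesis .
    qed
    finally show ?thesis by (simp add: fscale_def)
  qed
qed

lemma to_words_specht:
  assumes t0: "bij_betw t0 LD LN"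
  shows "to_words ` specht lam = (specht_words LN LD t0 :: (word \<Rightarrow> 'a::field) set)"
proof -
  interpret l: Vector_Spaces.linear fscale fscale "to_words :: (tabloid \<Rightarrow> 'a) \<Rightarrow> _"
    by (rule linear_to_words)
  have img: "to_words ` specht lam = fv.span (to_words ` (polytabloid lam ` tableaux lam :: (tabloid \<Rightarrow> 'a) set))"
    unfolding specht_def by (rule l.span_image[symmetric])
  show ?thesis
  proof
    show "to_words ` specht lam \<subseteq> (specht_words LN LD t0 :: (word \<Rightarrow> 'a) set)"
      unfolding img
    proof (rule fv.span_minimal[OF _ subspace_specht_words], rule subsetI)
      fix x :: "word \<Rightarrow> 'a" assume "x \<in> to_words ` (polytabloid lam ` tableaux lam)"
      then obtain t where "t \<in> tableaux lam" "x = to_words (polytabloid lam t)" by blast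
      then show "x \<in> specht_words LN LD t0"
        by (simp only: to_words_polytabloid[OF _ t0])
          (rule fv.subspace_scale[OF subspace_specht_words Delta_in_specht_words])
    qed
    show "(specht_words LN LD t0 :: (word \<Rightarrow> 'a) set) \<subseteq> to_words ` specht lam"
      unfolding img specht_words_def
    proof (rule fv.span_minimal[OF _ fv.subspace_span], rule subsetI)
      fix x :: "word \<Rightarrow> 'a" assume "x \<in> range (\<lambda>y w. Delta LN LD t0 w y)"
      then obtain y where x: "x = (\<lambda>w. Delta LN LD t0 w y)" by blast
      let ?T = "to_words ` (polytabloid lam ` tableaux lam :: (tabloid \<Rightarrow> 'a) set)"
      show "x \<in> fv.span ?T"
      proof (cases "\<exists>w. filling LN LD w y")
        case False
        then have "x = 0" by (auto simp: x Delta_def fun_eq_iff)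
        then show ?thesis using fv.span_zero by blast
      next
        case True
        then obtain w where f: "filling LN LD w y" by blast
        obtain t where t: "t \<in> tableaux lam" "w = line_word fst t" "y = line_word snd t"
          using filling_tableau[OF f] .
        let ?s = "Delta LN LD t0 w y :: 'a"
        have e: "to_words (polytabloid lam t) = fscale ?s x"
          unfolding x t(2,3) by (rule to_words_polytabloid[OF t(1) t0])
        have "fscale ?s (to_words (polytabloid lam t)) = x"
          unfolding e fv.scale_scale Delta_square[OF f] by (rule fv.scale_one)
        moreover have "fscale ?s (to_words (polytabloid lam t)) \<in> fv.span ?T"
          using t(1) by (intro fv.span_scale fv.span_base) blast
        ultimately show ?thesis by simp
      qed
    qed
  qed
qed

end


section \<open>The criterion\<close>

theorem theorem1p3:
  fixes n :: nat and lam :: "nat list"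
  assumes "odd CHAR('a::alg_closed_field)"
    and "n \<ge> 2"
    and "is_partition n lam"
  shows "decomposable (alt_group n) (perm_act lam) (specht lam :: (tabloid \<Rightarrow> 'a) set) \<longleftrightarrow>
    simple_module (sym_group n) (perm_act lam) (specht lam :: (tabloid \<Rightarrow> 'a) set) \<and>
    lam = conjugate lam"
proof -
  let ?D = "young_diagram lam"
  have n: "sum_list lam = n" using assms(3) by (simp add: is_partition_def)
  have two: "(2 :: 'a) \<noteq> 0"
  proof
    assume "(2 :: 'a) = 0"
    then have "CHAR('a) dvd 2" using of_nat_eq_0_iff_char_dvd[of 2, where ?'a = 'a] by simp
    then have "CHAR('a) = 1"
      using assms(1) by (metis dvd_refl prime_nat_iff two_is_prime_nat)
    then show False using CHAR_not_1[where ?'a = 'a] by simp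
  qed
  have D: "is_diagram ?D" by (rule is_diagram_young_diagram[OF assms(3)])
  have "card ?D = card {1..n}" using card_young_diagram[of lam] n by simp
  then obtain t0 where t0: "bij_betw t0 ?D {1..n}"
    using finite_same_card_bij[OF finite_young_diagram, of "{1..n}"] by auto
  interpret specht_setting n ?D t0 "TYPE('a)"
    by unfold_locales (rule two D t0)+
  let ?J = "to_words lam :: (tabloid \<Rightarrow> 'a) \<Rightarrow> word \<Rightarrow> 'a"
  have M: "submodule (sym_group n) (perm_act lam) (perm_module lam :: (tabloid \<Rightarrow> 'a) set)"
    using submodule_perm_module[of lam] n by simp
  have MA: "submodule (alt_group n) (perm_act lam) (perm_module lam :: (tabloid \<Rightarrow> 'a) set)"
    using M by (auto simp: submodule_def sym_group_carrier alt_group_carrier)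
  have act: "?J (perm_act lam g x) = wact g (?J x)" if "g permutes {1..n}" "x \<in> perm_module lam" for g x
    using to_words_act that n by blast
  have img: "?J ` specht lam = S" using to_words_specht[of t0 lam] t0 n by simp
  have "simple_module (sym_group n) wact (?J ` specht lam) \<longleftrightarrow>
      simple_module (sym_group n) (perm_act lam) (specht lam :: (tabloid \<Rightarrow> 'a) set)"
    by (rule simple_module_image[OF M linear_to_words inj_to_words _ specht_subset_perm_module])
      (simp add: act sym_group_carrier)
  moreover have "decomposable (alt_group n) wact (?J ` specht lam) \<longleftrightarrow>
      decomposable (alt_group n) (perm_act lam) (specht lam :: (tabloid \<Rightarrow> 'a) set)"
    by (rule decomposable_image[OF MA linear_to_words inj_to_words _ specht_subset_perm_module])
      (simp add: act alt_group_carrier)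
  ultimately show ?thesis
    using decomposable_iff[OF assms(2)] young_diagram_self_conjugate[OF assms(3)] unfolding img by blast
qed


end
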